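(* Assume that the Bateman--Horn conjecture holds uniformly for all primitive families with non-zero singular series, in the following sense: for every $\varepsilon>0$, every primitive family $\mathbf{g}=(g_1,\ldots,g_\ell)$ with $\mathfrak{S}(\mathbf{g})\neq 0$ and every $N\geq 2$, $$\pi(N;\mathbf{g})=\frac{1}{\mathrm{peg}(\mathbf{g})}\,\mathfrak{S}(\mathbf{g})\,\frac{N}{(\log N)^{\ell}}\Bigl(1+O\Bigl(\frac{c(\mathbf{g})^{\varepsilon}}{\log N}\Bigr)\Bigr),$$ where the implied constant depends at most on the degrees of the elements of $\mathbf{g}$ and on $\varepsilon$. Let $\mathbf{f}=(f_1,\ldots,f_m)$ be a fixed primitive family with $\mathfrak{S}(\mathbf{f})\neq 0$. For $N\geq 1$, let $$\delta(N,\mathbf{f})=\frac{\mathrm{peg}(\mathbf{f})}{\mathfrak{S}(\mathbf{f})}(\log N)^m.$$ Then for any $\lambda>0$ and any integer $r\geq 0$, we have $$\lim_{N\to+\infty}\frac1N\bigl|\{n\leq N\,\mid\,\pi(n+\lambda\delta(N,\mathbf{f});\mathbf{f})-\pi(n;\mathbf{f})=r\}\bigr|=e^{-\lambda}\frac{\lambda^r}{r!}.$$ In other words, for $N$ large, the number of $\mathbf{f}$-prime seeds in the intervals $]n,n+\lambda(\log N)^m]$, $1\le n\leq N$, is asymptotically distributed like a Poisson random variable with mean $\mathfrak{S}(\mathbf{f})\,\mathrm{peg}(\mathbf{f})^{-1}\lambda$.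
   Context: A finite family $\mathbf{f}=(f_1,\ldots,f_m)$ of polynomials in $\mathbf{Z}[X]$ of degrees $\deg(f_j)\geq 1$ is called primitive if the $f_j$ are distinct, and each $f_j$ is irreducible, has positive leading coefficient, and the gcd of its coefficients is $1$. An integer $n\geq 1$ is an $\mathbf{f}$-prime seed if $f_1(n),\ldots,f_m(n)$ are all (positive) primes. For real $x$, $\pi(x;\mathbf{f})$ is the number of $\mathbf{f}$-prime seeds $n\leq x$. Put $$\mathrm{peg}(\mathbf{f})=\prod_{j=1}^m\deg(f_j),\qquad c(\mathbf{f})=\sum_{1\leq j\leq m}H(f_j),\qquad H(a_0+a_1X+\cdots+a_dX^d)=\max_i|a_i|.$$ For a prime $p$, $\nu_p(\mathbf{f})$ is the number of $x\in\mathbf{Z}/p\mathbf{Z}$ such that $f_j(x)=0$ for some $j$. The singular series is $$\mathfrak{S}(\mathbf{f})=\prod_p\Bigl(1-\frac{\nu_p(\mathbf{f})}{p}\Bigr)\Bigl(1-\frac1p\Bigr)^{-m},$$ defined as the limit as $y\to+\infty$ of the partial products over primes $p\leq y$ (the product need not converge absolutely). *)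

theory Defs
  imports
    "HOL-Probability.Probability"
    "HOL-Number_Theory.Cong"
    "HOL-Computational_Algebra.Computational_Algebra"
begin

text \<open>
  A finite family \<open>(f\<^sub>1, \<dots>, f\<^sub>m)\<close> of integer polynomials is a list, with \<open>m\<close> its length.
  Families are nonempty: for \<open>m = 0\<close> every positive integer would be a prime seed.
\<close>

definition primitive_family :: "int poly list \<Rightarrow> bool" where
  "primitive_family fs \<longleftrightarrow>
     fs \<noteq> [] \<and> distinct fs \<and>
     (\<forall>f\<in>set fs. degree f \<ge> 1 \<and> irreducible f \<and> lead_coeff f > 0 \<and> content f = 1)"

text \<open>A prime of type \<^typ>\<open>int\<close> is positive by definition of \<^const>\<open>prime\<close>.\<close>

definition prime_seed :: "int poly list \<Rightarrow> nat \<Rightarrow> bool" where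
  "prime_seed fs n \<longleftrightarrow> n \<ge> 1 \<and> (\<forall>f\<in>set fs. prime (poly f (int n)))"

definition seed_count :: "real \<Rightarrow> int poly list \<Rightarrow> nat" where
  "seed_count x fs = card {n. prime_seed fs n \<and> real n \<le> x}"

definition peg :: "int poly list \<Rightarrow> nat" where
  "peg fs = (\<Prod>f\<leftarrow>fs. degree f)"

definition height :: "int poly \<Rightarrow> int" where
  "height f = (MAX i\<in>{..degree f}. \<bar>coeff f i\<bar>)"

definition height_sum :: "int poly list \<Rightarrow> int" where
  "height_sum fs = (\<Sum>f\<leftarrow>fs. height f)"

definition root_count :: "nat \<Rightarrow> int poly list \<Rightarrow> nat" where
  "root_count p fs = card {x\<in>{0..<p}. \<exists>f\<in>set fs. [poly f (int x) = 0] (mod int p)}"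

definition singular_partial_prod :: "int poly list \<Rightarrow> nat \<Rightarrow> real" where
  "singular_partial_prod fs y =
     (\<Prod>p | prime p \<and> p \<le> y.
        (1 - real (root_count p fs) / real p) * (1 - 1 / real p) powi (- int (length fs)))"

text \<open>
  For a primitive family the limit always exists (by the prime ideal theorem). The value \<open>0\<close> in the
  other branch is a convention for a total function; with it, a nonzero value of the singular
  series means that the limit exists and is nonzero.
\<close>

definition singular_series :: "int poly list \<Rightarrow> real" where
  "singular_series fs =
     (if convergent (singular_partial_prod fs) then lim (singular_partial_prod fs) else 0)"

text \<open>
  The implied constant \<open>C\<close> is a function of \<open>\<epsilon>\<close> and of the list of degrees only, and \<open>E\<close> is the
  relative error term.
\<close>

definition uniform_Bateman_Horn :: bool where
  "uniform_Bateman_Horn \<longleftrightarrow>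
     (\<exists>C :: real \<Rightarrow> nat list \<Rightarrow> real.
        \<forall>\<epsilon>>0. \<forall>gs. primitive_family gs \<longrightarrow> singular_series gs \<noteq> 0 \<longrightarrow>
          (\<forall>N::nat. N \<ge> 2 \<longrightarrow>
             (\<exists>E::real.
                real (seed_count (real N) gs) =
                  1 / real (peg gs) * singular_series gs * (real N / ln (real N) ^ length gs) * (1 + E) \<and>
                \<bar>E\<bar> \<le> C \<epsilon> (map degree gs) * (real_of_int (height_sum gs) powr \<epsilon> / ln (real N)))))"

definition mean_spacing :: "nat \<Rightarrow> int poly list \<Rightarrow> real" where
  "mean_spacing N fs = real (peg fs) / singular_series fs * ln (real N) ^ length fs"

end

theory Submission
  imports Defs "HOL-Real_Asymp.Real_Asymp"
begin

text \<open>
  The proof is the method of moments. The \<open>k\<close>-th factorial moment of the number of seeds in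
  \<open>]n, n + K]\<close> is a sum over \<open>h\<^sub>1, \<dots>, h\<^sub>k \<le> K\<close> of counts of seeds of the family of all \<open>f\<^sub>j(X + h\<^sub>i)\<close>,
  so the uniform conjecture reduces it to the average of the singular series of these families,
  which is \<open>\<SS>(f)\<^sup>k\<close>: the primes up to \<open>(log K)/4\<close> contribute a function of \<open>h\<close> with a period that is small
  compared with \<open>K\<close> and an average that the Chinese remainder theorem computes exactly, and the other primes
  contribute a factor that tends to \<open>1\<close> uniformly in \<open>h\<close>. Convergence of the Euler products
  follows by comparison with \<open>\<SS>(f)\<^sup>k\<close>, so the prime ideal theorem is not needed.

  The shifted polynomials may coincide when two \<open>h\<^sub>i\<close> are close (for instance for \<open>f = (X, X + 2)\<close>).
  Therefore only tuples with gaps larger than a constant \<open>L\<close> are used. The discarded pairs of seeds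
  \<open>n, n + d\<close> with \<open>0 < d \<le> L\<close> are rare: the conjecture for the families \<open>f(QX + a)\<close>, with \<open>Q\<close> a fixed
  primorial, bounds their density relative to the seeds by a product over \<open>p | Q\<close>, which tends to \<open>0\<close> as \<open>Q\<close> grows.
\<close>

section \<open>Primes, linear algebra and moments\<close>

text \<open>The shifts run up to a constant times \<open>(log N)^m\<close>, so the heights of the
  shifted families are at most a power of \<open>log N\<close>; for small \<open>\<epsilon>\<close>
  the height factor then loses against the denominator \<open>log N\<close>. This is where
  uniformity in the height enters. The cutoff \<open>(log K)/4\<close> meets two opposite demands.
  Its primorial is at most \<open>K^(1/2)\<close>, so \<open>K\<close> consecutive shifts cover many
  full periods. Beyond it, two shifts share a root only modulo primes dividing
  \<open>G(h - h')\<close>, a nonzero number of polynomial size in \<open>K\<close>; there are so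
  few of these that their total effect is \<open>O(1 / log log K)\<close>. The error is relative to
  the truncated product, so a zero singular series can only come from a local obstruction, which
  settles the families on which the conjecture is silent. \<open>G\<close> exists because
  \<open>Q[x, y]/(F(x), F(y))\<close> has dimension \<open>(deg F)^2\<close>, so powers of
  \<open>x - y\<close> are dependent there. Rarity of the \<open>n\<close> with a close pair of
  seeds does not by itself make them negligible in the moments. Cauchy-Schwarz does, since squared
  counts of separated tuples are bounded by counts of order up to \<open>2k\<close>.\<close>

lemma prod_coprime_dvd:
  fixes f :: "'a \<Rightarrow> 'b :: semiring_gcd"
  assumes "finite A" "\<And>x. x \<in> A \<Longrightarrow> f x dvd n"
    and "\<And>x y. x \<in> A \<Longrightarrow> y \<in> A \<Longrightarrow> x \<noteq> y \<Longrightarrow> coprime (f x) (f y)"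
  shows "prod f A dvd n"
  using assms
proof (induction A rule: finite_induct)
  case (insert x A)
  have "coprime (f x) (prod f A)"
    using insert by (intro prod_coprime_right) auto
  then show ?case using insert by (auto intro!: divides_mult)
qed simp

section \<open>Elementary estimates for primes and Euler products\<close>

abbreviation primes_upto :: "nat \<Rightarrow> nat set" ("\<P>") where "\<P> n \<equiv> {p. prime p \<and> p \<le> n}"

abbreviation primes_between :: "nat \<Rightarrow> nat \<Rightarrow> nat set" ("\<R>") where "\<R> z n \<equiv> {p. prime p \<and> z < p \<and> p \<le> n}"

text \<open>Erdos's induction. The primes in \<open>]m + 1, 2 * m + 1]\<close> divide the binomial
  coefficient of \<open>2 * m + 1\<close> over \<open>m\<close>, which is at most
  \<open>4 ^ m\<close> because it occurs twice in a row with sum \<open>2 * 4 ^ m\<close>. An even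
  \<open>n > 2\<close> adds no prime.\<close>

lemma primorial_le: "(\<Prod>p\<in>\<P> n. p) \<le> (4::nat) ^ n"
proof (induction n rule: less_induct)
  case (less n)
  consider "n \<le> 1" | "n = 2" | "n > 2" "even n" | m where "m \<ge> 1" "n = 2 * m + 1"
  proof -
    have "n \<le> 1 \<or> n = 2 \<or> n > 2 \<and> even n \<or> (\<exists>m\<ge>1. n = 2 * m + 1)"
    proof (cases "even n")
      case False
      then obtain m where "n = 2 * m + 1" by (auto elim: oddE)
      then show ?thesis by (cases m) auto
    qed auto
    then show ?thesis using that by blast
  qed
  then show ?case
  proof cases
    case 1
    then have "\<P> n = {}"
      by (auto dest: prime_ge_2_nat)
    then show ?thesis by (metis (no_types, lifting) one_le_numeral one_le_power prod.empty)
  next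
    case 2
    then have "\<P> n = {2}"
      using two_is_prime_nat by (auto dest: prime_ge_2_nat)
    then show ?thesis using 2 by simp
  next
    case 3
    then have "\<P> n = {p. prime p \<and> p \<le> n - 1}"
      by (auto simp: le_less) (metis even_iff_mod_2_eq_zero less_not_refl prime_odd_nat)
    then have "(\<Prod>p\<in>\<P> n. p) \<le> 4 ^ (n - 1)"
      using less.IH[of "n - 1"] 3 by auto
    also have "\<dots> \<le> 4 ^ n" by (intro power_increasing) auto
    finally show ?thesis .
  next
    case (4 m)
    let ?B = "{p. prime p \<and> m + 1 < p \<and> p \<le> 2 * m + 1}"
    have fin: "finite (\<P> (m + 1))" "finite ?B"
      by (auto intro: finite_subset[of _ "{..2 * m + 1}"])
    have split: "\<P> n = \<P> (m + 1) \<union> ?B"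
      using 4 by auto
    have dvd: "p dvd (2 * m + 1) choose m" if "p \<in> ?B" for p
    proof -
      have "p dvd fact m * fact (m + 1) * ((2 * m + 1) choose m)"
        using binomial_fact_lemma[of m "2 * m + 1"] that
        by (simp add: prime_dvd_fact_iff del: fact_Suc)
      moreover have "\<not> p dvd fact m" "\<not> p dvd fact (m + 1)"
        using that by (simp_all add: prime_dvd_fact_iff del: fact_Suc)
      ultimately show ?thesis
        using that by (auto simp: prime_dvd_mult_iff)
    qed
    have "(\<Prod>p\<in>?B. p) dvd (2 * m + 1) choose m"
      using dvd fin(2) by (intro prod_coprime_dvd) (auto simp: primes_coprime)
    then have "(\<Prod>p\<in>?B. p) \<le> (2 * m + 1) choose m"
      by (rule dvd_imp_le) simp
    also have "\<dots> \<le> 4 ^ m"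
    proof -
      have "2 * ((2 * m + 1) choose m) = (\<Sum>i\<in>{m, m+1}. (2 * m + 1) choose i)"
        using binomial_symmetric[of m "2 * m + 1"] by simp
      also have "\<dots> \<le> (\<Sum>i\<le>2*m+1. (2 * m + 1) choose i)"
        by (intro sum_mono2) auto
      also have "\<dots> = 2 * 4 ^ m"
        by (subst choose_row_sum) (simp add: power_mult)
      finally show ?thesis by simp
    qed
    finally have "(\<Prod>p\<in>?B. p) \<le> 4 ^ m" .
    moreover have "(\<Prod>p\<in>\<P> (m + 1). p) \<le> 4 ^ (m + 1)"
      using 4 by (intro less.IH) auto
    ultimately have "(\<Prod>p\<in>\<P> n. p) \<le> 4 ^ (m + 1) * 4 ^ m"
      unfolding split by (subst prod.union_disjoint) (use fin in \<open>auto intro!: mult_mono\<close>)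
    also have "\<dots> = 4 ^ n" using 4 by (simp add: power_add mult_2)
    finally show ?thesis .
  qed
qed

lemma finite_primes_le [simp]: "finite (\<P> n)"
  by (rule finite_subset[of _ "{..n}"]) auto

text \<open>Enlarged to all integers from 2 to \<open>n\<close>, the product telescopes to
  \<open>n\<close>. This is weaker than Mertens's theorem, but it will be applied with
  \<open>n\<close> of the order of a logarithm.\<close>

lemma prod_primes_inverse_le: "(\<Prod>p\<in>\<P> n. inverse (1 - 1 / real p)) \<le> max 1 (real n)"
proof -
  have "(\<Prod>p\<in>\<P> n. inverse (1 - 1 / real p)) \<le> (\<Prod>p\<in>{2..n}. inverse (1 - 1 / real p))"
    by (intro prod_mono2) (auto dest: prime_ge_2_nat simp: field_simps)
  also have "\<dots> \<le> max 1 (real n)"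
  proof (induction n)
    case (Suc n)
    show ?case
    proof (cases "n = 0")
      case False
      then have "{2..Suc n} = insert (Suc n) {2..n}" by auto
      then have "(\<Prod>p\<in>{2..Suc n}. inverse (1 - 1 / real p)) =
          (\<Prod>p\<in>{2..n}. inverse (1 - 1 / real p)) * inverse (1 - 1 / real (Suc n))"
        by simp
      also have "\<dots> \<le> real n * inverse (1 - 1 / real (Suc n))"
        using Suc False by (intro mult_right_mono) (auto simp: field_simps)
      also have "\<dots> = real (Suc n)" using False by (simp add: field_simps)
      finally show ?thesis by simp
    qed auto
  qed auto
  finally show ?thesis .
qed

text \<open>A finite form of the expansion of the Euler product. When a prime \<open>q\<close> joins
  \<open>P\<close>, a smooth integer is either free of \<open>q\<close> or \<open>q\<close> times a
  smooth integer, so the new sum \<open>s'\<close> and the old sum \<open>s\<close> satisfy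
  \<open>s' \<le> s + s' / q\<close>.\<close>

lemma sum_inverse_smooth_le:
  fixes P :: "nat set"
  assumes "finite P" "\<And>p. p \<in> P \<Longrightarrow> prime p"
  shows "(\<Sum>n | 1 \<le> n \<and> n \<le> N \<and> prime_factors n \<subseteq> P. 1 / real n) * (\<Prod>p\<in>P. 1 - 1 / real p) \<le> 1"
  using assms
proof (induction P rule: finite_induct)
  case empty
  have "{n. 1 \<le> n \<and> n \<le> N \<and> prime_factors n \<subseteq> {}} \<subseteq> {1}"
    by (auto simp: prime_factorization_empty_iff)
  then have "(\<Sum>n | 1 \<le> n \<and> n \<le> N \<and> prime_factors n \<subseteq> {}. 1 / real n) \<le> (\<Sum>n\<in>{1}. 1 / real n)"
    by (intro sum_mono2) auto
  then show ?case by simp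
next
  case (insert q P)
  define A where "A = (\<lambda>P. {n. 1 \<le> n \<and> n \<le> N \<and> prime_factors n \<subseteq> P})"
  have q: "prime q" using insert.prems by auto
  then have q2: "q \<ge> 2" by (rule prime_ge_2_nat)
  have fin: "finite (A P)" for P by (auto simp: A_def intro: finite_subset[of _ "{..N}"])
  have sub: "A (insert q P) \<subseteq> A P \<union> (\<lambda>n. q * n) ` A (insert q P)"
  proof
    fix n assume n: "n \<in> A (insert q P)"
    show "n \<in> A P \<union> (\<lambda>n. q * n) ` A (insert q P)"
    proof (cases "q dvd n")
      case True
      then obtain k where k: "n = q * k" by auto
      have "k dvd n" "k \<le> n" "k \<ge> 1" using k n q2 by (auto simp: A_def)
      moreover have "prime_factors k \<subseteq> prime_factors n"
        using \<open>k dvd n\<close> n by (intro dvd_prime_factors) (auto simp: A_def)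
      ultimately have "k \<in> A (insert q P)" using n by (auto simp: A_def)
      with k show ?thesis by blast
    next
      case False
      then have "n \<in> A P" using n by (auto simp: A_def in_prime_factors_iff)
      then show ?thesis by blast
    qed
  qed
  have "(\<Sum>n\<in>A (insert q P). 1 / real n) \<le> (\<Sum>n\<in>A P \<union> (\<lambda>n. q * n) ` A (insert q P). 1 / real n)"
    by (intro sum_mono2 sub) (auto simp: fin)
  also have "\<dots> \<le> (\<Sum>n\<in>A P. 1 / real n) + (\<Sum>n\<in>(\<lambda>n. q * n) ` A (insert q P). 1 / real n)"
    by (subst sum.union_inter[symmetric]) (auto simp: fin intro: sum_nonneg)
  also have "(\<Sum>n\<in>(\<lambda>n. q * n) ` A (insert q P). 1 / real n) = (\<Sum>n\<in>A (insert q P). 1 / real n) / real q"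
    using q2 by (subst sum.reindex) (auto simp: inj_on_def sum_divide_distrib field_simps)
  finally have "(\<Sum>n\<in>A (insert q P). 1 / real n) * (1 - 1 / real q) \<le> (\<Sum>n\<in>A P. 1 / real n)"
    by (simp add: field_simps)
  then have "(\<Sum>n\<in>A (insert q P). 1 / real n) * (1 - 1 / real q) * (\<Prod>p\<in>P. 1 - 1 / real p) \<le>
      (\<Sum>n\<in>A P. 1 / real n) * (\<Prod>p\<in>P. 1 - 1 / real p)"
  proof (intro mult_right_mono prod_nonneg)
    fix p assume "p \<in> P"
    then have "p > 0" using insert.prems prime_gt_0_nat by blast
    then show "0 \<le> 1 - 1 / real p" by (simp add: field_simps)
  qed
  also have "\<dots> \<le> 1" using insert by (auto simp: A_def)
  finally show ?case using insert by (simp add: A_def mult.assoc)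
qed

text \<open>Every positive integer up to \<open>n\<close> is composed of primes up to
  \<open>n\<close>, so the product is at most the inverse of a harmonic number.\<close>

lemma prod_primes_tendsto_0: "(\<lambda>n. \<Prod>p\<in>\<P> n. 1 - 1 / real p) \<longlonglongrightarrow> 0"
proof (rule tendsto_sandwich)
  have pos: "0 < (\<Prod>p\<in>\<P> n. 1 - 1 / real p)" for n
    by (intro prod_pos) (auto dest: prime_gt_1_nat simp: field_simps)
  then show "\<forall>\<^sub>F n in sequentially. 0 \<le> (\<Prod>p\<in>\<P> n. 1 - 1 / real p)"
    by (auto intro: always_eventually less_imp_le)
  show "\<forall>\<^sub>F n in sequentially. (\<Prod>p\<in>\<P> n. 1 - 1 / real p) \<le> inverse (harm n)"
  proof (rule eventually_sequentiallyI[of 1])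
    fix n :: nat assume n: "1 \<le> n"
    have eq: "{k. 1 \<le> k \<and> k \<le> n \<and> prime_factors k \<subseteq> \<P> n} = {1..n}"
      by (auto simp: in_prime_factors_iff dest!: dvd_imp_le)
    have "(\<Sum>k | 1 \<le> k \<and> k \<le> n \<and> prime_factors k \<subseteq> \<P> n. 1 / real k) *
        (\<Prod>p\<in>\<P> n. 1 - 1 / real p) \<le> 1"
      by (rule sum_inverse_smooth_le) auto
    then have "harm n * (\<Prod>p\<in>\<P> n. 1 - 1 / real p) \<le> 1"
      unfolding eq harm_def inverse_eq_divide .
    moreover have "(harm n :: real) > 0" using n by (intro harm_pos) auto
    ultimately show "(\<Prod>p\<in>\<P> n. 1 - 1 / real p) \<le> inverse (harm n)"
      by (metis inverse_eq_divide mult.commute pos_le_divide_eq)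
  qed
  show "(\<lambda>n. inverse (harm n :: real)) \<longlonglongrightarrow> 0"
    using harm_at_top tendsto_inverse_0_at_top by blast
qed auto

text \<open>Lagrange's bound. Splitting off a root by division by the monic \<open>X - a\<close>
  keeps the coefficients integral, and the quotient is again nonzero modulo
  \<open>p\<close>.\<close>

lemma card_poly_roots_mod_prime_le:
  fixes f :: "int poly" and p :: nat
  assumes "prime p" "\<not> (\<forall>i. int p dvd coeff f i)"
  shows "card {x\<in>{0..<p}. int p dvd poly f (int x)} \<le> degree f"
  using assms
proof (induction "degree f" arbitrary: f rule: less_induct)
  case less
  show ?case
  proof (cases "\<exists>a\<in>{0..<p}. int p dvd poly f (int a)")
    case False
    then have "{x\<in>{0..<p}. int p dvd poly f (int x)} = {}" by auto
    then show ?thesis by (metis (no_types, lifting) card.empty zero_le)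
  next
    case True
    then obtain a where a: "a < p" "int p dvd poly f (int a)" by auto
    define g where "g = synthetic_div f (int a)"
    have f: "f = [:-int a, 1:] * g + [:poly f (int a):]"
      using synthetic_div_correct'[of "int a" f] by (simp add: g_def)
    have nz: "degree f \<noteq> 0"
    proof
      assume "degree f = 0"
      then obtain c where "f = [:c:]" by (auto elim: degree_eq_zeroE)
      then have "int p dvd coeff f i" for i using a by (cases i) auto
      with less.prems show False by blast
    qed
    have deg: "degree g = degree f - 1" by (simp add: g_def degree_synthetic_div)
    have g: "\<not> (\<forall>i. int p dvd coeff g i)"
    proof
      assume *: "\<forall>i. int p dvd coeff g i"
      have "int p dvd coeff f i" for i
        by (subst f) (cases i, use * a in auto)
      with less.prems show False by blast
    qed
    have "{x\<in>{0..<p}. int p dvd poly f (int x)} \<subseteq> insert a {x\<in>{0..<p}. int p dvd poly g (int x)}"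
    proof
      fix x assume x: "x \<in> {x\<in>{0..<p}. int p dvd poly f (int x)}"
      have "poly f (int x) - poly f (int a) = (int x - int a) * poly g (int x)"
        by (subst (1) f) (simp add: algebra_simps)
      then have "int p dvd (int x - int a) * poly g (int x)"
        using x a by (metis (no_types, lifting) dvd_diff mem_Collect_eq)
      then have "int p dvd int x - int a \<or> int p dvd poly g (int x)"
        using less.prems by (simp add: prime_dvd_mult_iff)
      moreover have "x = a" if "int p dvd int x - int a"
      proof -
        have "int x mod int p = int a mod int p" using that by (simp add: mod_eq_dvd_iff)
        then show ?thesis using x a by (simp flip: zmod_int)
      qed
      ultimately show "x \<in> insert a {x\<in>{0..<p}. int p dvd poly g (int x)}" using x by auto
    qed
    then have "card {x\<in>{0..<p}. int p dvd poly f (int x)} \<le> card (insert a {x\<in>{0..<p}. int p dvd poly g (int x)})"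
      by (intro card_mono) auto
    also have "\<dots> \<le> Suc (card {x\<in>{0..<p}. int p dvd poly g (int x)})"
      by (rule card_insert_le_m1) auto
    also have "\<dots> \<le> Suc (degree g)"
      using less.hyps[of g] less.prems g deg nz by auto
    finally show ?thesis using deg nz by simp
  qed
qed

text \<open>Gaussian elimination without division: a pivot \<open>v m\<close> removes the coordinate
  \<open>a\<close> from the other vectors, and one vector and one coordinate fewer remain.\<close>

lemma int_vectors_dependent:
  fixes v :: "nat \<Rightarrow> 'a \<Rightarrow> int"
  assumes "finite I" "card I < n"
  shows "\<exists>c. (\<exists>k<n. c k \<noteq> 0) \<and> (\<forall>i\<in>I. (\<Sum>k<n. c k * v k i) = 0)"
  using assms
proof (induction I arbitrary: n v rule: finite_induct)
  case empty
  then show ?case by (intro exI[of _ "\<lambda>_. 1"]) auto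
next
  case (insert a I)
  show ?case
  proof (cases "\<forall>k<n. v k a = 0")
    case True
    have "card I < n" using insert by simp
    then obtain c where "\<exists>k<n. c k \<noteq> 0" "\<forall>i\<in>I. (\<Sum>k<n. c k * v k i) = 0"
      using insert.IH[of n v] by blast
    then show ?thesis using True by (intro exI[of _ c]) auto
  next
    case False
    then obtain m where m: "m < n" "v m a \<noteq> 0" by auto
    \<comment> \<open>\<open>s\<close> enumerates the indices other than the pivot; \<open>t\<close>
      below is its inverse.\<close>
    define s where "s = (\<lambda>k. if k < m then k else Suc k)"
    have n: "n = Suc (n - 1)" using m by simp
    have bij: "bij_betw s {..<n - 1} ({..<n} - {m})"
    proof (rule bij_betwI[where g = "\<lambda>k. if k < m then k else k - 1"])
      show "(\<lambda>k. if k < m then k else k - 1) \<in> {..<n} - {m} \<rightarrow> {..<n - 1}"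
        using m by (intro Pi_I) (simp; linarith)
    qed (use m in \<open>auto simp: s_def split: if_splits\<close>)
    define w where "w = (\<lambda>k i. v m a * v (s k) i - v (s k) a * v m i)"
    have "card I < n - 1" using insert by simp
    then obtain c where c: "\<exists>k<n-1. c k \<noteq> 0" "\<forall>i\<in>I. (\<Sum>k<n-1. c k * w k i) = 0"
      using insert.IH[of "n - 1" w] by blast
    define t where "t = (\<lambda>k. if k < m then k else k - 1)"
    have ts: "t (s k) = k" for k by (auto simp: t_def s_def)
    \<comment> \<open>The coefficient at the pivot is chosen so that the combination of the
      \<open>v k\<close> with coefficients \<open>d\<close> equals that of the \<open>w k\<close>
      with coefficients \<open>c\<close>; the coordinate \<open>a\<close> of every
      \<open>w k\<close> is zero.\<close>
    define d where "d = (\<lambda>k. if k = m then - (\<Sum>k<n-1. c k * v (s k) a) else v m a * c (t k))"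
    have sm: "s k \<noteq> m" for k by (auto simp: s_def)
    have sum: "(\<Sum>k<n. d k * v k i) = (\<Sum>k<n-1. c k * w k i)" for i
    proof -
      have "(\<Sum>k<n. d k * v k i) = d m * v m i + (\<Sum>k\<in>{..<n}-{m}. d k * v k i)"
        using m by (subst sum.remove[of _ m]) auto
      also have "(\<Sum>k\<in>{..<n}-{m}. d k * v k i) = (\<Sum>k<n-1. d (s k) * v (s k) i)"
        by (rule sum.reindex_bij_betw[OF bij, symmetric])
      also have "d m * v m i + \<dots> = (\<Sum>k<n-1. c k * w k i)"
        by (simp add: d_def sm ts w_def sum_distrib_right sum_distrib_left algebra_simps sum_subtractf)
      finally show ?thesis .
    qed
    have "(\<Sum>k<n. d k * v k i) = 0" if "i \<in> insert a I" for i
      using that c(2) unfolding sum by (auto simp: w_def algebra_simps)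
    moreover obtain k where k: "k < n - 1" "c k \<noteq> 0" using c by auto
    have "s k < n" using k by (auto simp: s_def)
    moreover have "d (s k) \<noteq> 0" using k m by (simp add: d_def sm ts)
    ultimately show ?thesis by (intro exI[of _ d]) blast
  qed
qed

lemma card_residues_crt:
  fixes P :: "nat set" and A :: "nat \<Rightarrow> nat set"
  assumes "finite P" "\<And>p. p \<in> P \<Longrightarrow> prime p" "\<And>p. p \<in> P \<Longrightarrow> A p \<subseteq> {0..<p}"
  shows "card {x\<in>{0..<\<Prod>P}. \<forall>p\<in>P. x mod p \<in> A p} = (\<Prod>p\<in>P. card (A p))"
proof -
  let ?f = "\<lambda>x. \<lambda>p\<in>P. x mod p"
  have crt: "\<exists>!x. x < (\<Prod>p\<in>P. p) \<and> (\<forall>p\<in>P. [x = u p] (mod p))" for u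
    using assms prime_gt_0_nat by (intro chinese_remainder_unique_nat) (auto simp: primes_coprime)
  have "bij_betw ?f {x\<in>{0..<\<Prod>P}. \<forall>p\<in>P. x mod p \<in> A p} (PiE P A)"
  proof (rule bij_betw_imageI)
    show "inj_on ?f {x\<in>{0..<\<Prod>P}. \<forall>p\<in>P. x mod p \<in> A p}"
    proof (rule inj_onI)
      fix x y assume x: "x \<in> {x\<in>{0..<\<Prod>P}. \<forall>p\<in>P. x mod p \<in> A p}"
        and y: "y \<in> {x\<in>{0..<\<Prod>P}. \<forall>p\<in>P. x mod p \<in> A p}" and eq: "?f x = ?f y"
      have "[x = y] (mod p)" if "p \<in> P" for p
        using fun_cong[OF eq, of p] that by (simp add: cong_def)
      then show "x = y" using crt[of "\<lambda>_. y"] x y by auto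
    qed
    show "?f ` {x\<in>{0..<\<Prod>P}. \<forall>p\<in>P. x mod p \<in> A p} = PiE P A"
    proof (intro equalityI subsetI)
      fix u assume u: "u \<in> PiE P A"
      obtain x where x: "x < \<Prod>P" "\<forall>p\<in>P. [x = u p] (mod p)" using crt[of u] by auto
      have "x mod p = u p" if "p \<in> P" for p
        using x(2) that PiE_mem[OF u that] assms(3)[OF that] by (auto simp: cong_def)
      then have "u = ?f x" "\<forall>p\<in>P. x mod p \<in> A p"
        using u PiE_mem[OF u] by (auto intro!: PiE_ext[OF u])
      with x show "u \<in> ?f ` {x\<in>{0..<\<Prod>P}. \<forall>p\<in>P. x mod p \<in> A p}" by auto
    qed auto
  qed
  then show ?thesis using assms(1) by (simp add: bij_betw_same_card card_PiE)
qed

text \<open>A substitute for the resultant that serves every modulus \<open>n\<close> at once. If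
  \<open>n\<close> divides \<open>F(x)\<close> and \<open>F(y)\<close>, then up to a fixed
  multiplier each power of \<open>x\<close> and of \<open>y\<close> reduces to powers below
  \<open>M\<close>. So the powers of \<open>x - y\<close> become combinations of the
  \<open>M * M\<close> monomials \<open>x^i y^j\<close>, with coefficients independent of
  \<open>x\<close>, \<open>y\<close> and \<open>n\<close>, and a linear relation between
  \<open>M * M + 1\<close> of them is \<open>G\<close>.\<close>

lemma ex_difference_poly:
  fixes F :: "int poly"
  assumes "F \<noteq> 0"
  shows "\<exists>G::int poly. G \<noteq> 0 \<and> (\<forall>n x y. n dvd poly F x \<longrightarrow> n dvd poly F y \<longrightarrow> n dvd poly G (x - y))"
proof -
  define M where "M = degree F"
  have "\<exists>a q r. a \<noteq> 0 \<and> smult a (monom 1 k) = F * q + r \<and> (r = 0 \<or> degree r < M)" for k :: nat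
    using pseudo_mod[OF assms, of "monom 1 k"] unfolding M_def by metis
  then obtain a q r where a: "\<And>k. a k \<noteq> (0::int)"
    and qr: "\<And>k. smult (a k) (monom 1 k) = F * q k + r k"
    and r: "\<And>k. r k = 0 \<or> degree (r k) < M"
    by metis
  \<comment> \<open>\<open>F\<close> need not be monic, so pseudo-division produces a multiplier
    \<open>a k\<close> for each exponent. \<open>A\<close> is a common multiple of those up to
    \<open>M * M\<close>, the largest exponent that occurs.\<close>
  define A where "A = (\<Prod>k\<le>M*M. a k)"
  have A0: "A \<noteq> 0" using a by (simp add: A_def)
  define R where "R = (\<lambda>k i. (\<Prod>l\<in>{..M*M}-{k}. a l) * coeff (r k) i)"
  have red: "[A * x ^ k = (\<Sum>i<M. R k i * x ^ i)] (mod n)" if "n dvd poly F x" "k \<le> M * M" for n x k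
  proof -
    have "a k * x ^ k = poly F x * poly (q k) x + poly (r k) x"
      using arg_cong[OF qr[of k], of "\<lambda>p. poly p x"] by (simp add: poly_monom)
    moreover have "poly (r k) x = (\<Sum>i<M. coeff (r k) i * x ^ i)"
    proof (cases "r k = 0")
      case False
      then have "degree (r k) < M" using r by auto
      then show ?thesis unfolding poly_altdef
        by (intro sum.mono_neutral_left) (auto simp: coeff_eq_0)
    qed auto
    ultimately have "[a k * x ^ k = (\<Sum>i<M. coeff (r k) i * x ^ i)] (mod n)"
      using that(1) by (simp add: cong_iff_dvd_diff)
    then have "[(\<Prod>l\<in>{..M*M}-{k}. a l) * (a k * x ^ k) =
        (\<Prod>l\<in>{..M*M}-{k}. a l) * (\<Sum>i<M. coeff (r k) i * x ^ i)] (mod n)"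
      by (rule cong_scalar_left)
    moreover have "A = a k * (\<Prod>l\<in>{..M*M}-{k}. a l)"
      using that by (simp add: A_def prod.remove[of _ k])
    ultimately show ?thesis
      by (simp add: R_def sum_distrib_left mult_ac)
  qed
  \<comment> \<open>The coefficient of \<open>x^i y^j\<close> in the binomial expansion of
    \<open>A^2 (x - y)^n\<close> once the powers of \<open>x\<close> and of \<open>y\<close> are
    reduced.\<close>
  define v where "v = (\<lambda>n (i, j). \<Sum>k\<le>n. of_nat (n choose k) * (-1) ^ (n - k) * R k i * R (n - k) j)"
  have swap3: "(\<Sum>k\<in>K. \<Sum>i\<in>I. \<Sum>j\<in>I. g k i j) = (\<Sum>i\<in>I. \<Sum>j\<in>I. \<Sum>k\<in>K. g k i j)"
    for g :: "nat \<Rightarrow> nat \<Rightarrow> nat \<Rightarrow> int" and K I :: "nat set"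
  proof -
    have "(\<Sum>k\<in>K. \<Sum>i\<in>I. \<Sum>j\<in>I. g k i j) = (\<Sum>i\<in>I. \<Sum>k\<in>K. \<Sum>j\<in>I. g k i j)" by (rule sum.swap)
    also have "\<dots> = (\<Sum>i\<in>I. \<Sum>j\<in>I. \<Sum>k\<in>K. g k i j)" by (intro sum.cong refl sum.swap)
    finally show ?thesis .
  qed
  have fac: "c * (\<Sum>i<M. f i * x ^ i) * (\<Sum>j<M. g j * y ^ j) = (\<Sum>i<M. \<Sum>j<M. c * f i * g j * x ^ i * y ^ j)"
    for c x y :: int and f g :: "nat \<Rightarrow> int"
  proof -
    have "c * (\<Sum>i<M. f i * x ^ i) * (\<Sum>j<M. g j * y ^ j) = (\<Sum>i<M. \<Sum>j<M. c * ((f i * x ^ i) * (g j * y ^ j)))"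
      by (simp only: mult.assoc sum_product) (simp only: sum_distrib_left)
    also have "\<dots> = (\<Sum>i<M. \<Sum>j<M. c * f i * g j * x ^ i * y ^ j)"
      by (intro sum.cong refl) simp
    finally show ?thesis .
  qed
  have "card ({..<M} \<times> {..<M}) < Suc (M * M)" by simp
  from int_vectors_dependent[OF _ this, of v]
  obtain c where c: "\<exists>k<Suc (M * M). c k \<noteq> 0"
    and c0: "\<And>i j. i < M \<Longrightarrow> j < M \<Longrightarrow> (\<Sum>k<Suc (M * M). c k * v k (i, j)) = 0"
    by fastforce
  define G where "G = (\<Sum>n<Suc (M * M). monom (c n * A\<^sup>2) n)"
  have "coeff G n = c n * A\<^sup>2" if "n < Suc (M * M)" for n
    using that by (simp add: G_def coeff_sum)
  then have "G \<noteq> 0" using c A0 by (metis coeff_0 mult_eq_0_iff power_eq_0_iff)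
  moreover have "n dvd poly G (x - y)" if n: "n dvd poly F x" "n dvd poly F y" for n x y
  proof -
    have pw: "[A\<^sup>2 * (x - y) ^ m = (\<Sum>i<M. \<Sum>j<M. v m (i, j) * x ^ i * y ^ j)] (mod n)" if m: "m < Suc (M * M)" for m
    proof -
      let ?c = "\<lambda>k. of_nat (m choose k) * (-1) ^ (m - k) :: int"
      have "A\<^sup>2 * (x - y) ^ m = A\<^sup>2 * (x + (-1) * y) ^ m" by simp
      also have "\<dots> = (\<Sum>k\<le>m. ?c k * (A * x ^ k) * (A * y ^ (m - k)))"
        by (subst binomial_ring) (simp add: sum_distrib_left power2_eq_square power_mult_distrib power_minus[of y] mult_ac)
      finally have 1: "A\<^sup>2 * (x - y) ^ m = (\<Sum>k\<le>m. ?c k * (A * x ^ k) * (A * y ^ (m - k)))" .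
      have 2: "[(\<Sum>k\<le>m. ?c k * (A * x ^ k) * (A * y ^ (m - k))) =
          (\<Sum>k\<le>m. ?c k * (\<Sum>i<M. R k i * x ^ i) * (\<Sum>j<M. R (m - k) j * y ^ j))] (mod n)"
        using m n by (intro cong_sum cong_mult cong_refl red) auto
      have "(\<Sum>k\<le>m. ?c k * (\<Sum>i<M. R k i * x ^ i) * (\<Sum>j<M. R (m - k) j * y ^ j)) =
          (\<Sum>k\<le>m. \<Sum>i<M. \<Sum>j<M. ?c k * R k i * R (m - k) j * x ^ i * y ^ j)"
        by (simp only: fac)
      also have "\<dots> = (\<Sum>i<M. \<Sum>j<M. \<Sum>k\<le>m. ?c k * R k i * R (m - k) j * x ^ i * y ^ j)"
        by (rule swap3)
      also have "\<dots> = (\<Sum>i<M. \<Sum>j<M. v m (i, j) * x ^ i * y ^ j)"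
        by (simp only: v_def sum_distrib_right prod.case)
      finally show ?thesis using 2 unfolding 1 by (simp only:)
    qed
    have 1: "poly G (x - y) = (\<Sum>m<Suc (M * M). c m * (A\<^sup>2 * (x - y) ^ m))"
      by (simp only: G_def poly_sum poly_monom mult.assoc)
    have 2: "[(\<Sum>m<Suc (M * M). c m * (A\<^sup>2 * (x - y) ^ m)) =
        (\<Sum>m<Suc (M * M). c m * (\<Sum>i<M. \<Sum>j<M. v m (i, j) * x ^ i * y ^ j))] (mod n)"
      by (intro cong_sum cong_mult cong_refl pw) auto
    have "(\<Sum>m<Suc (M * M). c m * (\<Sum>i<M. \<Sum>j<M. v m (i, j) * x ^ i * y ^ j)) =
        (\<Sum>m<Suc (M * M). \<Sum>i<M. \<Sum>j<M. c m * v m (i, j) * (x ^ i * y ^ j))"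
      by (simp only: sum_distrib_left mult.assoc)
    also have "\<dots> = (\<Sum>i<M. \<Sum>j<M. \<Sum>m<Suc (M * M). c m * v m (i, j) * (x ^ i * y ^ j))"
      by (rule swap3)
    also have "\<dots> = (\<Sum>i<M. \<Sum>j<M. (\<Sum>m<Suc (M * M). c m * v m (i, j)) * (x ^ i * y ^ j))"
      by (simp only: sum_distrib_right)
    also have "\<dots> = 0" by (intro sum.neutral ballI) (simp only: c0 lessThan_iff mult_zero_left)
    finally show ?thesis using 2 unfolding 1 by (simp only: cong_0_iff)
  qed
  ultimately show ?thesis by blast
qed

text \<open>The primes multiply to a divisor of \<open>D\<close>, so \<open>z ^ card P\<close> is at
  most the absolute value of \<open>D\<close>. It will bound the number of primes at which two
  shifts collide.\<close>

lemma card_prime_divisors_le: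
  fixes D :: int and P :: "nat set"
  assumes "D \<noteq> 0" "finite P" "z > 0" "\<And>p. p \<in> P \<Longrightarrow> prime p \<and> real p \<ge> z \<and> int p dvd D"
  shows "real (card P) * ln z \<le> ln \<bar>real_of_int D\<bar>"
proof -
  have "(\<Prod>p\<in>P. int p) dvd D"
    using assms by (intro prod_coprime_dvd) (auto simp: primes_coprime)
  then have "\<bar>\<Prod>p\<in>P. int p\<bar> \<le> \<bar>D\<bar>" using assms(1) by (metis dvd_imp_le_int)
  then have "real_of_int (\<Prod>p\<in>P. int p) \<le> \<bar>real_of_int D\<bar>" by linarith
  moreover have "z ^ card P \<le> (\<Prod>p\<in>P. real p)"
    using assms by (subst prod_constant[symmetric]) (intro prod_mono, auto)
  ultimately have "z ^ card P \<le> \<bar>real_of_int D\<bar>" by (simp add: of_nat_prod)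
  then have "ln (z ^ card P) \<le> ln \<bar>real_of_int D\<bar>" using assms by (subst ln_le_cancel_iff) auto
  then show ?thesis using assms by (simp add: ln_realpow)
qed

section \<open>Euler factors close to 1\<close>

lemma abs_prod_minus_1_le:
  fixes f :: "nat \<Rightarrow> real"
  shows "\<bar>(\<Prod>x\<in>A. f x) - 1\<bar> \<le> exp (\<Sum>x\<in>A. \<bar>f x - 1\<bar>) - 1"
proof (cases "finite A")
  case True
  have "\<bar>(\<Prod>x\<in>A. f x) - 1\<bar> \<le> (\<Prod>x\<in>A. 1 + \<bar>f x - 1\<bar>) - 1"
    using norm_prod_minus1_le_prod_minus1[of "\<lambda>x. f x - 1" A] by simp
  also have "(\<Prod>x\<in>A. 1 + \<bar>f x - 1\<bar>) \<le> (\<Prod>x\<in>A. exp \<bar>f x - 1\<bar>)"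
    by (intro prod_mono) (auto simp: add_nonneg_nonneg)
  finally show ?thesis using True by (simp add: exp_sum)
qed auto

text \<open>Here \<open>t\<close> stands for the proportion of roots modulo \<open>p\<close> of the
  family and \<open>u\<close> for that of \<open>k\<close> shifts of it. If the shifts have no root
  in common, then \<open>u = k * t\<close> and the linear terms of \<open>1 - u\<close> and
  \<open>(1 - t) ^ k\<close> cancel; what remains is summable over \<open>p\<close>. The factor
  \<open>2 ^ k\<close> bounds the inverse of the denominator.\<close>

lemma local_ratio_bounds:
  fixes t u :: real
  assumes "0 \<le> t" "t \<le> 1/2" "0 \<le> u" "u \<le> real k * t"
  shows "\<bar>(1 - u) / (1 - t) ^ k - 1\<bar> \<le> 2 ^ k * real k * t"
    and "u = real k * t \<Longrightarrow> \<bar>(1 - u) / (1 - t) ^ k - 1\<bar> \<le> 2 ^ k * (real k)\<^sup>2 * t\<^sup>2"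
proof -
  have pw: "(1/2) ^ k \<le> (1 - t) ^ k" using assms by (intro power_mono) auto
  have pos: "(1 - t) ^ k > 0" using assms by auto
  have eq: "\<bar>(1 - u) / (1 - t) ^ k - 1\<bar> = \<bar>1 - u - (1 - t) ^ k\<bar> / (1 - t) ^ k"
  proof -
    have "(1 - u) / (1 - t) ^ k - 1 = (1 - u - (1 - t) ^ k) / (1 - t) ^ k"
      using less_imp_neq[OF pos] by (metis diff_divide_distrib div_self)
    then show ?thesis using pos by (simp only: abs_divide abs_of_pos)
  qed
  have bern: "1 - real k * t \<le> (1 - t) ^ k"
    using Bernoulli_inequality[of "-t" k] assms by simp
  have le1: "(1 - t) ^ k \<le> 1" using assms by (intro power_le_one) auto
  have scale: "x / (1 - t) ^ k \<le> 2 ^ k * y" if "x \<le> y" "0 \<le> y" for x y :: real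
  proof -
    have "x / (1 - t) ^ k \<le> y / (1 - t) ^ k" using that pos by (intro divide_right_mono) auto
    also have "\<dots> \<le> y / (1/2) ^ k" using that pw pos by (intro divide_left_mono mult_pos_pos) auto
    finally show ?thesis by (simp add: power_one_over field_simps)
  qed
  have "\<bar>1 - u - (1 - t) ^ k\<bar> \<le> real k * t" using assms bern le1 by (simp add: abs_le_iff)
  then show "\<bar>(1 - u) / (1 - t) ^ k - 1\<bar> \<le> 2 ^ k * real k * t"
    unfolding eq using assms scale by (simp add: mult.assoc)
  assume u: "u = real k * t"
  have "(1 - t) ^ k \<le> 1 - real k * t + (real k)\<^sup>2 * t\<^sup>2"
  proof (induction k)
    case (Suc k)
    have "(1 - t) ^ Suc k \<le> (1 - t) * (1 - real k * t + (real k)\<^sup>2 * t\<^sup>2)"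
      using Suc assms by (simp add: mult_left_mono)
    also have "\<dots> = 1 - real (Suc k) * t + (real k + (real k)\<^sup>2) * t\<^sup>2 - (real k)\<^sup>2 * t ^ 3"
      by (simp add: algebra_simps power2_eq_square power3_eq_cube)
    also have "\<dots> \<le> 1 - real (Suc k) * t + (real (Suc k))\<^sup>2 * t\<^sup>2"
    proof -
      have "(real k + (real k)\<^sup>2) * t\<^sup>2 \<le> (real (Suc k))\<^sup>2 * t\<^sup>2"
        by (intro mult_right_mono) (auto simp: power2_eq_square algebra_simps)
      moreover have "0 \<le> (real k)\<^sup>2 * t ^ 3" using assms by simp
      ultimately show ?thesis by linarith
    qed
    finally show ?case .
  qed auto
  then have "\<bar>1 - u - (1 - t) ^ k\<bar> \<le> (real k)\<^sup>2 * t\<^sup>2" using u bern by (simp add: abs_le_iff)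
  then show "\<bar>(1 - u) / (1 - t) ^ k - 1\<bar> \<le> 2 ^ k * (real k)\<^sup>2 * t\<^sup>2"
    unfolding eq using scale by (simp add: mult.assoc)
qed

text \<open>Divided by \<open>r! j!\<close>, the factorial moment of order \<open>r + j\<close> is
  \<open>(x choose r) * ((x - r) choose j)\<close>. For \<open>x > r\<close> the alternating sum
  over \<open>j \<le> J\<close> of the second factor is, up to sign,
  \<open>(x - r - 1) choose J\<close>, which is at most \<open>(x - r) choose (J + 1)\<close>, the
  first omitted term.\<close>

lemma bonferroni_indicator:
  fixes x r J :: nat
  shows "\<bar>of_bool (x = r) - (\<Sum>j\<le>J. (-1) ^ j / (fact r * fact j) * (fact (r + j) * real (x choose (r + j))))\<bar> \<le>
    fact (r + Suc J) * real (x choose (r + Suc J)) / (fact r * fact (Suc J))"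
proof -
  have eq: "fact (r + j) * real (x choose (r + j)) / (fact r * fact j) = real (x choose r) * real ((x - r) choose j)" for j
  proof (cases "r + j \<le> x")
    case True
    have "real (x choose (r + j)) * real ((r + j) choose r) = real (x choose r) * real ((x - r) choose j)"
      using choose_mult[of r "r + j" x] True by (simp flip: of_nat_mult)
    moreover have "real ((r + j) choose r) = fact (r + j) / (fact r * fact j)"
      by (subst binomial_fact) auto
    ultimately show ?thesis by (simp add: mult_ac)
  next
    case False
    then show ?thesis by (cases "r \<le> x") (auto simp: binomial_eq_0)
  qed
  have "(\<Sum>j\<le>J. (-1) ^ j / (fact r * fact j) * (fact (r + j) * real (x choose (r + j)))) =
      (\<Sum>j\<le>J. (-1) ^ j * (fact (r + j) * real (x choose (r + j)) / (fact r * fact j)))"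
    by (intro sum.cong) auto
  also have "\<dots> = real (x choose r) * (\<Sum>j\<le>J. (-1) ^ j * real ((x - r) choose j))"
    unfolding eq by (simp add: sum_distrib_left mult_ac)
  finally have sum: "(\<Sum>j\<le>J. (-1) ^ j / (fact r * fact j) * (fact (r + j) * real (x choose (r + j)))) =
      real (x choose r) * (\<Sum>j\<le>J. (-1) ^ j * real ((x - r) choose j))" .
  consider "x < r" | "x = r" | d where "x - r = Suc d" by (cases "x - r") force+
  then show ?thesis
  proof cases
    case 2
    have "(\<Sum>j\<le>J. (-1) ^ j * real (0 choose j)) = (\<Sum>j\<in>{0}. (-1) ^ j * real (0 choose j))"
      by (intro sum.mono_neutral_right) auto
    then show ?thesis unfolding sum using 2 by simp
  next
    case (3 d)
    have "(\<Sum>j\<le>J. (-1) ^ j * real (Suc d choose j)) = (-1) ^ J * real (d choose J)"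
      using gbinomial_sum_lower_neg[of "real (Suc d)" J]
      by (simp add: binomial_gbinomial mult.commute)
    moreover have "real (d choose J) \<le> real (Suc d choose Suc J)" by simp
    ultimately show ?thesis unfolding sum eq using 3
      by (auto simp: abs_mult mult_left_mono)
  qed (auto simp: sum binomial_eq_0)
qed

text \<open>\<open>Y k N n\<close> will count separated \<open>k\<close>-tuples, and it is the
  factorial moment of \<open>X N n\<close> only outside \<open>Bad N\<close>. On
  \<open>Bad N\<close> the indicator of \<open>X N n = r\<close> is bounded by 1, and the hypothesis
  on squares controls \<open>Y\<close>.\<close>

lemma poisson_limit_of_moments:
  fixes X :: "nat \<Rightarrow> nat \<Rightarrow> nat" and Y :: "nat \<Rightarrow> nat \<Rightarrow> nat \<Rightarrow> nat" and Bad :: "nat \<Rightarrow> nat set"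
  assumes mom: "\<And>k. (\<lambda>N. (\<Sum>n=1..N. real (Y k N n)) / real N) \<longlonglongrightarrow> lam ^ k"
    and bad: "\<And>N. Bad N \<subseteq> {1..N}" "(\<lambda>N. real (card (Bad N)) / real N) \<longlonglongrightarrow> 0"
    and good: "\<And>k N n. n \<in> {1..N} - Bad N \<Longrightarrow> Y k N n = fact k * (X N n choose k)"
    and sq: "\<And>k. \<exists>C. \<forall>N n. real (Y k N n) ^ 2 \<le> C * (\<Sum>j\<le>2*k. real (Y j N n))"
  shows "(\<lambda>N. real (card {n\<in>{1..N}. X N n = r}) / real N) \<longlonglongrightarrow> exp (- lam) * (lam ^ r / fact r)"
proof -
  define b where "b = (\<lambda>N. real (card (Bad N)) / real N)"
  define m where "m = (\<lambda>k N. (\<Sum>n=1..N. real (Y k N n)) / real N)"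
  define bm where "bm = (\<lambda>k N. (\<Sum>n\<in>Bad N. real (Y k N n)) / real N)"
  have finB: "finite (Bad N)" for N using bad(1) finite_subset by blast
  have bm: "bm k \<longlonglongrightarrow> 0" for k
  proof -
    obtain C where C: "\<And>N n. real (Y k N n) ^ 2 \<le> C * (\<Sum>j\<le>2*k. real (Y j N n))" using sq by blast
    have "(bm k N)\<^sup>2 \<le> b N * (\<bar>C\<bar> * (\<Sum>j\<le>2*k. m j N))" for N
    proof -
      \<comment> \<open>Cauchy-Schwarz: the mean square of \<open>Y k\<close> is bounded by moments
        of order up to \<open>2 * k\<close>, which converge, so the vanishing density of
        \<open>Bad N\<close> makes the sum over \<open>Bad N\<close> negligible.\<close>
      have "(\<Sum>n\<in>Bad N. 1 * real (Y k N n))\<^sup>2 \<le> (\<Sum>n\<in>Bad N. 1\<^sup>2) * (\<Sum>n\<in>Bad N. (real (Y k N n))\<^sup>2)"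
        by (rule Cauchy_Schwarz_ineq_sum)
      also have "(\<Sum>n\<in>Bad N. (real (Y k N n))\<^sup>2) \<le> (\<Sum>n=1..N. (real (Y k N n))\<^sup>2)"
        using bad by (intro sum_mono2) auto
      also have "\<dots> \<le> (\<Sum>n=1..N. \<bar>C\<bar> * (\<Sum>j\<le>2*k. real (Y j N n)))"
      proof (rule sum_mono)
        fix n
        have "C * (\<Sum>j\<le>2*k. real (Y j N n)) \<le> \<bar>C\<bar> * (\<Sum>j\<le>2*k. real (Y j N n))"
          by (intro mult_right_mono sum_nonneg) auto
        then show "(real (Y k N n))\<^sup>2 \<le> \<bar>C\<bar> * (\<Sum>j\<le>2*k. real (Y j N n))" using C[of N n] by linarith
      qed
      also have "\<dots> = \<bar>C\<bar> * (\<Sum>j\<le>2*k. \<Sum>n=1..N. real (Y j N n))"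
        by (subst sum.swap) (simp add: sum_distrib_left)
      finally have "(\<Sum>n\<in>Bad N. real (Y k N n))\<^sup>2 \<le> real (card (Bad N)) * (\<bar>C\<bar> * (\<Sum>j\<le>2*k. \<Sum>n=1..N. real (Y j N n)))"
        by (simp add: mult_left_mono)
      then have "(\<Sum>n\<in>Bad N. real (Y k N n))\<^sup>2 / (real N)\<^sup>2 \<le> real (card (Bad N)) * (\<bar>C\<bar> * (\<Sum>j\<le>2*k. \<Sum>n=1..N. real (Y j N n))) / (real N)\<^sup>2"
        by (rule divide_right_mono) auto
      also have "\<dots> = b N * (\<bar>C\<bar> * (\<Sum>j\<le>2*k. m j N))"
        by (simp add: b_def m_def power2_eq_square sum_divide_distrib[symmetric])
      finally show ?thesis by (simp add: bm_def power_divide)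
    qed
    then have le: "\<forall>\<^sub>F N in sequentially. (bm k N)\<^sup>2 \<le> b N * (\<bar>C\<bar> * (\<Sum>j\<le>2*k. m j N))"
      by (intro always_eventually allI)
    have "(\<lambda>N. b N * (\<bar>C\<bar> * (\<Sum>j\<le>2*k. m j N))) \<longlonglongrightarrow> 0 * (\<bar>C\<bar> * (\<Sum>j\<le>2*k. lam ^ j))"
      unfolding m_def b_def by (intro tendsto_intros mom bad)
    then have lim: "(\<lambda>N. b N * (\<bar>C\<bar> * (\<Sum>j\<le>2*k. m j N))) \<longlonglongrightarrow> 0" by simp
    have ge: "\<forall>\<^sub>F N in sequentially. 0 \<le> (bm k N)\<^sup>2" by (intro always_eventually allI) simp
    have "(\<lambda>N. (bm k N)\<^sup>2) \<longlonglongrightarrow> 0"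
      by (rule tendsto_sandwich[OF ge le tendsto_const lim])
    then show ?thesis by simp
  qed
  let ?c = "\<lambda>j. (-1) ^ j / (fact r * fact j) :: real"
  define S where "S = (\<lambda>J N. \<Sum>j\<le>J. ?c j * m (r + j) N)"
  \<comment> \<open>In this order: the first omitted Bonferroni term, the indicator on
    \<open>Bad N\<close>, and the truncated alternating sum on \<open>Bad N\<close>.\<close>
  define err where "err = (\<lambda>J N. m (r + Suc J) N / (fact r * fact (Suc J)) + b N + (\<Sum>j\<le>J. bm (r + j) N))"
  define P where "P = (\<lambda>N. real (card {n\<in>{1..N}. X N n = r}) / real N)"
  have main: "\<bar>P N - S J N\<bar> \<le> err J N" for J N
  proof -
    define s where "s = (\<lambda>n. \<Sum>j\<le>J. ?c j * real (Y (r + j) N n))"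
    have g: "\<bar>of_bool (X N n = r) - s n\<bar> \<le> real (Y (r + Suc J) N n) / (fact r * fact (Suc J))"
      if "n \<in> {1..N} - Bad N" for n
      using bonferroni_indicator[of "X N n" r J] unfolding s_def good[OF that] of_nat_mult of_nat_fact .
    have bd: "\<bar>of_bool (X N n = r) - s n\<bar> \<le> 1 + (\<Sum>j\<le>J. real (Y (r + j) N n))" for n
    proof -
      have "\<bar>s n\<bar> \<le> (\<Sum>j\<le>J. \<bar>?c j * real (Y (r + j) N n)\<bar>)"
        unfolding s_def by (rule sum_abs)
      also have "\<dots> \<le> (\<Sum>j\<le>J. real (Y (r + j) N n))"
      proof (rule sum_mono)
        fix j
        have "1 \<le> (fact r * fact j :: real)" using mult_mono[of 1 "fact r" 1 "fact j :: real"] by simp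
        then have "1 / (fact r * fact j) * real (Y (r + j) N n) \<le> 1 * real (Y (r + j) N n)"
          by (intro mult_right_mono) auto
        then show "\<bar>?c j * real (Y (r + j) N n)\<bar> \<le> real (Y (r + j) N n)"
          by (simp add: abs_mult)
      qed
      finally show ?thesis by auto
    qed
    have "(\<Sum>n=1..N. of_bool (X N n = r) :: real) = real (card {n\<in>{1..N}. X N n = r})"
      by (simp add: of_bool_def sum.If_cases Int_def)
    moreover have "(\<Sum>n=1..N. s n) / real N = S J N"
      unfolding s_def S_def m_def
      by (subst sum.swap) (simp add: sum_divide_distrib sum_distrib_left)
    ultimately have "P N - S J N = (\<Sum>n=1..N. of_bool (X N n = r) - s n) / real N"
      by (simp add: P_def sum_subtractf diff_divide_distrib)
    also have "\<bar>\<dots>\<bar> \<le> (\<Sum>n=1..N. \<bar>of_bool (X N n = r) - s n\<bar>) / real N"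
      by (simp add: divide_right_mono sum_abs)
    also have "(\<Sum>n=1..N. \<bar>of_bool (X N n = r) - s n\<bar>) =
        (\<Sum>n\<in>{1..N}-Bad N. \<bar>of_bool (X N n = r) - s n\<bar>) + (\<Sum>n\<in>Bad N. \<bar>of_bool (X N n = r) - s n\<bar>)"
      using bad by (intro sum.subset_diff) auto
    also have "\<dots> \<le> (\<Sum>n\<in>{1..N}-Bad N. real (Y (r + Suc J) N n) / (fact r * fact (Suc J))) +
        (\<Sum>n\<in>Bad N. 1 + (\<Sum>j\<le>J. real (Y (r + j) N n)))"
      using g bd by (intro add_mono sum_mono) auto
    also have "\<dots> \<le> (\<Sum>n=1..N. real (Y (r + Suc J) N n) / (fact r * fact (Suc J))) +
        (\<Sum>n\<in>Bad N. 1 + (\<Sum>j\<le>J. real (Y (r + j) N n)))"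
      by (intro add_right_mono sum_mono2) auto
    finally have "\<bar>P N - S J N\<bar> \<le> ((\<Sum>n=1..N. real (Y (r + Suc J) N n) / (fact r * fact (Suc J))) +
        (\<Sum>n\<in>Bad N. 1 + (\<Sum>j\<le>J. real (Y (r + j) N n)))) / real N"
      by (simp add: divide_right_mono)
    also have "\<dots> = err J N"
      unfolding err_def m_def b_def bm_def sum.distrib
      by (subst sum.swap) (simp add: add_divide_distrib sum_divide_distrib mult_ac del: fact_Suc)
    finally show ?thesis .
  qed
  let ?S = "\<lambda>J. \<Sum>j\<le>J. ?c j * lam ^ (r + j)" and ?e = "\<lambda>J. lam ^ (r + Suc J) / (fact r * fact (Suc J))"
  define p where "p = exp (- lam) * (lam ^ r / fact r)"
  have exps: "(\<lambda>J. ?S J) \<longlonglongrightarrow> p"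
  proof -
    have "(\<lambda>J. \<Sum>j\<le>J. (- lam) ^ j / fact j) \<longlonglongrightarrow> exp (- lam)"
      using exp_converges[of "- lam"] unfolding sums_def_le by (simp add: scaleR_conv_of_real field_simps)
    then have "(\<lambda>J. lam ^ r / fact r * (\<Sum>j\<le>J. (- lam) ^ j / fact j)) \<longlonglongrightarrow> lam ^ r / fact r * exp (- lam)"
      by (intro tendsto_intros)
    also have "(\<lambda>J. lam ^ r / fact r * (\<Sum>j\<le>J. (- lam) ^ j / fact j)) =
        (\<lambda>J. ?S J)"
      by (simp add: sum_distrib_left power_add power_minus[of lam] mult_ac)
    finally show ?thesis by (simp add: p_def mult.commute)
  qed
  have tail: "(\<lambda>J. ?e J) \<longlonglongrightarrow> 0"
  proof -
    have "(\<lambda>j. lam ^ j / fact j) \<longlonglongrightarrow> 0" using summable_LIMSEQ_zero[OF summable_exp[of lam]] by (simp add: divide_inverse mult.commute)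
    then have "(\<lambda>j. lam ^ r / fact r * (lam ^ Suc j / fact (Suc j))) \<longlonglongrightarrow> lam ^ r / fact r * 0"
      by (intro tendsto_intros) (rule LIMSEQ_Suc)
    then show ?thesis by (simp add: power_add mult_ac del: fact_Suc)
  qed
  show ?thesis
    unfolding P_def[symmetric] p_def[symmetric]
  proof (rule tendstoI)
    fix e :: real assume "e > 0"
    \<comment> \<open>\<open>J\<close> is fixed first, so that the truncated Poisson series is close
      to its sum and the omitted term is small; only then does \<open>N\<close> grow.\<close>
    have "(\<lambda>J. \<bar>?S J - p\<bar> + ?e J)
        \<longlonglongrightarrow> \<bar>p - p\<bar> + 0"
      by (intro tendsto_intros exps tail)
    then have "\<forall>\<^sub>F J in sequentially. \<bar>?S J - p\<bar> +
        ?e J < e"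
      using \<open>e > 0\<close> by (intro order_tendstoD(2)) auto
    then obtain J where J: "\<bar>?S J - p\<bar> +
        ?e J < e"
      by (auto simp: eventually_sequentially)
    have "(\<lambda>N. \<bar>S J N - p\<bar> + err J N) \<longlonglongrightarrow> \<bar>?S J - p\<bar> +
        (?e J + 0 + (\<Sum>j\<le>J. 0))"
      unfolding S_def err_def m_def b_def by (intro tendsto_intros mom bad bm) auto
    then have "\<forall>\<^sub>F N in sequentially. \<bar>S J N - p\<bar> + err J N < e"
      using J by (intro order_tendstoD(2)) auto
    then show "\<forall>\<^sub>F N in sequentially. dist (P N) p < e"
    proof eventually_elim
      case (elim N)
      then show ?case using main[of N J] by (simp add: dist_real_def)
    qed
  qed
qed

section \<open>Affine images of families of polynomials\<close>

text \<open>Over a field, the substitution of \<open>a X + b\<close> is a degree-preserving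
  automorphism, inverse to that of \<open>(X - b) / a\<close>.\<close>

lemma irreducible_pcompose_linear:
  fixes p :: "'a :: field poly"
  assumes "a \<noteq> 0" "irreducible p"
  shows "irreducible (p \<circ>\<^sub>p [:b, a:])"
proof -
  let ?l = "[:b, a:]" and ?l' = "[:- b / a, 1 / a:]"
  have deg: "degree (q \<circ>\<^sub>p ?l) = degree q" "degree (q \<circ>\<^sub>p ?l') = degree q" for q :: "'a poly"
    using assms(1) by (simp_all add: degree_pcompose)
  have inv: "(q \<circ>\<^sub>p ?l) \<circ>\<^sub>p ?l' = q" for q :: "'a poly"
  proof -
    have "?l \<circ>\<^sub>p ?l' = [:0, 1:]" using assms(1) by (simp add: pcompose_pCons)
    then show ?thesis by (simp flip: pcompose_assoc)
  qed
  have unit: "q dvd 1 \<longleftrightarrow> q \<noteq> 0 \<and> degree q = 0" for q :: "'a poly"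
    by (metis is_unit_iff_degree not_is_unit_0)
  show ?thesis
  proof (rule irreducibleI)
    show "p \<circ>\<^sub>p ?l \<noteq> 0" using assms inv[of p] by auto
    show "\<not> p \<circ>\<^sub>p ?l dvd 1"
      using assms(2) unfolding irreducible_def unit deg(1) by auto
    fix u v assume "p \<circ>\<^sub>p ?l = u * v"
    then have "p = (u \<circ>\<^sub>p ?l') * (v \<circ>\<^sub>p ?l')" by (metis inv pcompose_mult)
    then have *: "u \<circ>\<^sub>p ?l' dvd 1 \<or> v \<circ>\<^sub>p ?l' dvd 1" using assms(2) irreducibleD by blast
    moreover have "q dvd 1" if "q \<circ>\<^sub>p ?l' dvd 1" for q :: "'a poly"
      using that unfolding unit deg(2) by auto
    ultimately show "u dvd 1 \<or> v dvd 1" by blast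
  qed
qed

lemma fract_poly_pcompose:
  fixes p q :: "'a :: idom poly"
  shows "fract_poly (p \<circ>\<^sub>p q) = fract_poly p \<circ>\<^sub>p fract_poly q"
  by (induction p) (simp_all add: pcompose_pCons map_poly_pCons)

lemma dvd_pcompose_diff:
  fixes f l l' :: "'a :: comm_ring_1 poly"
  assumes "d dvd l - l'"
  shows "d dvd f \<circ>\<^sub>p l - f \<circ>\<^sub>p l'"
proof (induction f)
  case (pCons a f)
  have "pCons a f \<circ>\<^sub>p l - pCons a f \<circ>\<^sub>p l' = (l - l') * (f \<circ>\<^sub>p l) + l' * (f \<circ>\<^sub>p l - f \<circ>\<^sub>p l')"
    by (simp add: pcompose_pCons algebra_simps)
  then show ?case using pCons assms by (simp add: dvd_add dvd_mult dvd_mult2)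
qed simp

text \<open>Suppose that a prime \<open>p\<close> divides all coefficients of
  \<open>f(a + q X)\<close>. Then it divides the constant term \<open>f(a)\<close>, hence not
  \<open>q\<close>. With \<open>r\<close> an inverse of \<open>q\<close> modulo \<open>p\<close>,
  the substitution of \<open>r (X - a)\<close> recovers \<open>f\<close> modulo \<open>p\<close>, so
  \<open>p\<close> divides \<open>f\<close>, against content 1.\<close>

lemma content_pcompose_linear:
  fixes f :: "int poly"
  assumes "content f = 1" "coprime (poly f a) q"
  shows "content (f \<circ>\<^sub>p [:a, q:]) = 1"
proof (rule ccontr)
  assume ne: "content (f \<circ>\<^sub>p [:a, q:]) \<noteq> 1"
  have "\<not> is_unit (content (f \<circ>\<^sub>p [:a, q:]))"
  proof
    assume "is_unit (content (f \<circ>\<^sub>p [:a, q:]))"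
    then have "\<bar>content (f \<circ>\<^sub>p [:a, q:])\<bar> = 1" by (simp add: zdvd1_eq)
    moreover have "content (f \<circ>\<^sub>p [:a, q:]) \<ge> 0" by (metis abs_ge_zero normalize_content normalize_int_def)
    ultimately show False using ne by simp
  qed
  then obtain p where p: "prime p" "p dvd content (f \<circ>\<^sub>p [:a, q:])"
  proof (cases "content (f \<circ>\<^sub>p [:a, q:]) = 0")
    case True
    then show ?thesis using that[of 2] by simp
  next
    case False
    then show ?thesis
      using that \<open>\<not> is_unit (content (f \<circ>\<^sub>p [:a, q:]))\<close> prime_divisor_exists by blast
  qed
  have dvd: "[:p:] dvd f \<circ>\<^sub>p [:a, q:]" using p by (simp add: const_poly_dvd_iff_dvd_content)
  then have "p dvd coeff (f \<circ>\<^sub>p [:a, q:]) 0" unfolding const_poly_dvd_iff by blast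
  then have "p dvd poly f a" by simp
  then have "\<not> p dvd q" using assms(2) p(1) by (meson coprime_common_divisor not_prime_unit)
  then have "coprime q p" using p(1) by (meson coprime_commute prime_imp_coprime)
  then obtain r where r: "[q * r = 1] (mod p)" using cong_solve_coprime_int by blast
  obtain k where "f \<circ>\<^sub>p [:a, q:] = [:p:] * k" using dvd by auto
  then have "(f \<circ>\<^sub>p [:a, q:]) \<circ>\<^sub>p [:- a * r, r:] = [:p:] * (k \<circ>\<^sub>p [:- a * r, r:])"
    by (simp only: pcompose_mult pcompose_const)
  then have "[:p:] dvd (f \<circ>\<^sub>p [:a, q:]) \<circ>\<^sub>p [:- a * r, r:]" by (simp only: dvd_triv_left)
  moreover have "(f \<circ>\<^sub>p [:a, q:]) \<circ>\<^sub>p [:- a * r, r:] = f \<circ>\<^sub>p [:a * (1 - q * r), q * r:]"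
    by (simp add: pcompose_assoc[symmetric] pcompose_pCons algebra_simps)
  moreover have "[:p:] dvd f \<circ>\<^sub>p [:a * (1 - q * r), q * r:] - f \<circ>\<^sub>p [:0, 1:]"
  proof (rule dvd_pcompose_diff)
    have "p dvd 1 - q * r" using r by (simp add: cong_iff_dvd_diff dvd_diff_commute)
    moreover from this have "p dvd q * r - 1" by (simp add: dvd_diff_commute)
    ultimately show "[:p:] dvd [:a * (1 - q * r), q * r:] - [:0, 1:]"
      by (simp add: const_poly_dvd_iff coeff_pCons split: nat.splits)
  qed
  ultimately have "[:p:] dvd f" by (metis dvd_diffD pcompose_idR dvd_diff_commute dvd_add_right_iff diff_add_cancel)
  then have "p dvd 1" using assms(1) by (simp only: const_poly_dvd_iff_dvd_content)
  then show False using p(1) not_prime_unit by blast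
qed

section \<open>Families of shifts and families along arithmetic progressions\<close>

definition affine_family :: "nat \<Rightarrow> nat \<Rightarrow> int poly list \<Rightarrow> int poly list" where
  "affine_family q a fs = map (\<lambda>f. f \<circ>\<^sub>p [:int a, int q:]) fs"

definition shifted_family :: "nat list \<Rightarrow> int poly list \<Rightarrow> int poly list" where
  "shifted_family hs fs = concat (map (\<lambda>h. affine_family 1 h fs) hs)"

lemma shifted_family_Nil [simp]: "shifted_family [] fs = []"
  and shifted_family_Cons [simp]: "shifted_family (h # hs) fs = affine_family 1 h fs @ shifted_family hs fs"
  by (simp_all add: shifted_family_def)

lemma length_affine_family [simp]: "length (affine_family q a fs) = length fs"
  by (simp add: affine_family_def)

lemma length_shifted_family [simp]: "length (shifted_family hs fs) = length hs * length fs"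
  by (induction hs) auto

lemma poly_affine: "poly (f \<circ>\<^sub>p [:int a, int q:]) (int x) = poly f (int (a + q * x))"
  by (simp add: poly_pcompose mult.commute)

lemma ball_affine_family:
  "(\<forall>g\<in>set (affine_family q a fs). P (poly g (int x))) \<longleftrightarrow> (\<forall>f\<in>set fs. P (poly f (int (a + q * x))))"
  by (simp add: affine_family_def poly_affine del: of_nat_add of_nat_mult)

lemma bex_affine_family:
  "(\<exists>g\<in>set (affine_family q a fs). P (poly g (int x))) \<longleftrightarrow> (\<exists>f\<in>set fs. P (poly f (int (a + q * x))))"
  by (simp add: affine_family_def poly_affine del: of_nat_add of_nat_mult)

lemma set_shifted_family: "set (shifted_family hs fs) = (\<Union>h\<in>set hs. set (affine_family 1 h fs))"
  by (simp add: shifted_family_def)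

lemma map_degree_affine_family: "q > 0 \<Longrightarrow> map degree (affine_family q a fs) = map degree fs"
  by (simp add: affine_family_def degree_pcompose)

lemma peg_affine_family: "q > 0 \<Longrightarrow> peg (affine_family q a fs) = peg fs"
  unfolding peg_def map_degree_affine_family by simp

lemma map_degree_shifted_family: "map degree (shifted_family hs fs) = concat (replicate (length hs) (map degree fs))"
  by (induction hs) (simp_all add: map_degree_affine_family)

lemma peg_append: "peg (fs @ gs) = peg fs * peg gs" by (simp add: peg_def)

lemma peg_shifted_family: "peg (shifted_family hs fs) = peg fs ^ length hs"
  by (induction hs) (simp_all add: peg_affine_family peg_append, simp add: peg_def)

lemma prime_seed_affine_family:
  "prime_seed (affine_family q a fs) x \<longleftrightarrow> x \<ge> 1 \<and> (\<forall>f\<in>set fs. prime (poly f (int (a + q * x))))"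
  unfolding prime_seed_def ball_affine_family ..

lemma prime_seed_shifted_family:
  "prime_seed (shifted_family hs fs) x \<longleftrightarrow> x \<ge> 1 \<and> (\<forall>h\<in>set hs. prime_seed fs (x + h))"
  unfolding prime_seed_def set_shifted_family
  using ball_affine_family[of 1 _ fs prime x] by (auto simp: add.commute)

section \<open>Roots of families modulo a prime\<close>

abbreviation local_density :: "int poly list \<Rightarrow> nat \<Rightarrow> real" ("\<delta>") where
  "\<delta> fs p \<equiv> 1 - real (root_count p fs) / real p"

definition divides_value :: "int poly list \<Rightarrow> nat \<Rightarrow> nat \<Rightarrow> bool" where
  "divides_value fs p x \<longleftrightarrow> (\<exists>f\<in>set fs. int p dvd poly f (int x))"

lemma root_count_altdef: "root_count p fs = card {x\<in>{0..<p}. divides_value fs p x}"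
  by (simp add: root_count_def divides_value_def cong_0_iff)

lemma cong_poly:
  fixes f :: "'a :: {comm_ring_1, unique_euclidean_ring} poly"
  shows "[x = y] (mod n) \<Longrightarrow> [poly f x = poly f y] (mod n)"
  by (induction f) (auto intro: cong_add cong_mult)

lemma divides_value_mod: "divides_value fs p (x mod p) \<longleftrightarrow> divides_value fs p x"
proof -
  have "[poly f (int (x mod p)) = poly f (int x)] (mod int p)" for f
    by (rule cong_poly) (simp add: zmod_int)
  then show ?thesis unfolding divides_value_def using cong_dvd_iff by blast
qed

lemma divides_value_cong: "[x = y] (mod p) \<Longrightarrow> divides_value fs p x \<longleftrightarrow> divides_value fs p y"
  using divides_value_mod[of fs p x] divides_value_mod[of fs p y] by (simp add: cong_def)

lemma divides_value_affine_family: "divides_value (affine_family q a fs) p x \<longleftrightarrow> divides_value fs p (a + q * x)"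
  unfolding divides_value_def bex_affine_family ..

lemma divides_value_append: "divides_value (fs @ gs) p x \<longleftrightarrow> divides_value fs p x \<or> divides_value gs p x"
  by (auto simp: divides_value_def)

lemma divides_value_shifted_family: "divides_value (shifted_family hs fs) p x \<longleftrightarrow> (\<exists>h\<in>set hs. divides_value fs p (x + h))"
  by (induction hs) (auto simp: divides_value_append divides_value_affine_family add.commute, auto simp: divides_value_def)

lemma root_count_le: "root_count p fs \<le> p"
  unfolding root_count_altdef by (rule order.trans[OF card_mono[of "{0..<p}"]]) auto

lemma root_count_affine_family:
  assumes "coprime q p"
  shows "root_count p (affine_family q a fs) = root_count p fs"
proof (cases "p = 0")
  case False
  let ?R = "{x\<in>{0..<p}. divides_value fs p x}"
  let ?R' = "{x\<in>{0..<p}. divides_value (affine_family q a fs) p x}"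
  let ?h = "\<lambda>x. (a + q * x) mod p"
  have inj: "inj_on ?h {0..<p}"
  proof (rule inj_onI)
    fix x y assume xy: "x \<in> {0..<p}" "y \<in> {0..<p}" "?h x = ?h y"
    then have "[a + q * x = a + q * y] (mod p)" by (simp add: cong_def)
    then have "[x = y] (mod p)" using assms by (simp add: cong_add_lcancel_nat cong_mult_lcancel_nat)
    then show "x = y" using xy by (simp add: cong_def)
  qed
  have surj: "?h ` {0..<p} = {0..<p}"
    using False by (intro card_subset_eq) (auto simp: card_image[OF inj])
  have "bij_betw ?h ?R' ?R"
  proof (rule bij_betw_imageI)
    show "inj_on ?h ?R'" by (rule inj_on_subset[OF inj]) auto
    show "?h ` ?R' = ?R"
    proof (intro equalityI subsetI)
      fix y assume y: "y \<in> ?R"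
      then obtain x where x: "x \<in> {0..<p}" "y = ?h x" using surj by (metis (no_types, lifting) image_iff mem_Collect_eq)
      then show "y \<in> ?h ` ?R'" using y by (auto simp: divides_value_mod divides_value_affine_family)
    qed (use False in \<open>auto simp: divides_value_mod divides_value_affine_family\<close>)
  qed
  then show ?thesis unfolding root_count_altdef by (rule bij_betw_same_card)
qed (simp add: root_count_def)

lemma root_count_append_le: "root_count p (fs @ gs) \<le> root_count p fs + root_count p gs"
proof -
  have "{x\<in>{0..<p}. divides_value (fs @ gs) p x} = {x\<in>{0..<p}. divides_value fs p x} \<union> {x\<in>{0..<p}. divides_value gs p x}"
    by (auto simp: divides_value_append)
  then show ?thesis unfolding root_count_altdef by (metis card_Un_le)
qed

lemma root_count_append_disjoint:
  assumes "\<And>x. divides_value fs p x \<Longrightarrow> divides_value gs p x \<Longrightarrow> False"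
  shows "root_count p (fs @ gs) = root_count p fs + root_count p gs"
proof -
  have "{x\<in>{0..<p}. divides_value (fs @ gs) p x} = {x\<in>{0..<p}. divides_value fs p x} \<union> {x\<in>{0..<p}. divides_value gs p x}"
    by (auto simp: divides_value_append)
  then show ?thesis unfolding root_count_altdef using assms
    by (subst card_Un_disjoint[symmetric]) auto
qed

lemma root_count_shifted_family_le: "root_count p (shifted_family hs fs) \<le> length hs * root_count p fs"
proof (induction hs)
  case Nil
  then show ?case by (simp add: root_count_def)
next
  case (Cons h hs)
  then show ?case
    using root_count_append_le[of p "affine_family 1 h fs" "shifted_family hs fs"]
    by (simp add: root_count_affine_family)
qed

text \<open>Content 1 keeps every member nonzero modulo \<open>p\<close>, so Lagrange's bound
  applies to each.\<close>

lemma root_count_le_sum_degree: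
  assumes "prime p" "\<And>f. f \<in> set fs \<Longrightarrow> content f = 1"
  shows "root_count p fs \<le> (\<Sum>f\<leftarrow>fs. degree f)"
  using assms(2)
proof (induction fs)
  case Nil
  then show ?case by (simp add: root_count_def)
next
  case (Cons f fs)
  have "\<not> int p dvd content f" using Cons.prems assms(1) by (auto dest: prime_gt_1_nat)
  then have "\<not> (\<forall>i. int p dvd coeff f i)"
    by (simp flip: const_poly_dvd_iff add: const_poly_dvd_iff_dvd_content)
  then have "root_count p [f] \<le> degree f"
    using card_poly_roots_mod_prime_le[OF assms(1)] by (simp add: root_count_altdef divides_value_def)
  then show ?case
    using Cons root_count_append_le[of p "[f]" fs] by (simp add: add_mono le_trans)
qed

lemma divides_value_prod_list:
  "divides_value fs p x \<Longrightarrow> int p dvd poly (prod_list fs) (int x)"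
  by (induction fs) (auto simp: divides_value_def simp del: of_nat_mult intro: dvd_mult dvd_mult2)

text \<open>The coprimality hypothesis gives content 1. Irreducibility goes through the fraction
  field by Gauss's lemma and back, because for \<open>q > 1\<close> the substitution is invertible
  only there.\<close>

lemma primitive_affine_family:
  assumes "primitive_family fs" "q > 0" "\<And>f. f \<in> set fs \<Longrightarrow> coprime (poly f (int a)) (int q)"
  shows "primitive_family (affine_family q a fs)"
proof -
  let ?l = "[:int a, int q:]"
  have "inj_on (\<lambda>f. f \<circ>\<^sub>p ?l) (set fs)"
  proof (rule inj_onI)
    fix f g assume "f \<circ>\<^sub>p ?l = g \<circ>\<^sub>p ?l"
    then have "(f - g) \<circ>\<^sub>p ?l = 0" by (simp add: pcompose_diff)
    then show "f = g" using assms(2) by (subst (asm) pcompose_eq_0_iff) auto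
  qed
  moreover have "degree (f \<circ>\<^sub>p ?l) \<ge> 1 \<and> irreducible (f \<circ>\<^sub>p ?l) \<and> lead_coeff (f \<circ>\<^sub>p ?l) > 0 \<and> content (f \<circ>\<^sub>p ?l) = 1"
    if f: "f \<in> set fs" for f
  proof (intro conjI)
    have p: "degree f \<ge> 1" "irreducible f" "lead_coeff f > 0" "content f = 1"
      using f assms(1) by (auto simp: primitive_family_def)
    show deg: "degree (f \<circ>\<^sub>p ?l) \<ge> 1" using p assms(2) by (simp add: degree_pcompose)
    show cont: "content (f \<circ>\<^sub>p ?l) = 1" using p assms(3)[OF f] by (intro content_pcompose_linear)
    show "lead_coeff (f \<circ>\<^sub>p ?l) > 0" using p assms(2) by (subst lead_coeff_comp) auto
    have "irreducible (fract_poly f)" using p by (subst (asm) nonconst_poly_irreducible_iff) auto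
    then have "irreducible (fract_poly f \<circ>\<^sub>p [:to_fract (int a), to_fract (int q):])"
      using assms(2) by (intro irreducible_pcompose_linear) auto
    also have "fract_poly f \<circ>\<^sub>p [:to_fract (int a), to_fract (int q):] = fract_poly (f \<circ>\<^sub>p ?l)"
      by (simp add: fract_poly_pcompose map_poly_pCons)
    finally show "irreducible (f \<circ>\<^sub>p ?l)" using cont deg by (subst nonconst_poly_irreducible_iff) auto
  qed
  ultimately show ?thesis
    using assms(1) by (auto simp: primitive_family_def affine_family_def distinct_map)
qed

section \<open>Growth of heights and values under shifts\<close>

lemma coeff_pcompose_shift_bound:
  fixes f :: "int poly"
  shows "\<exists>C e. C \<ge> 0 \<and> (\<forall>(h::nat) i. real_of_int \<bar>coeff (f \<circ>\<^sub>p [:int h, 1:]) i\<bar> \<le> C * (1 + real h) ^ e)"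
proof (induction f)
  case 0
  then show ?case by (intro exI[of _ 0]) auto
next
  case (pCons a f)
  then obtain C e where C: "C \<ge> 0" and *: "\<And>h i. real_of_int \<bar>coeff (f \<circ>\<^sub>p [:int h, 1:]) i\<bar> \<le> C * (1 + real h) ^ e"
    by blast
  have "real_of_int \<bar>coeff (pCons a f \<circ>\<^sub>p [:int h, 1:]) i\<bar> \<le> (\<bar>real_of_int a\<bar> + C) * (1 + real h) ^ Suc e" for h i
  proof -
    let ?g = "f \<circ>\<^sub>p [:int h, 1:]"
    have 1: "real_of_int \<bar>coeff (pCons a f \<circ>\<^sub>p [:int h, 1:]) i\<bar> \<le>
        \<bar>real_of_int a\<bar> + real h * real_of_int \<bar>coeff ?g i\<bar> + (case i of 0 \<Rightarrow> 0 | Suc j \<Rightarrow> real_of_int \<bar>coeff ?g j\<bar>)"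
      by (cases i) (auto simp: pcompose_pCons abs_mult intro!: order.trans[OF abs_triangle_ineq])
    have 2: "real h * real_of_int \<bar>coeff ?g i\<bar> \<le> real h * (C * (1 + real h) ^ e)" by (intro mult_left_mono *) auto
    have 3: "(case i of 0 \<Rightarrow> 0 | Suc j \<Rightarrow> real_of_int \<bar>coeff ?g j\<bar>) \<le> C * (1 + real h) ^ e"
      using * C by (auto split: nat.splits)
    have 4: "\<bar>real_of_int a\<bar> * 1 \<le> \<bar>real_of_int a\<bar> * (1 + real h) ^ Suc e" by (intro mult_left_mono one_le_power) auto
    show ?thesis using 1 2 3 4 by (simp add: algebra_simps)
  qed
  then show ?case using C by (intro exI[of _ "\<bar>real_of_int a\<bar> + C"] exI[of _ "Suc e"]) auto
qed

lemma height_sum_affine_bound: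
  "\<exists>C e. C \<ge> 0 \<and> (\<forall>h::nat. real_of_int (height_sum (affine_family 1 h fs)) \<le> C * (1 + real h) ^ e)"
proof (induction fs)
  case Nil
  then show ?case by (intro exI[of _ 0]) (auto simp: height_sum_def affine_family_def)
next
  case (Cons f fs)
  then obtain C e where C: "C \<ge> 0" and *: "\<And>h. real_of_int (height_sum (affine_family 1 h fs)) \<le> C * (1 + real h) ^ e"
    by blast
  obtain C' e' where C': "C' \<ge> 0" and **: "\<And>h i. real_of_int \<bar>coeff (f \<circ>\<^sub>p [:int h, 1:]) i\<bar> \<le> C' * (1 + real h) ^ e'"
    using coeff_pcompose_shift_bound by blast
  have "real_of_int (height_sum (affine_family 1 h (f # fs))) \<le> (C + C') * (1 + real h) ^ (e + e')" for h
  proof -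
    have "height (f \<circ>\<^sub>p [:int h, 1:]) \<in> (\<lambda>i. \<bar>coeff (f \<circ>\<^sub>p [:int h, 1:]) i\<bar>) ` {..degree (f \<circ>\<^sub>p [:int h, 1:])}"
      unfolding height_def by (intro Max_in) auto
    then have "real_of_int (height (f \<circ>\<^sub>p [:int h, 1:])) \<le> C' * (1 + real h) ^ e'"
      using ** by auto
    also have "\<dots> \<le> C' * (1 + real h) ^ (e + e')" using C' by (intro mult_left_mono power_increasing) auto
    finally have 1: "real_of_int (height (f \<circ>\<^sub>p [:int h, 1:])) \<le> C' * (1 + real h) ^ (e + e')" .
    have "real_of_int (height_sum (affine_family 1 h fs)) \<le> C * (1 + real h) ^ e" by (rule *)
    also have "\<dots> \<le> C * (1 + real h) ^ (e + e')" using C by (intro mult_left_mono power_increasing) auto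
    finally have 2: "real_of_int (height_sum (affine_family 1 h fs)) \<le> C * (1 + real h) ^ (e + e')" .
    show ?thesis using 1 2 by (simp add: height_sum_def affine_family_def algebra_simps)
  qed
  then show ?case using C C' by (intro exI[of _ "C + C'"] exI[of _ "e + e'"]) auto
qed

text \<open>\<open>C\<close> and \<open>e\<close> depend on \<open>fs\<close> alone: the height is
  polynomial in the size of the shifts, with an exponent that does not grow with the number of
  shifts.\<close>

lemma height_sum_shifted_bound:
  "\<exists>C e. C \<ge> 0 \<and> (\<forall>hs K. set hs \<subseteq> {..K} \<longrightarrow>
      real_of_int (height_sum (shifted_family hs fs)) \<le> real (length hs) * C * (1 + real K) ^ e)"
proof -
  obtain C e where C: "C \<ge> 0" and *: "\<And>h. real_of_int (height_sum (affine_family 1 h fs)) \<le> C * (1 + real h) ^ e"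
    using height_sum_affine_bound by blast
  have "real_of_int (height_sum (shifted_family hs fs)) \<le> real (length hs) * C * (1 + real K) ^ e" if "set hs \<subseteq> {..K}" for hs K
    using that
  proof (induction hs)
    case (Cons h hs)
    have "real_of_int (height_sum (affine_family 1 h fs)) \<le> C * (1 + real h) ^ e" by (rule *)
    also have "\<dots> \<le> C * (1 + real K) ^ e" using C Cons.prems by (intro mult_left_mono power_mono) auto
    finally show ?case using Cons by (simp add: height_sum_def algebra_simps)
  qed (simp add: height_sum_def)
  then show ?thesis using C by blast
qed

lemma height_sum_nonneg: "height_sum fs \<ge> 0"
proof -
  have "height f \<ge> 0" for f
  proof -
    have "height f \<in> (\<lambda>i. \<bar>coeff f i\<bar>) ` {..degree f}" unfolding height_def by (intro Max_in) auto
    then show ?thesis by auto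
  qed
  then show ?thesis unfolding height_sum_def by (intro sum_list_nonneg) auto
qed

lemma finite_seeds_le [simp]: "finite {n. prime_seed fs n \<and> real n \<le> x}"
  by (rule finite_subset[of _ "{..nat \<lfloor>x\<rfloor>}"]) (auto simp: le_nat_iff le_floor_iff)

text \<open>Applied to \<open>G\<close> at differences of shifts, it limits the number of primes at
  which they collide.\<close>

lemma poly_abs_bound:
  fixes G :: "int poly"
  shows "\<exists>B b. B \<ge> 1 \<and> (\<forall>d. \<bar>real_of_int (poly G d)\<bar> \<le> B * (1 + \<bar>real_of_int d\<bar>) ^ b)"
proof (induction G)
  case 0
  then show ?case by (intro exI[of _ 1]) auto
next
  case (pCons a G)
  then obtain B b where B: "B \<ge> 1" and *: "\<And>d. \<bar>real_of_int (poly G d)\<bar> \<le> B * (1 + \<bar>real_of_int d\<bar>) ^ b"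
    by blast
  have "\<bar>real_of_int (poly (pCons a G) d)\<bar> \<le> (\<bar>real_of_int a\<bar> + B) * (1 + \<bar>real_of_int d\<bar>) ^ Suc b" for d
  proof -
    have "\<bar>real_of_int (poly (pCons a G) d)\<bar> \<le> \<bar>real_of_int a\<bar> + \<bar>real_of_int d\<bar> * \<bar>real_of_int (poly G d)\<bar>"
      by (auto simp flip: abs_mult intro: order.trans[OF abs_triangle_ineq])
    also have "\<dots> \<le> \<bar>real_of_int a\<bar> * (1 + \<bar>real_of_int d\<bar>) ^ Suc b + (1 + \<bar>real_of_int d\<bar>) * (B * (1 + \<bar>real_of_int d\<bar>) ^ b)"
    proof (rule add_mono)
      have "\<bar>real_of_int a\<bar> * 1 \<le> \<bar>real_of_int a\<bar> * (1 + \<bar>real_of_int d\<bar>) ^ Suc b"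
        by (intro mult_left_mono one_le_power) auto
      then show "\<bar>real_of_int a\<bar> \<le> \<bar>real_of_int a\<bar> * (1 + \<bar>real_of_int d\<bar>) ^ Suc b" by simp
      show "\<bar>real_of_int d\<bar> * \<bar>real_of_int (poly G d)\<bar> \<le> (1 + \<bar>real_of_int d\<bar>) * (B * (1 + \<bar>real_of_int d\<bar>) ^ b)"
        by (intro mult_mono *) auto
    qed
    also have "\<dots> = (\<bar>real_of_int a\<bar> + B) * (1 + \<bar>real_of_int d\<bar>) ^ Suc b" by (simp add: algebra_simps)
    finally show ?thesis .
  qed
  then show ?case using B by (intro exI[of _ "\<bar>real_of_int a\<bar> + B"] exI[of _ "Suc b"]) auto
qed

section \<open>Singular series of shifted families\<close>

lemma prime_prod_pos: "(\<Prod>p\<in>\<P> z. inverse (1 - 1 / real p)) > 0"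
  by (intro prod_pos) (auto dest: prime_gt_1_nat simp: field_simps)

text \<open>A nonconstant polynomial takes each value finitely often, hence infinitely many values,
  while \<open>D\<close> has finitely many divisors.\<close>

lemma nonconst_not_dvd_const:
  fixes g :: "int poly" and D :: int
  assumes "degree g \<ge> 1" "D \<noteq> 0"
  shows "\<exists>x. \<not> poly g x dvd D"
proof (rule ccontr)
  assume "\<not> ?thesis"
  then have dvd: "poly g x dvd D" for x by blast
  have "x \<in> (\<Union>v\<in>{-\<bar>D\<bar>..\<bar>D\<bar>}. {x. poly (g - [:v:]) x = 0})" for x
    using dvd_imp_le_int[OF assms(2) dvd[of x]] by auto
  then have "(UNIV :: int set) \<subseteq> (\<Union>v\<in>{-\<bar>D\<bar>..\<bar>D\<bar>}. {x. poly (g - [:v:]) x = 0})" by blast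
  moreover have "finite (\<Union>v\<in>{-\<bar>D\<bar>..\<bar>D\<bar>}. {x. poly (g - [:v:]) x = 0})"
    using assms(1) by (intro finite_UN_I poly_roots_finite) auto
  ultimately show False using infinite_UNIV_int finite_subset by blast
qed

lemma local_factor_nonneg: "prime p \<Longrightarrow> 0 \<le> \<delta> gs p"
  using root_count_le[of p gs] prime_gt_0_nat[of p] by (simp add: field_simps)

lemma sum_inverse_squares_le:
  assumes "z > 0"
  shows "(\<Sum>n\<in>{z<..y}. 1 / (real n)\<^sup>2) \<le> 1 / real z"
proof -
  have "(\<Sum>n\<in>{z<..y}. 1 / (real n)\<^sup>2) \<le> 1 / real z - 1 / real y" if "y \<ge> z"
    using that
  proof (induction y rule: dec_induct)
    case (step n)
    have "{z<..Suc n} = insert (Suc n) {z<..n}" using step by auto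
    moreover have "1 / (real (Suc n))\<^sup>2 \<le> 1 / real n - 1 / real (Suc n)"
    proof -
      have "1 / (real (Suc n))\<^sup>2 \<le> 1 / (real n * real (Suc n))"
        using step assms unfolding power2_eq_square by (intro divide_left_mono mult_right_mono) auto
      also have "\<dots> = 1 / real n - 1 / real (Suc n)" using step assms by (simp add: field_simps)
      finally show ?thesis .
    qed
    ultimately show ?case using step by simp
  qed simp
  moreover have "1 / real z - 1 / real y \<le> 1 / real z" by simp
  ultimately show ?thesis by (cases "y \<ge> z") (fastforce intro: order.trans, simp)
qed

text \<open>
  \<open>G\<close> replaces the resultant of \<open>\<Prod> f\<^sub>j(X)\<close> and \<open>\<Prod> f\<^sub>j(X + Y)\<close>: a prime \<open>p\<close> for which the roots of two shifts
  of the family meet modulo \<open>p\<close> divides the value of \<open>G\<close> at the difference of the shifts.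
\<close>

locale separated_family =
  fixes fs :: "int poly list" and G :: "int poly" and L :: nat
  assumes prim: "primitive_family fs" and singular_nz: "singular_series fs \<noteq> 0"
    and G_dvd: "\<And>n x y. n dvd poly (prod_list fs) x \<Longrightarrow> n dvd poly (prod_list fs) y \<Longrightarrow> n dvd poly G (x - y)"
    and G_nz: "\<And>d. \<bar>d\<bar> > int L \<Longrightarrow> poly G d \<noteq> 0"
begin

abbreviation m :: nat where "m \<equiv> length fs"
abbreviation M :: nat where "M \<equiv> (\<Sum>f\<leftarrow>fs. degree f)"
abbreviation \<nu> :: "nat \<Rightarrow> nat" where "\<nu> p \<equiv> root_count p fs"
abbreviation \<SS> :: real where "\<SS> \<equiv> singular_series fs"

abbreviation \<F> :: "nat list \<Rightarrow> int poly list" where "\<F> hs \<equiv> shifted_family hs fs"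

abbreviation singular_shifted :: "nat list \<Rightarrow> real" ("\<SS>\<^sub>F") where "\<SS>\<^sub>F hs \<equiv> singular_series (\<F> hs)"

abbreviation no_collision :: "nat \<Rightarrow> nat list \<Rightarrow> bool" where
  "no_collision p hs \<equiv> sorted_wrt (\<lambda>h h'. \<not> int p dvd poly G (int h - int h')) hs"

abbreviation far :: "nat \<Rightarrow> nat \<Rightarrow> bool" where "far h h' \<equiv> h + L < h' \<or> h' + L < h"

text \<open>\<open>far\<close> is symmetric, so \<open>sorted_wrt\<close> imposes it on all pairs
  and orders nothing: each admissible set of shifts occurs in all \<open>k!\<close> arrangements, as
  a factorial moment requires.\<close>

definition Sep :: "nat \<Rightarrow> nat \<Rightarrow> nat list set" where
  "Sep k K = {hs. length hs = k \<and> set hs \<subseteq> {1..K} \<and> sorted_wrt far hs}"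

text \<open>By the Chinese remainder theorem, the density of the integers at which no member has a
  prime divisor \<open>p \<le> z\<close>.\<close>

definition V :: "nat \<Rightarrow> real" where
  "V z = (\<Prod>p\<in>\<P> z. \<delta> fs p)"

text \<open>The Euler factor at \<open>p\<close> of the singular series of the shifted family
  divided by \<open>\<SS> ^ length hs\<close>; the powers of \<open>1 - 1 / p\<close> cancel in this
  quotient.\<close>

definition \<beta> :: "nat list \<Rightarrow> nat \<Rightarrow> real" where
  "\<beta> hs p = \<delta> (\<F> hs) p / \<delta> fs p ^ length hs"

definition U :: "nat \<Rightarrow> nat list \<Rightarrow> real" where
  "U z hs = (\<Prod>p\<in>\<P> z. \<beta> hs p)"

section \<open>Local densities of the original family\<close>

lemma m_pos: "m > 0" using prim by (auto simp: primitive_family_def)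

lemma contents: "f \<in> set fs \<Longrightarrow> content f = 1" using prim by (auto simp: primitive_family_def)

lemma root_count_le_M: "prime p \<Longrightarrow> \<nu> p \<le> M"
  using root_count_le_sum_degree contents by blast

lemma M_pos: "M > 0"
proof -
  have "hd fs \<in> set fs" using m_pos by auto
  moreover from this have "degree (hd fs) \<ge> 1" using prim by (auto simp: primitive_family_def)
  moreover have "degree (hd fs) \<le> M" using calculation by (intro member_le_sum_list) auto
  ultimately show ?thesis by simp
qed

lemma partial_prod_tendsto: "singular_partial_prod fs \<longlonglongrightarrow> \<SS>"
  using singular_nz unfolding singular_series_def
  by (auto split: if_splits simp: convergent_LIMSEQ_iff)

lemma partial_prod_eq:
  "singular_partial_prod fs z = V z * (\<Prod>p\<in>\<P> z. inverse (1 - 1 / real p)) ^ m"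
  unfolding singular_partial_prod_def V_def
  by (simp add: prod.distrib prod_power_distrib power_int_minus power_inverse)

text \<open>A full set of roots modulo \<open>p\<close> would annihilate all later partial products,
  against the nonzero singular series.\<close>

lemma root_count_less: assumes "prime p" shows "\<nu> p < p"
proof (rule ccontr)
  assume "\<not> \<nu> p < p"
  then have eq: "\<nu> p = p" using root_count_le[of p fs] by simp
  have "singular_partial_prod fs y = 0" if "y \<ge> p" for y
    unfolding partial_prod_eq V_def
    using that assms eq prime_gt_0_nat[OF assms] by (auto intro!: prod_zero)
  then have "\<forall>\<^sub>F y in sequentially. singular_partial_prod fs y = 0"
    by (auto simp: eventually_sequentially)
  then have "singular_partial_prod fs \<longlonglongrightarrow> 0" by (rule tendsto_eventually)
  then show False using partial_prod_tendsto LIMSEQ_unique singular_nz by blast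
qed

lemma local_factor_pos: "prime p \<Longrightarrow> \<delta> fs p > 0"
  using root_count_less[of p] by (simp add: field_simps)

lemma V_pos: "V z > 0"
  unfolding V_def using local_factor_pos by (intro prod_pos) blast


lemma partial_prod_pos: "singular_partial_prod fs z > 0"
  unfolding partial_prod_eq using V_pos prime_prod_pos by auto

lemma singular_pos: "\<SS> > 0"
proof -
  have "\<SS> \<ge> 0"
    using partial_prod_pos less_imp_le by (intro LIMSEQ_le_const[OF partial_prod_tendsto]) blast
  then show ?thesis using singular_nz by simp
qed

text \<open>The partial products tend to a nonzero limit, so their inverses are bounded, and
  \<open>1 / V z\<close> is comparable with the \<open>m\<close>-th power of the product of the
  \<open>1 / (1 - 1/p)\<close>.\<close>

lemma V_inverse_bound: "\<exists>C>0. \<forall>z. 1 / V z \<le> C * max 1 (real z) ^ m"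
proof -
  have "(\<lambda>z. inverse (singular_partial_prod fs z)) \<longlonglongrightarrow> inverse \<SS>"
    using partial_prod_tendsto singular_nz by (intro tendsto_inverse)
  then have "Bseq (\<lambda>z. inverse (singular_partial_prod fs z))"
    by (intro convergent_imp_Bseq) (auto simp: convergent_def)
  then obtain C where C: "C > 0" "\<And>z. norm (inverse (singular_partial_prod fs z)) \<le> C" by (auto elim: BseqE)
  have "1 / V z \<le> C * max 1 (real z) ^ m" for z
  proof -
    let ?P = "\<Prod>p\<in>\<P> z. inverse (1 - 1 / real p)"
    have "1 / V z = inverse (singular_partial_prod fs z) * ?P ^ m"
      unfolding partial_prod_eq using V_pos[of z] prime_prod_pos[of z] by (simp add: field_simps)
    also have "\<dots> \<le> C * max 1 (real z) ^ m"
    proof (rule mult_mono)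
      show "inverse (singular_partial_prod fs z) \<le> C"
        using C(2)[of z] partial_prod_pos[of z] by simp
      show "?P ^ m \<le> max 1 (real z) ^ m"
        using prod_primes_inverse_le[of z] prime_prod_pos[of z] by (intro power_mono) auto
      show "0 \<le> ?P ^ m" using prime_prod_pos[of z] by simp
    qed (use C in simp)
    finally show ?thesis .
  qed
  then show ?thesis using C by blast
qed

lemma V_tendsto_0: "V \<longlonglongrightarrow> 0"
proof -
  let ?P = "\<lambda>z. \<Prod>p\<in>\<P> z. 1 - 1 / real p"
  have "V z = singular_partial_prod fs z * ?P z ^ m" for z
  proof -
    have "?P z > 0" by (intro prod_pos) (auto dest: prime_gt_1_nat simp: field_simps)
    moreover have "(\<Prod>p\<in>\<P> z. inverse (1 - 1 / real p)) = inverse (?P z)"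
      using prod_inversef[of "\<lambda>p. 1 - 1 / real p"] by (simp add: o_def)
    ultimately show ?thesis unfolding partial_prod_eq by (simp add: power_inverse mult.assoc)
  qed
  moreover have "(\<lambda>z. singular_partial_prod fs z * ?P z ^ m) \<longlonglongrightarrow> \<SS> * 0 ^ m"
    by (intro tendsto_intros partial_prod_tendsto prod_primes_tendsto_0)
  ultimately have "V \<longlonglongrightarrow> \<SS> * 0 ^ m" by presburger
  then show ?thesis using m_pos by (simp add: power_0_left)
qed

text \<open>A root common to two shifts would make \<open>p\<close> divide \<open>G\<close> at their
  difference. Without collisions the root sets are disjoint translates of one set.\<close>

lemma root_count_shifted_family_eq:
  assumes "prime p" "no_collision p hs"
  shows "root_count p (\<F> hs) = length hs * \<nu> p"
  using assms(2)
proof (induction hs)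
  case Nil
  then show ?case by (simp add: root_count_def)
next
  case (Cons h hs)
  have "root_count p (affine_family 1 h fs @ \<F> hs) =
      root_count p (affine_family 1 h fs) + root_count p (\<F> hs)"
  proof (rule root_count_append_disjoint)
    fix x assume "divides_value (affine_family 1 h fs) p x" "divides_value (\<F> hs) p x"
    then obtain h' where h': "h' \<in> set hs" "divides_value fs p (h + x)" "divides_value fs p (x + h')"
      by (auto simp: divides_value_affine_family divides_value_shifted_family)
    then have "int p dvd poly G (int (h + x) - int (x + h'))"
      by (intro G_dvd divides_value_prod_list)
    then show False using Cons.prems h'(1) by simp
  qed
  then show ?case using Cons by (simp add: root_count_affine_family)
qed

lemma primitive_affine_1: "primitive_family (affine_family 1 h fs)"
  by (intro primitive_affine_family prim) auto

text \<open>Only distinctness across shifts is at stake. If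
  \<open>f(X + h) = f'(X + h') = g\<close>, then every value of \<open>g\<close> divides the nonzero
  number \<open>G(h - h')\<close>, which is impossible for nonconstant \<open>g\<close>. So the
  polynomial that detects common roots also excludes coinciding members.\<close>

lemma primitive_shifted_family:
  assumes "sorted_wrt far hs" "hs \<noteq> []"
  shows "primitive_family (\<F> hs)"
proof -
  have "distinct (\<F> hs)" using assms(1)
  proof (induction hs)
    case (Cons h hs)
    have "set (affine_family 1 h fs) \<inter> set (\<F> hs) = {}"
    proof (rule ccontr)
      assume "\<not> ?thesis"
      then obtain g h' where g: "g \<in> set (affine_family 1 h fs)" "g \<in> set (affine_family 1 h' fs)" "h' \<in> set hs"
        by (auto simp: set_shifted_family)
      then obtain f f' where f: "f \<in> set fs" "g = f \<circ>\<^sub>p [:int h, 1:]" "f' \<in> set fs" "g = f' \<circ>\<^sub>p [:int h', 1:]"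
        by (auto simp: affine_family_def)
      have "far h h'" using Cons.prems g(3) by simp
      then have nz: "poly G (int h - int h') \<noteq> 0" by (intro G_nz) auto
      have "degree g \<ge> 1" using primitive_affine_1[of h] g(1) by (auto simp: primitive_family_def)
      then obtain x where x: "\<not> poly g x dvd poly G (int h - int h')" using nonconst_not_dvd_const nz by blast
      have *: "poly f y dvd poly (prod_list fs) y" if "f \<in> set fs" for f and y :: int
        using that by (induction fs) auto
      have "poly g x = poly f (int h + x)" "poly g x = poly f' (int h' + x)"
        by (subst f(2), simp add: poly_pcompose) (subst f(4), simp add: poly_pcompose)
      then have "poly g x dvd poly (prod_list fs) (int h + x)" "poly g x dvd poly (prod_list fs) (int h' + x)"
        using *[OF f(1), of "int h + x"] *[OF f(3), of "int h' + x"] by metis+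
      then have "poly g x dvd poly G (int h + x - (int h' + x))" by (rule G_dvd)
      then show False using x by simp
    qed
    then show ?case using Cons primitive_affine_1[of h] by (auto simp: primitive_family_def)
  qed simp
  moreover have "\<F> hs \<noteq> []"
    using assms(2) m_pos by (cases hs) (auto simp: affine_family_def)
  ultimately show ?thesis
    using primitive_affine_1 unfolding primitive_family_def set_shifted_family by blast
qed

section \<open>Euler factors and convergence for shifted families\<close>

lemma \<beta>_nonneg: "prime p \<Longrightarrow> \<beta> hs p \<ge> 0"
  unfolding \<beta>_def using local_factor_pos[of p] local_factor_nonneg[of p] by (auto intro!: divide_nonneg_pos)

lemma U_nonneg: "U z hs \<ge> 0"
  unfolding U_def by (intro prod_nonneg) (auto intro: \<beta>_nonneg)

lemma U_eq: "U z hs = (\<Prod>p\<in>\<P> z. \<delta> (\<F> hs) p) / V z ^ length hs"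
  unfolding U_def \<beta>_def V_def by (simp add: prod_dividef prod_power_distrib)

lemma partial_prod_shifted:
  "singular_partial_prod (\<F> hs) y = singular_partial_prod fs y ^ length hs * U y hs"
proof -
  have "singular_partial_prod (\<F> hs) y =
      (\<Prod>p\<in>\<P> y. (\<delta> fs p * (1 - 1 / real p) powi (- int m)) ^ length hs * \<beta> hs p)"
    unfolding singular_partial_prod_def
  proof (intro prod.cong refl)
    fix p assume "p \<in> \<P> y"
    then have pos: "\<delta> fs p > 0" using local_factor_pos by auto
    have "(1 - 1 / real p) powi (- int (length (\<F> hs))) = ((1 - 1 / real p) powi (- int m)) ^ length hs"
      by (simp add: power_int_minus power_mult[symmetric] mult.commute power_inverse flip: of_nat_mult)
    moreover have "\<delta> (\<F> hs) p = \<delta> fs p ^ length hs * \<beta> hs p"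
      unfolding \<beta>_def by (metis less_irrefl nonzero_mult_div_cancel_left pos power_not_zero times_divide_eq_right)
    ultimately show "\<delta> (\<F> hs) p * (1 - 1 / real p) powi (- int (length (\<F> hs))) =
        (\<delta> fs p * (1 - 1 / real p) powi (- int m)) ^ length hs * \<beta> hs p"
      by (simp only: power_mult_distrib mult_ac)
  qed
  also have "\<dots> = singular_partial_prod fs y ^ length hs * U y hs"
    unfolding singular_partial_prod_def U_def prod_power_distrib by (rule prod.distrib)
  finally show ?thesis .
qed

lemma \<beta>_bounds:
  fixes hs :: "nat list"
  assumes "prime p" "p \<ge> 2 * M"
  defines "C \<equiv> 2 ^ length hs * (real (length hs))\<^sup>2 * real M ^ 2"
  shows "\<bar>\<beta> hs p - 1\<bar> \<le> C / real p"
    and "no_collision p hs \<Longrightarrow> \<bar>\<beta> hs p - 1\<bar> \<le> C / (real p)\<^sup>2"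
proof -
  define t where "t = real (\<nu> p) / real p"
  define u where "u = real (root_count p (\<F> hs)) / real p"
  let ?k = "length hs"
  have p: "p > 0" using assms(1) prime_gt_0_nat by blast
  have tM: "t \<le> real M / real p" unfolding t_def using root_count_le_M[OF assms(1)] by (intro divide_right_mono) auto
  have "2 * real M \<le> real p" using assms(2) by linarith
  then have "real M / real p \<le> 1 / 2" using p by (simp add: field_simps)
  then have t: "0 \<le> t" "t \<le> 1/2" using order.trans[OF tM, of "1 / 2"] by (simp_all add: t_def)
  have u: "0 \<le> u" "u \<le> real ?k * t"
    using root_count_shifted_family_le[of p hs fs]
    by (auto simp: u_def t_def field_simps simp flip: of_nat_mult intro: divide_right_mono)
  have \<beta>: "\<beta> hs p = (1 - u) / (1 - t) ^ ?k" by (simp add: \<beta>_def u_def t_def)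
  have "\<bar>\<beta> hs p - 1\<bar> \<le> 2 ^ ?k * real ?k * t" unfolding \<beta> by (rule local_ratio_bounds(1)) (use t u in auto)
  also have "\<dots> \<le> 2 ^ ?k * real ?k * (real M / real p)" using tM by (intro mult_left_mono) auto
  \<comment> \<open>The squares serve only to give both bounds the same constant
    \<open>C\<close>.\<close>
  also have "\<dots> \<le> 2 ^ ?k * real ?k ^ 2 * (real M ^ 2 / real p)"
  proof (intro mult_mono divide_right_mono)
    show "real ?k \<le> real ?k ^ 2" by (metis of_nat_le_iff of_nat_power le_square power2_eq_square)
    show "real M \<le> real M ^ 2" by (metis of_nat_le_iff of_nat_power le_square power2_eq_square)
  qed auto
  finally show "\<bar>\<beta> hs p - 1\<bar> \<le> C / real p" by (simp add: C_def)
  assume "no_collision p hs"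
  then have "u = real ?k * t"
    using root_count_shifted_family_eq[OF assms(1)] by (simp add: u_def t_def)
  then have "\<bar>\<beta> hs p - 1\<bar> \<le> 2 ^ ?k * (real ?k)\<^sup>2 * t\<^sup>2" unfolding \<beta> by (rule local_ratio_bounds(2)[OF t u])
  also have "\<dots> \<le> 2 ^ ?k * (real ?k)\<^sup>2 * (real M / real p)\<^sup>2" using t tM by (intro mult_left_mono power_mono) auto
  finally show "\<bar>\<beta> hs p - 1\<bar> \<le> C / (real p)\<^sup>2" by (simp add: C_def power_divide)
qed

text \<open>Primes above \<open>z\<close> are of two kinds. Where no roots collide, a factor costs
  \<open>C / p^2\<close>, in total at most \<open>C / z\<close>. A colliding prime costs
  \<open>C / p \<le> C / z\<close>, but it divides some \<open>G(h\<^sub>i - h\<^sub>j)\<close>, a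
  nonzero number of size at most \<open>B * (1 + K) ^ b\<close>, so each of at most
  \<open>k^2\<close> pairs has at most \<open>ln (B * (1 + K) ^ b) / ln z\<close> of them.\<close>

lemma \<beta>_tail_bound:
  fixes hs :: "nat list"
  assumes hs: "sorted_wrt far hs" "set hs \<subseteq> {1..K}" and z: "z \<ge> 2" "z \<ge> 2 * M"
    and B: "B \<ge> 1" "\<And>d. \<bar>real_of_int (poly G d)\<bar> \<le> B * (1 + \<bar>real_of_int d\<bar>) ^ b"
  defines "k \<equiv> length hs"
  defines "C \<equiv> 2 ^ k * (real k)\<^sup>2 * real M ^ 2"
  shows "(\<Sum>p\<in>\<R> z y. \<bar>\<beta> hs p - 1\<bar>) \<le>
    C / real z * (1 + real k ^ 2 * (ln (B * (1 + real K) ^ b) / ln (real z)))"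
proof -
  let ?P = "\<R> z y"
  define D where "D = (\<lambda>(i, j). poly G (int (hs ! i) - int (hs ! j)))"
  define I where "I = {(i, j). i < j \<and> j < k}"
  define A where "A = (\<lambda>ij. {p\<in>?P. int p dvd D ij})"
  let ?J = "\<Union>ij\<in>I. A ij"
  have finP: "finite ?P" by (rule finite_subset[of _ "{..y}"]) auto
  have finA: "finite (A ij)" for ij unfolding A_def using finP by simp
  have I: "I \<subseteq> {..<k} \<times> {..<k}" by (auto simp: I_def)
  then have finI: "finite I" using finite_subset by blast
  have "card I \<le> card ({..<k} \<times> {..<k})" using I by (intro card_mono) auto
  then have cardI: "real (card I) \<le> real k ^ 2" by (simp add: power2_eq_square flip: of_nat_mult)
  define \<l> where "\<l> = ln (B * (1 + real K) ^ b)"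
  have "B * (1 + real K) ^ b \<ge> 1" using B(1) mult_mono[of 1 B 1 "(1 + real K) ^ b"] by (simp add: one_le_power)
  then have \<l>0: "\<l> \<ge> 0" unfolding \<l>_def by simp
  have lnz: "ln (real z) > 0" using z by simp
  have cardA: "real (card (A ij)) \<le> \<l> / ln (real z)" if ij: "ij \<in> I" for ij
  proof -
    obtain i j where ij': "ij = (i, j)" "i < j" "j < k" using ij by (auto simp: I_def)
    have mem: "hs ! i \<in> set hs" "hs ! j \<in> set hs" using ij' by (auto simp: k_def)
    have "far (hs ! i) (hs ! j)" using hs(1) ij' by (auto simp: sorted_wrt_iff_nth_less k_def)
    then have nz: "D ij \<noteq> 0" unfolding D_def ij' prod.case by (intro G_nz) auto
    have "\<bar>real_of_int (int (hs ! i) - int (hs ! j))\<bar> \<le> real K"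
    proof -
      have "hs ! i \<le> K" "hs ! j \<le> K" using mem hs(2) by auto
      then show ?thesis by (simp add: abs_le_iff)
    qed
    then have "B * (1 + \<bar>real_of_int (int (hs ! i) - int (hs ! j))\<bar>) ^ b \<le> B * (1 + real K) ^ b"
      using B(1) by (intro mult_left_mono power_mono) auto
    then have "\<bar>real_of_int (D ij)\<bar> \<le> B * (1 + real K) ^ b"
      using B(2)[of "int (hs ! i) - int (hs ! j)"] unfolding D_def ij' prod.case by linarith
    then have "ln \<bar>real_of_int (D ij)\<bar> \<le> \<l>" unfolding \<l>_def using nz by (subst ln_le_cancel_iff) auto
    moreover have "real (card (A ij)) * ln (real z) \<le> ln \<bar>real_of_int (D ij)\<bar>"
      using finA nz z by (intro card_prime_divisors_le) (auto simp: A_def)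
    ultimately show ?thesis using lnz by (simp add: pos_le_divide_eq)
  qed
  have C0: "C \<ge> 0" by (simp add: C_def)
  have "(\<Sum>p\<in>?P. \<bar>\<beta> hs p - 1\<bar>) \<le> (\<Sum>p\<in>?P. C / (real p)\<^sup>2 + (if p \<in> ?J then C / real z else 0))"
  proof (rule sum_mono)
    fix p assume p: "p \<in> ?P"
    show "\<bar>\<beta> hs p - 1\<bar> \<le> C / (real p)\<^sup>2 + (if p \<in> ?J then C / real z else 0)"
    proof (cases "p \<in> ?J")
      case True
      have "\<bar>\<beta> hs p - 1\<bar> \<le> C / real p"
        using p z \<beta>_bounds(1)[of p hs] by (simp add: C_def k_def)
      also have "\<dots> \<le> C / real z" using p z C0 by (intro divide_left_mono) auto
      also have "\<dots> \<le> C / (real p)\<^sup>2 + C / real z" using C0 by simp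
      finally show ?thesis using True by (simp only: if_True)
    next
      case False
      then have "no_collision p hs"
        using p by (auto simp: sorted_wrt_iff_nth_less A_def D_def I_def k_def)
      then have "\<bar>\<beta> hs p - 1\<bar> \<le> C / (real p)\<^sup>2"
        using p z \<beta>_bounds(2)[of p hs] by (simp add: C_def k_def)
      then show ?thesis using False by (simp only: if_False add_0_right)
    qed
  qed
  also have "\<dots> = C * (\<Sum>p\<in>?P. 1 / (real p)\<^sup>2) + real (card ?J) * (C / real z)"
  proof -
    have "?P \<inter> ?J = ?J" by (auto simp: A_def)
    then have "(\<Sum>p\<in>?P. if p \<in> ?J then C / real z else 0) = real (card ?J) * (C / real z)"
      by (subst sum.inter_restrict[OF finP, symmetric]) simp
    then show ?thesis by (simp add: sum.distrib sum_distrib_left)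
  qed
  also have "\<dots> \<le> C * (1 / real z) + (real k ^ 2 * (\<l> / ln (real z))) * (C / real z)"
  proof (intro add_mono mult_left_mono mult_right_mono)
    have "(\<Sum>p\<in>?P. 1 / (real p)\<^sup>2) \<le> (\<Sum>n\<in>{z<..y}. 1 / (real n)\<^sup>2)" by (intro sum_mono2) auto
    also have "\<dots> \<le> 1 / real z" using z by (intro sum_inverse_squares_le) auto
    finally show "(\<Sum>p\<in>?P. 1 / (real p)\<^sup>2) \<le> 1 / real z" .
    have "real (card ?J) \<le> (\<Sum>ij\<in>I. real (card (A ij)))"
      using card_UN_le[OF finI, of A] by (simp flip: of_nat_sum)
    also have "\<dots> \<le> (\<Sum>ij\<in>I. \<l> / ln (real z))" by (intro sum_mono cardA)
    also have "\<dots> = real (card I) * (\<l> / ln (real z))" by simp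
    also have "\<dots> \<le> real k ^ 2 * (\<l> / ln (real z))" using cardI \<l>0 lnz by (intro mult_right_mono) auto
    finally show "real (card ?J) \<le> real k ^ 2 * (\<l> / ln (real z))" .
  qed (use C0 in auto)
  also have "\<dots> = C / real z * (1 + real k ^ 2 * (\<l> / ln (real z)))" by (simp add: algebra_simps)
  finally show ?thesis unfolding \<l>_def .
qed

text \<open>The factors beyond \<open>z\<close> form an absolutely convergent product whose limit is
  within \<open>exp s - 1\<close> of 1. Convergence itself matters here, because
  \<open>singular_series\<close> is 0 by convention otherwise. The error is proportional to the main
  term, which makes it harmless in averages over \<open>hs\<close>.\<close>

lemma singular_series_shifted:
  assumes s: "\<And>y. (\<Sum>p\<in>\<R> z y. \<bar>\<beta> hs p - 1\<bar>) \<le> s"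
  shows "\<bar>\<SS>\<^sub>F hs - \<SS> ^ length hs * U z hs\<bar> \<le> (exp s - 1) * (\<SS> ^ length hs * U z hs)"
proof -
  define T where "T = (\<lambda>y. \<Prod>p\<in>\<R> z y. \<beta> hs p)"
  \<comment> \<open>Padding with 1 turns the product over primes into one over initial segments of
    the naturals, the form in which infinite products are treated.\<close>
  define b where "b = (\<lambda>n. if prime n \<and> z < n then \<beta> hs n else 1)"
  have T: "(\<Prod>n\<le>y. b n) = T y" for y
  proof -
    have "(\<Prod>n\<le>y. b n) = (\<Prod>n | n \<le> y \<and> prime n \<and> z < n. \<beta> hs n)"
      unfolding b_def by (subst prod.inter_filter[symmetric]) auto
    also have "{n. n \<le> y \<and> prime n \<and> z < n} = \<R> z y" by auto
    finally show ?thesis by (simp add: T_def)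
  qed
  have "summable (\<lambda>n. norm (b n - 1))"
  proof (rule summableI_nonneg_bounded)
    fix y
    have "(\<Sum>n<y. norm (b n - 1)) \<le> (\<Sum>n\<le>y. norm (b n - 1))" by (intro sum_mono2) auto
    also have "\<dots> = (\<Sum>n\<le>y. if prime n \<and> z < n then \<bar>\<beta> hs n - 1\<bar> else 0)" by (intro sum.cong) (auto simp: b_def)
    also have "\<dots> = (\<Sum>n | n \<le> y \<and> prime n \<and> z < n. \<bar>\<beta> hs n - 1\<bar>)"
      by (subst sum.inter_filter[symmetric]) auto
    also have "{n. n \<le> y \<and> prime n \<and> z < n} = \<R> z y" by auto
    finally show "(\<Sum>n<y. norm (b n - 1)) \<le> s" using s[of y] by linarith
  qed auto
  then have "convergent_prod b" by (intro abs_convergent_prod_imp_convergent_prod summable_imp_abs_convergent_prod)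
  then have "convergent T" using convergent_prod_imp_convergent[of b] by (simp add: T)
  then obtain W where W: "T \<longlonglongrightarrow> W" by (auto simp: convergent_def)
  have "\<bar>T y - 1\<bar> \<le> exp s - 1" for y
    using abs_prod_minus_1_le[of "\<beta> hs" "\<R> z y"] s[of y] unfolding T_def
    by (smt (verit) exp_le_cancel_iff)
  then have W1: "\<bar>W - 1\<bar> \<le> exp s - 1"
    by (intro LIMSEQ_le_const2[OF tendsto_rabs[OF tendsto_diff[OF W tendsto_const]]]) auto
  have UT: "U y hs = U z hs * T y" if "y \<ge> z" for y
  proof -
    have eq: "\<P> y = \<P> z \<union> \<R> z y" using that by auto
    have "finite (\<R> z y)" by (rule finite_subset[of _ "{..y}"]) auto
    then show ?thesis unfolding U_def T_def eq by (intro prod.union_disjoint) auto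
  qed
  have "(\<lambda>y. singular_partial_prod fs y ^ length hs * (U z hs * T y)) \<longlonglongrightarrow> \<SS> ^ length hs * (U z hs * W)"
    by (intro tendsto_intros partial_prod_tendsto W)
  moreover have "\<forall>\<^sub>F y in sequentially. singular_partial_prod fs y ^ length hs * (U z hs * T y) = singular_partial_prod (\<F> hs) y"
    by (rule eventually_sequentiallyI[of z]) (simp only: UT[symmetric] partial_prod_shifted)
  ultimately have lim: "singular_partial_prod (\<F> hs) \<longlonglongrightarrow> \<SS> ^ length hs * (U z hs * W)"
    by (rule Lim_transform_eventually)
  then have eq: "\<SS>\<^sub>F hs = \<SS> ^ length hs * (U z hs * W)"
    using limI[OF lim] convergentI[OF lim] singular_series_def[of "\<F> hs"] by presburger
  have "\<SS>\<^sub>F hs - \<SS> ^ length hs * U z hs = (\<SS> ^ length hs * U z hs) * (W - 1)"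
    unfolding eq by (simp add: algebra_simps)
  then have "\<bar>\<SS>\<^sub>F hs - \<SS> ^ length hs * U z hs\<bar> = (\<SS> ^ length hs * U z hs) * \<bar>W - 1\<bar>"
    using singular_pos U_nonneg[of z hs] by (simp add: abs_mult)
  also have "\<dots> \<le> (\<SS> ^ length hs * U z hs) * (exp s - 1)"
    using W1 singular_pos U_nonneg[of z hs] by (intro mult_left_mono) auto
  finally show ?thesis by (simp add: mult.commute)
qed

end

section \<open>Averages of singular series\<close>

text \<open>By the Chinese remainder theorem the conditions at different primes are
  independent.\<close>

lemma card_values_coprime_primorial:
  fixes z :: nat
  defines "Q \<equiv> \<Prod>p\<in>\<P> z. p"
  shows "real (card {x\<in>{0..<Q}. \<forall>p. prime p \<and> p \<le> z \<longrightarrow> \<not> divides_value gs p x}) =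
    real Q * (\<Prod>p\<in>\<P> z. \<delta> gs p)"
proof -
  let ?P = "\<P> z"
  define A where "A = (\<lambda>p. {x\<in>{0..<p}. \<not> divides_value gs p x})"
  have cardA: "real (card (A p)) = real p * \<delta> gs p" if "p \<in> ?P" for p
  proof -
    have eq: "A p = {0..<p} - {x\<in>{0..<p}. divides_value gs p x}" by (auto simp: A_def)
    have "card (A p) = card {0..<p} - root_count p gs" unfolding eq root_count_altdef
      by (rule card_Diff_subset) auto
    then have "real (card (A p)) = real p - real (root_count p gs)"
      using root_count_le[of p gs] by (simp add: of_nat_diff)
    then show ?thesis using that prime_gt_0_nat[of p] by (simp add: right_diff_distrib)
  qed
  have iff: "x mod p \<in> A p \<longleftrightarrow> \<not> divides_value gs p x" if "p \<in> ?P" for x p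
    using that prime_gt_0_nat[of p] by (simp add: A_def divides_value_mod)
  have "{x\<in>{0..<Q}. \<forall>p. prime p \<and> p \<le> z \<longrightarrow> \<not> divides_value gs p x} = {x\<in>{0..<\<Prod>?P}. \<forall>p\<in>?P. x mod p \<in> A p}"
  proof -
    have "(\<forall>p. prime p \<and> p \<le> z \<longrightarrow> \<not> divides_value gs p x) \<longleftrightarrow> (\<forall>p\<in>?P. x mod p \<in> A p)" for x
      using iff by simp
    then show ?thesis unfolding Q_def by (simp only:)
  qed
  also have "card \<dots> = (\<Prod>p\<in>?P. card (A p))"
    by (intro card_residues_crt) (auto simp: A_def)
  also have "real \<dots> = (\<Prod>p\<in>?P. real p * \<delta> gs p)"
    unfolding of_nat_prod by (intro prod.cong refl cardA)
  also have "\<dots> = real Q * (\<Prod>p\<in>?P. \<delta> gs p)"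
    by (simp add: prod.distrib Q_def)
  finally show ?thesis .
qed

lemma card_periodic:
  fixes P :: "nat \<Rightarrow> bool"
  assumes "n > 0" "\<And>x. P (x mod n) \<longleftrightarrow> P x"
  shows "card {x\<in>{a..<a + t * n}. P x} = t * card {x\<in>{0..<n}. P x}"
proof (induction t)
  case (Suc t)
  let ?b = "a + t * n"
  have inj: "inj_on (\<lambda>x. x mod n) {?b..<?b + n}"
  proof (rule linorder_inj_onI)
    fix x y assume xy: "x < y" "x \<in> {?b..<?b + n}" "y \<in> {?b..<?b + n}"
    then have "y - x < n" "y - x > 0" by auto
    then have "\<not> n dvd y - x" using nat_dvd_not_less by blast
    then show "x mod n \<noteq> y mod n" using xy by (metis less_imp_le mod_eq_dvd_iff_nat)
  qed auto
  have img: "(\<lambda>x. x mod n) ` {?b..<?b + n} = {0..<n}"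
    using assms(1) by (intro card_subset_eq) (auto simp: card_image[OF inj])
  have "bij_betw (\<lambda>x. x mod n) {x\<in>{?b..<?b + n}. P x} {x\<in>{0..<n}. P x}"
  proof (rule bij_betw_imageI)
    show "inj_on (\<lambda>x. x mod n) {x\<in>{?b..<?b + n}. P x}" by (rule inj_on_subset[OF inj]) auto
    show "(\<lambda>x. x mod n) ` {x\<in>{?b..<?b + n}. P x} = {x\<in>{0..<n}. P x}"
      unfolding img[symmetric] using assms(2) by blast
  qed
  then have period: "card {x\<in>{?b..<?b + n}. P x} = card {x\<in>{0..<n}. P x}" by (rule bij_betw_same_card)
  have eq: "{x\<in>{a..<a + Suc t * n}. P x} = {x\<in>{a..<?b}. P x} \<union> {x\<in>{?b..<?b + n}. P x}" by auto
  have "card {x\<in>{a..<a + Suc t * n}. P x} = card {x\<in>{a..<?b}. P x} + card {x\<in>{?b..<?b + n}. P x}"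
    unfolding eq by (rule card_Un_disjoint) auto
  then show ?case using Suc period by simp
qed simp

context separated_family
begin

section \<open>Averages of the small Euler factors over shifts\<close>

definition good :: "nat \<Rightarrow> nat \<Rightarrow> bool" where
  "good z x \<longleftrightarrow> (\<forall>p. prime p \<and> p \<le> z \<longrightarrow> \<not> divides_value fs p x)"

definition Q :: "nat \<Rightarrow> nat" where "Q z = (\<Prod>p\<in>\<P> z. p)"

definition W :: "nat \<Rightarrow> nat list \<Rightarrow> nat" where
  "W z hs = card {x\<in>{0..<Q z}. \<forall>h\<in>set hs. good z (x + h)}"

lemma Q_pos: "Q z > 0"
  unfolding Q_def by (intro prod_pos) (auto dest: prime_gt_0_nat)

text \<open>The product over primes becomes a count of residues \<open>x\<close>. In this form a
  further shift is one more condition on \<open>x\<close>, and the average over that shift can be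
  taken for each \<open>x\<close> separately.\<close>

lemma U_eq_W: "U z hs = real (W z hs) / real (Q z) / V z ^ length hs"
proof -
  have "{x\<in>{0..<Q z}. \<forall>h\<in>set hs. good z (x + h)} =
      {x\<in>{0..<Q z}. \<forall>p. prime p \<and> p \<le> z \<longrightarrow> \<not> divides_value (\<F> hs) p x}"
    by (auto simp: good_def divides_value_shifted_family)
  then have "real (W z hs) = real (Q z) * (\<Prod>p\<in>\<P> z. \<delta> (\<F> hs) p)"
    unfolding W_def Q_def by (simp only: card_values_coprime_primorial)
  then show ?thesis unfolding U_eq using Q_pos[of z] by simp
qed

lemma good_mod: "good z (x mod Q z) \<longleftrightarrow> good z x"
proof -
  have "divides_value fs p (x mod Q z) \<longleftrightarrow> divides_value fs p x" if "prime p" "p \<le> z" for p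
  proof -
    have "p dvd Q z" unfolding Q_def using that by (intro dvd_prodI) auto
    then show ?thesis by (intro divides_value_cong) (simp add: cong_def mod_mod_cancel)
  qed
  then show ?thesis by (auto simp: good_def)
qed

text \<open>\<open>K\<close> consecutive integers contain \<open>K div Q z\<close> full periods and
  are covered by one more; each period holds exactly \<open>Q z * V z\<close> good integers.\<close>

lemma card_good_bounds:
  "(real K - real (Q z)) * V z \<le> real (card {h\<in>{1..K}. good z (x + h)})"
  "real (card {h\<in>{1..K}. good z (x + h)}) \<le> (real K + real (Q z)) * V z"
proof -
  define q where "q = Q z"
  have q: "q > 0" using Q_pos by (simp add: q_def)
  define n where "n = K div q"
  have n: "n * q \<le> K" "K < Suc n * q"
    using q by (simp_all add: n_def) (metis add.commute dividend_less_div_times mult.commute)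
  define \<phi> where "\<phi> = card {x\<in>{0..<q}. good z x}"
  have \<phi>: "real \<phi> = real q * V z"
    unfolding \<phi>_def q_def Q_def V_def good_def by (rule card_values_coprime_primorial)
  have per: "card {h\<in>{a..<a + t * q}. good z h} = t * \<phi>" for a t
    unfolding \<phi>_def using q by (intro card_periodic) (auto simp: q_def good_mod)
  have "bij_betw (\<lambda>h. x + h) {h\<in>{1..K}. good z (x + h)} {h\<in>{x + 1..<x + 1 + K}. good z h}"
    by (rule bij_betwI[where g = "\<lambda>h. h - x"]) auto
  then have eq: "card {h\<in>{1..K}. good z (x + h)} = card {h\<in>{x + 1..<x + 1 + K}. good z h}"
    by (rule bij_betw_same_card)
  have "n * \<phi> \<le> card {h\<in>{x + 1..<x + 1 + K}. good z h}"
    unfolding per[of "x + 1", symmetric] using n by (intro card_mono) auto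
  then have lo: "real n * real \<phi> \<le> real (card {h\<in>{1..K}. good z (x + h)})"
    unfolding eq by (simp flip: of_nat_mult)
  have "card {h\<in>{x + 1..<x + 1 + K}. good z h} \<le> Suc n * \<phi>"
    unfolding per[of "x + 1", symmetric] using n by (intro card_mono) auto
  then have hi: "real (card {h\<in>{1..K}. good z (x + h)}) \<le> (1 + real n) * real \<phi>"
    unfolding eq by (metis of_nat_Suc of_nat_le_iff of_nat_mult)
  have n': "real n * real q \<le> real K" "real K \<le> (1 + real n) * real q"
    using n by (metis of_nat_le_iff of_nat_mult, metis less_imp_le of_nat_Suc of_nat_le_iff of_nat_mult)
  have "(real K - real q) * V z \<le> (real n * real q) * V z"
    using n' V_pos[of z] by (intro mult_right_mono) (auto simp: algebra_simps)
  then show "(real K - real (Q z)) * V z \<le> real (card {h\<in>{1..K}. good z (x + h)})"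
    using lo by (simp add: \<phi> q_def mult.assoc)
  have "((1 + real n) * real q) * V z \<le> (real K + real q) * V z"
    using n' V_pos[of z] by (intro mult_right_mono) (auto simp: algebra_simps)
  then show "real (card {h\<in>{1..K}. good z (x + h)}) \<le> (real K + real (Q z)) * V z"
    using hi by (simp add: \<phi> q_def mult.assoc)
qed

text \<open>After exchanging the sums, each residue \<open>x\<close> asks for the number of
  \<open>h\<close> with \<open>x + h\<close> good, which is about \<open>K * V z\<close> whatever
  \<open>x\<close> is. The factor \<open>V z\<close> cancels against the normalisation of
  \<open>U\<close>.\<close>

lemma sum_U_Cons_bounds:
  "(real K - real (Q z)) * U z hs \<le> (\<Sum>h=1..K. U z (h # hs))"
  "(\<Sum>h=1..K. U z (h # hs)) \<le> (real K + real (Q z)) * U z hs"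
proof -
  define X where "X = {x\<in>{0..<Q z}. \<forall>h\<in>set hs. good z (x + h)}"
  define c where "c = (\<lambda>x. real (card {h\<in>{1..K}. good z (x + h)}))"
  have finX: "finite X" by (simp add: X_def)
  have "real (W z (h # hs)) = (\<Sum>x\<in>X. of_bool (good z (x + h)))" for h
  proof -
    have "{x\<in>{0..<Q z}. \<forall>h'\<in>set (h # hs). good z (x + h')} = {x\<in>X. good z (x + h)}" by (auto simp: X_def)
    then show ?thesis unfolding W_def using finX by (simp add: of_bool_def sum.If_cases Int_def)
  qed
  then have "(\<Sum>h=1..K. real (W z (h # hs))) = (\<Sum>x\<in>X. \<Sum>h=1..K. of_bool (good z (x + h)))"
    by (simp only:) (rule sum.swap)
  also have "\<dots> = (\<Sum>x\<in>X. c x)"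
    by (intro sum.cong refl) (simp add: c_def of_bool_def sum.If_cases Int_def)
  finally have sumW: "(\<Sum>h=1..K. real (W z (h # hs))) = (\<Sum>x\<in>X. c x)" .
  have sumU: "(\<Sum>h=1..K. U z (h # hs)) = (\<Sum>x\<in>X. c x) / real (Q z) / V z ^ Suc (length hs)"
    unfolding U_eq_W sumW[symmetric] by (simp add: sum_divide_distrib)
  have U: "U z hs = real (card X) / real (Q z) / V z ^ length hs" unfolding U_eq_W W_def X_def ..
  have nz: "V z \<noteq> 0" using V_pos[of z] by simp
  have scale: "(a * V z * real (card X)) / real (Q z) / V z ^ Suc (length hs) = a * U z hs" for a
    unfolding U using nz by simp
  have "(\<Sum>x\<in>X. (real K - real (Q z)) * V z) \<le> (\<Sum>x\<in>X. c x)"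
    unfolding c_def by (intro sum_mono card_good_bounds)
  then have "((real K - real (Q z)) * V z * real (card X)) / real (Q z) / V z ^ Suc (length hs) \<le> (\<Sum>h=1..K. U z (h # hs))"
    unfolding sumU using V_pos[of z] by (intro divide_right_mono) (auto simp: mult_ac intro: less_imp_le)
  then show "(real K - real (Q z)) * U z hs \<le> (\<Sum>h=1..K. U z (h # hs))" unfolding scale .
  have "(\<Sum>x\<in>X. c x) \<le> (\<Sum>x\<in>X. (real K + real (Q z)) * V z)"
    unfolding c_def by (intro sum_mono card_good_bounds)
  then have "(\<Sum>h=1..K. U z (h # hs)) \<le> ((real K + real (Q z)) * V z * real (card X)) / real (Q z) / V z ^ Suc (length hs)"
    unfolding sumU using V_pos[of z] by (intro divide_right_mono) (auto simp: mult_ac intro: less_imp_le)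
  then show "(\<Sum>h=1..K. U z (h # hs)) \<le> (real K + real (Q z)) * U z hs" unfolding scale .
qed

text \<open>A crude bound, from dropping the condition at \<open>h\<close>; it is meant for the few
  shifts too close to an earlier one.\<close>

lemma U_Cons_le: "U z (h # hs) \<le> U z hs / V z"
proof -
  have "W z (h # hs) \<le> W z hs" unfolding W_def by (intro card_mono) auto
  then have "real (W z (h # hs)) / real (Q z) / V z ^ Suc (length hs) \<le> real (W z hs) / real (Q z) / V z ^ Suc (length hs)"
    using V_pos[of z] by (intro divide_right_mono) auto
  then show ?thesis unfolding U_eq_W by (simp add: mult_ac)
qed

lemma finite_Sep [simp]: "finite (Sep k K)"
proof -
  have "finite {hs. set hs \<subseteq> {1..K} \<and> length hs = k}" by (rule finite_lists_length_eq) auto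
  then show ?thesis by (rule rev_finite_subset) (auto simp: Sep_def)
qed

lemma Sep_0 [simp]: "Sep 0 K = {[]}" by (auto simp: Sep_def)

lemma sum_Sep_Suc:
  "(\<Sum>hs\<in>Sep (Suc k) K. F hs) = (\<Sum>hs\<in>Sep k K. \<Sum>h | h \<in> {1..K} \<and> (\<forall>h'\<in>set hs. far h h'). F (h # hs))"
proof -
  let ?A = "\<lambda>hs. {h. h \<in> {1..K} \<and> (\<forall>h'\<in>set hs. far h h')}"
  have "Sep (Suc k) K = (\<lambda>(hs, h). h # hs) ` (SIGMA hs:Sep k K. ?A hs)"
  proof (intro equalityI subsetI)
    fix l assume "l \<in> Sep (Suc k) K"
    then obtain h hs where "l = h # hs" "hs \<in> Sep k K" "h \<in> ?A hs" by (cases l) (auto simp: Sep_def)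
    then show "l \<in> (\<lambda>(hs, h). h # hs) ` (SIGMA hs:Sep k K. ?A hs)" by force
  qed (auto simp: Sep_def)
  moreover have "inj_on (\<lambda>(hs, h). h # hs) (SIGMA hs:Sep k K. ?A hs)" by (auto simp: inj_on_def)
  ultimately have "(\<Sum>hs\<in>Sep (Suc k) K. F hs) = (\<Sum>(hs, h)\<in>(SIGMA hs:Sep k K. ?A hs). F (h # hs))"
    by (simp add: sum.reindex o_def case_prod_unfold)
  then show ?thesis by (subst sum.Sigma) auto
qed

text \<open>The lower bound loses the values of the new shift within \<open>L\<close> of an entry of
  \<open>hs\<close>, at most \<open>k * (2 * L + 1)\<close> in number, each costing at most
  \<open>U z hs / V z\<close>.\<close>

lemma sum_U_Sep_Suc_bounds:
  fixes z k K
  defines "S \<equiv> \<lambda>k. \<Sum>hs\<in>Sep k K. U z hs"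
  shows "S (Suc k) \<le> (real K + real (Q z)) * S k"
    and "(real K - real (Q z) - real k * (2 * real L + 1) / V z) * S k \<le> S (Suc k)"
proof -
  let ?A = "\<lambda>hs. {h. h \<in> {1..K} \<and> (\<forall>h'\<in>set hs. far h h')}"
  have "(\<Sum>h\<in>?A hs. U z (h # hs)) \<le> (real K + real (Q z)) * U z hs" for hs
  proof -
    have "(\<Sum>h\<in>?A hs. U z (h # hs)) \<le> (\<Sum>h=1..K. U z (h # hs))"
      by (intro sum_mono2) (auto intro: U_nonneg)
    then show ?thesis using sum_U_Cons_bounds(2) order.trans by blast
  qed
  then show "S (Suc k) \<le> (real K + real (Q z)) * S k"
    unfolding S_def sum_Sep_Suc sum_distrib_left by (intro sum_mono)
  have "(real K - real (Q z) - real k * (2 * real L + 1) / V z) * U z hs \<le> (\<Sum>h\<in>?A hs. U z (h # hs))"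
    if hs: "hs \<in> Sep k K" for hs
  proof -
    let ?B = "{1..K} - ?A hs"
    have "?B \<subseteq> (\<Union>h'\<in>set hs. {h' - L..h' + L})" by fastforce
    then have "card ?B \<le> card (\<Union>h'\<in>set hs. {h' - L..h' + L})" by (intro card_mono) auto
    also have "\<dots> \<le> (\<Sum>h'\<in>set hs. card {h' - L..h' + L})" by (rule card_UN_le) auto
    also have "\<dots> \<le> (\<Sum>h'\<in>set hs. 2 * L + 1)" by (intro sum_mono) auto
    also have "\<dots> = card (set hs) * (2 * L + 1)" by (simp only: sum_constant of_nat_id)
    also have "\<dots> \<le> k * (2 * L + 1)" using hs card_length[of hs] unfolding Sep_def by (intro mult_le_mono1) auto
    finally have cardB: "real (card ?B) \<le> real k * (2 * real L + 1)"
      by (metis (mono_tags, lifting) of_nat_1 of_nat_add of_nat_le_iff of_nat_mult of_nat_numeral)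
    have "(\<Sum>h\<in>?B. U z (h # hs)) \<le> (\<Sum>h\<in>?B. U z hs / V z)" by (intro sum_mono U_Cons_le)
    also have "\<dots> = real (card ?B) * (U z hs / V z)" by simp
    also have "\<dots> \<le> real k * (2 * real L + 1) * (U z hs / V z)"
      using cardB U_nonneg[of z hs] V_pos[of z] by (intro mult_right_mono) auto
    finally have B: "(\<Sum>h\<in>?B. U z (h # hs)) \<le> real k * (2 * real L + 1) / V z * U z hs" by simp
    have "(\<Sum>h=1..K. U z (h # hs)) = (\<Sum>h\<in>?B. U z (h # hs)) + (\<Sum>h\<in>?A hs. U z (h # hs))"
      by (rule sum.subset_diff) auto
    then show ?thesis using B sum_U_Cons_bounds(1)[of K z hs] by (simp add: algebra_simps)
  qed
  then show "(real K - real (Q z) - real k * (2 * real L + 1) / V z) * S k \<le> S (Suc k)"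
    unfolding S_def sum_Sep_Suc sum_distrib_left by (intro sum_mono) auto
qed

text \<open>With the factor \<open>1/4\<close> the primorial is at most
  \<open>4 ^ cutoff K \<le> K^(1/2)\<close>, as \<open>ln 4 \<le> 2\<close>, while the cutoff keeps
  the order of \<open>ln K\<close>.\<close>

definition cutoff :: "nat \<Rightarrow> nat" where "cutoff K = nat \<lfloor>ln (real K) / 4\<rfloor>"

lemma cutoff_at_top: "filterlim cutoff at_top at_top"
  unfolding cutoff_def by real_asymp

lemma Q_cutoff_tendsto: "(\<lambda>K. real (Q (cutoff K)) / real K) \<longlonglongrightarrow> 0"
proof (rule tendsto_sandwich[of "\<lambda>_. 0" _ _ "\<lambda>K. real K powr (-1/2)"])
  show "\<forall>\<^sub>F K in sequentially. real (Q (cutoff K)) / real K \<le> real K powr (-1/2)"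
  proof (rule eventually_sequentiallyI[of 1])
    fix K :: nat assume K: "1 \<le> K"
    have "ln (4::real) = 2 * ln 2" using ln_realpow[of 2 2] by simp
    then have ln4: "ln (4::real) \<le> 2" using ln_le_minus_one[of "2::real"] by simp
    have "real (Q (cutoff K)) \<le> real (4 ^ cutoff K)" unfolding Q_def of_nat_le_iff by (rule primorial_le)
    also have "\<dots> = exp (ln 4 * real (cutoff K))" by (simp add: exp_of_nat2_mult)
    also have "\<dots> \<le> exp (2 * (ln (real K) / 4))"
    proof -
      have "real (cutoff K) \<le> ln (real K) / 4"
        unfolding cutoff_def using K by (intro of_nat_floor) simp
      then have "ln 4 * real (cutoff K) \<le> 2 * (ln (real K) / 4)" using ln4 K by (intro mult_mono) auto
      then show ?thesis by simp
    qed
    also have "\<dots> = real K powr (1/2)" using K by (simp add: powr_def)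
    finally have "real (Q (cutoff K)) / real K \<le> real K powr (1/2) / real K powr 1"
      using K by (simp add: divide_right_mono)
    also have "\<dots> = real K powr (-1/2)" by (subst powr_diff[symmetric]) simp
    finally show "real (Q (cutoff K)) / real K \<le> real K powr (-1/2)" .
  qed
  show "(\<lambda>K. real K powr (-1/2)) \<longlonglongrightarrow> 0" by real_asymp
qed auto

lemma V_cutoff_tendsto: "(\<lambda>K. 1 / V (cutoff K) / real K) \<longlonglongrightarrow> 0"
proof -
  obtain C where C: "C > 0" "\<And>z. 1 / V z \<le> C * max 1 (real z) ^ m" using V_inverse_bound by blast
  show ?thesis
  proof (rule tendsto_sandwich[of "\<lambda>_. 0" _ _ "\<lambda>K. C * ((1 + ln (real K)) ^ m / real K)"])
    show "\<forall>\<^sub>F K in sequentially. 1 / V (cutoff K) / real K \<le> C * ((1 + ln (real K)) ^ m / real K)"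
    proof (rule eventually_sequentiallyI[of 1])
      fix K :: nat assume K: "1 \<le> K"
      have "real (cutoff K) \<le> ln (real K) / 4"
        unfolding cutoff_def using K by (intro of_nat_floor) simp
      then have "max 1 (real (cutoff K)) ^ m \<le> (1 + ln (real K)) ^ m" using K ln_ge_zero[of "real K"] by (intro power_mono) auto
      then have "C * max 1 (real (cutoff K)) ^ m \<le> C * (1 + ln (real K)) ^ m" using C by (intro mult_left_mono) auto
      then have "1 / V (cutoff K) \<le> C * (1 + ln (real K)) ^ m" using C(2)[of "cutoff K"] by linarith
      then show "1 / V (cutoff K) / real K \<le> C * ((1 + ln (real K)) ^ m / real K)"
        using K divide_right_mono[of _ _ "real K"] by fastforce
    qed
    have "(\<lambda>K::nat. (1 + ln (real K)) ^ m / real K) \<longlonglongrightarrow> 0" by real_asymp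
    then show "(\<lambda>K. C * ((1 + ln (real K)) ^ m / real K)) \<longlonglongrightarrow> 0" by (rule tendsto_mult_right_zero)
    show "\<forall>\<^sub>F K in sequentially. 0 \<le> 1 / V (cutoff K) / real K"
      using V_pos by (intro always_eventually allI divide_nonneg_nonneg) (auto intro: less_imp_le)
  qed auto
qed

text \<open>One more shift multiplies the sum by \<open>K (1 + o(1))\<close>, because at the cutoff
  both the period \<open>Q\<close> and \<open>1 / V\<close> are \<open>o(K)\<close>.\<close>

lemma sum_U_Sep_tendsto: "(\<lambda>K. (\<Sum>hs\<in>Sep k K. U (cutoff K) hs) / real K ^ k) \<longlonglongrightarrow> 1"
proof (induction k)
  case 0
  have "U z [] = 1" for z by (simp add: U_def \<beta>_def root_count_def)
  then show ?case by simp
next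
  case (Suc k)
  define r where "r = (\<lambda>k K. (\<Sum>hs\<in>Sep k K. U (cutoff K) hs) / real K ^ k)"
  define q where "q = (\<lambda>K. real (Q (cutoff K)) / real K)"
  define v where "v = (\<lambda>K. 1 / V (cutoff K) / real K)"
  have lims: "q \<longlonglongrightarrow> 0" "v \<longlonglongrightarrow> 0" "r k \<longlonglongrightarrow> 1"
    unfolding q_def v_def r_def using Q_cutoff_tendsto V_cutoff_tendsto Suc by blast+
  have "r (Suc k) \<longlonglongrightarrow> 1"
  proof (rule tendsto_sandwich[of "\<lambda>K. (1 - q K - real k * (2 * real L + 1) * v K) * r k K" _ _ "\<lambda>K. (1 + q K) * r k K"])
    have "(\<lambda>K. (1 + q K) * r k K) \<longlonglongrightarrow> (1 + 0) * 1" by (intro tendsto_intros lims)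
    then show "(\<lambda>K. (1 + q K) * r k K) \<longlonglongrightarrow> 1" by simp
    have "(\<lambda>K. (1 - q K - real k * (2 * real L + 1) * v K) * r k K) \<longlonglongrightarrow> (1 - 0 - real k * (2 * real L + 1) * 0) * 1"
      by (intro tendsto_intros lims)
    then show "(\<lambda>K. (1 - q K - real k * (2 * real L + 1) * v K) * r k K) \<longlonglongrightarrow> 1" by simp
    show "\<forall>\<^sub>F K in sequentially. r (Suc k) K \<le> (1 + q K) * r k K"
    proof (rule eventually_sequentiallyI[of 1])
      fix K :: nat assume K: "1 \<le> K"
      have "r (Suc k) K \<le> (real K + real (Q (cutoff K))) * (\<Sum>hs\<in>Sep k K. U (cutoff K) hs) / real K ^ Suc k"
        unfolding r_def by (intro divide_right_mono sum_U_Sep_Suc_bounds) auto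
      also have "\<dots> = (real K + real (Q (cutoff K))) / real K * r k K" unfolding r_def by simp
      also have "(real K + real (Q (cutoff K))) / real K = 1 + q K" using K by (simp add: q_def add_divide_distrib)
      finally show "r (Suc k) K \<le> (1 + q K) * r k K" .
    qed
    show "\<forall>\<^sub>F K in sequentially. (1 - q K - real k * (2 * real L + 1) * v K) * r k K \<le> r (Suc k) K"
    proof (rule eventually_sequentiallyI[of 1])
      fix K :: nat assume K: "1 \<le> K"
      have "1 - q K - real k * (2 * real L + 1) * v K =
          (real K - real (Q (cutoff K)) - real k * (2 * real L + 1) / V (cutoff K)) / real K"
        using K by (simp add: q_def v_def diff_divide_distrib)
      then have "(1 - q K - real k * (2 * real L + 1) * v K) * r k K =
          (real K - real (Q (cutoff K)) - real k * (2 * real L + 1) / V (cutoff K)) * (\<Sum>hs\<in>Sep k K. U (cutoff K) hs) / real K ^ Suc k"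
        unfolding r_def by simp
      also have "\<dots> \<le> r (Suc k) K"
        unfolding r_def by (intro divide_right_mono sum_U_Sep_Suc_bounds) auto
      finally show "(1 - q K - real k * (2 * real L + 1) * v K) * r k K \<le> r (Suc k) K" .
    qed
  qed
  then show ?case unfolding r_def .
qed

lemma singular_series_shifted_uniform:
  "\<exists>s. s \<longlonglongrightarrow> 0 \<and> (\<forall>\<^sub>F K in sequentially. \<forall>hs\<in>Sep k K.
     \<bar>\<SS>\<^sub>F hs - \<SS> ^ k * U (cutoff K) hs\<bar> \<le> s K * (\<SS> ^ k * U (cutoff K) hs))"
proof -
  obtain B b where B: "B \<ge> 1" "\<And>d. \<bar>real_of_int (poly G d)\<bar> \<le> B * (1 + \<bar>real_of_int d\<bar>) ^ b"
    using poly_abs_bound by blast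
  define C where "C = 2 ^ k * (real k)\<^sup>2 * real M ^ 2"
  define E where "E = (\<lambda>K. C / real (cutoff K) * (1 + real k ^ 2 * (ln (B * (1 + real K) ^ b) / ln (real (cutoff K)))))"
  have lim1: "(\<lambda>K. 1 / real (cutoff K)) \<longlonglongrightarrow> 0"
    unfolding cutoff_def by real_asymp
  have lim2: "(\<lambda>K. 1 / (real (cutoff K) * ln (real (cutoff K)))) \<longlonglongrightarrow> 0"
    unfolding cutoff_def by real_asymp
  \<comment> \<open>The decisive term, from the colliding primes: \<open>cutoff K\<close> has the
    order of \<open>ln K\<close>, so this is of order \<open>1 / ln (ln K)\<close>.\<close>
  have lim3: "(\<lambda>K. ln (1 + real K) / (real (cutoff K) * ln (real (cutoff K)))) \<longlonglongrightarrow> 0"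
    unfolding cutoff_def by real_asymp
  have E_eq: "E K = C * (1 / real (cutoff K)) + C * real k ^ 2 * ln B * (1 / (real (cutoff K) * ln (real (cutoff K)))) +
      C * real k ^ 2 * real b * (ln (1 + real K) / (real (cutoff K) * ln (real (cutoff K))))" for K
  proof -
    have "ln (B * (1 + real K) ^ b) = ln B + real b * ln (1 + real K)"
      using B(1) by (simp add: ln_mult ln_realpow)
    then show ?thesis by (simp add: E_def algebra_simps add_divide_distrib)
  qed
  have E0: "E \<longlonglongrightarrow> 0"
    unfolding E_eq using tendsto_add[OF tendsto_add[OF tendsto_mult_right_zero[OF lim1] tendsto_mult_right_zero[OF lim2]] tendsto_mult_right_zero[OF lim3]]
    by simp
  have "\<forall>\<^sub>F K in sequentially. cutoff K \<ge> max 2 (2 * M)"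
    using cutoff_at_top unfolding filterlim_at_top by blast
  then have "\<forall>\<^sub>F K in sequentially. \<forall>hs\<in>Sep k K.
     \<bar>\<SS>\<^sub>F hs - \<SS> ^ k * U (cutoff K) hs\<bar> \<le> (exp (E K) - 1) * (\<SS> ^ k * U (cutoff K) hs)"
  proof eventually_elim
    case (elim K)
    show ?case
    proof
      fix hs assume "hs \<in> Sep k K"
      then have hs: "length hs = k" "set hs \<subseteq> {1..K}" "sorted_wrt far hs" by (auto simp: Sep_def)
      have "(\<Sum>p | prime p \<and> cutoff K < p \<and> p \<le> y. \<bar>\<beta> hs p - 1\<bar>) \<le> E K" for y
        using \<beta>_tail_bound[OF hs(3,2) _ _ B, of "cutoff K" y] elim unfolding E_def C_def hs(1) by simp
      from singular_series_shifted[OF this]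
      show "\<bar>\<SS>\<^sub>F hs - \<SS> ^ k * U (cutoff K) hs\<bar> \<le> (exp (E K) - 1) * (\<SS> ^ k * U (cutoff K) hs)"
        unfolding hs(1) .
    qed
  qed
  moreover have "(\<lambda>K. exp (E K) - 1) \<longlonglongrightarrow> exp 0 - 1" by (intro tendsto_intros E0)
  ultimately show ?thesis by (intro exI[of _ "\<lambda>K. exp (E K) - 1"]) simp
qed

text \<open>Because the error is relative, as soon as \<open>s K < 1\<close> a zero singular series
  forces \<open>U (cutoff K) hs = 0\<close>, that is, a zero Euler factor. The conjecture excludes
  such families; the obstruction gives an elementary bound for them.\<close>

lemma singular_series_shifted_nonneg_or_obstructed:
  "\<forall>\<^sub>F K in sequentially. \<forall>hs\<in>Sep k K. \<SS>\<^sub>F hs \<ge> 0 \<and>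
    (\<SS>\<^sub>F hs = 0 \<longrightarrow> (\<exists>p. prime p \<and> root_count p (\<F> hs) = p))"
proof -
  obtain s where s: "s \<longlonglongrightarrow> 0" "\<forall>\<^sub>F K in sequentially. \<forall>hs\<in>Sep k K.
     \<bar>\<SS>\<^sub>F hs - \<SS> ^ k * U (cutoff K) hs\<bar> \<le> s K * (\<SS> ^ k * U (cutoff K) hs)"
    using singular_series_shifted_uniform by blast
  have "\<forall>\<^sub>F K in sequentially. s K < 1" using s(1) by (intro order_tendstoD) auto
  then show ?thesis using s(2)
  proof eventually_elim
    case (elim K)
    show ?case
    proof (intro ballI conjI impI)
      fix hs assume hs: "hs \<in> Sep k K"
      let ?u = "\<SS> ^ k * U (cutoff K) hs"
      have u: "?u \<ge> 0" using singular_pos U_nonneg by simp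
      have b: "\<bar>\<SS>\<^sub>F hs - ?u\<bar> \<le> s K * ?u" using elim hs by blast
      have "s K * ?u \<le> 1 * ?u" using elim u by (intro mult_right_mono) auto
      then show "\<SS>\<^sub>F hs \<ge> 0" using b by linarith
      assume "\<SS>\<^sub>F hs = 0"
      then have "(1 - s K) * ?u \<le> 0" using b u by (simp add: algebra_simps)
      then have "?u \<le> 0" using elim by (simp add: mult_le_0_iff)
      then have "U (cutoff K) hs = 0" using u singular_pos by simp
      then obtain p where p: "prime p" "\<beta> hs p = 0" unfolding U_def by (auto simp: prod_zero_iff)
      then have "real (root_count p (\<F> hs)) = real p"
        using local_factor_pos[OF p(1)] prime_gt_0_nat[OF p(1)] unfolding \<beta>_def by (auto simp: field_simps)
      then show "\<exists>p. prime p \<and> root_count p (\<F> hs) = p" using p(1) by auto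
    qed
  qed
qed

text \<open>The relative errors add up to \<open>s K\<close> times the average of the truncated
  products, which stays bounded.\<close>

lemma singular_series_average:
  "(\<lambda>K. (\<Sum>hs\<in>Sep k K. \<SS>\<^sub>F hs) / real K ^ k) \<longlonglongrightarrow> \<SS> ^ k"
proof -
  obtain s where s: "s \<longlonglongrightarrow> 0" "\<forall>\<^sub>F K in sequentially. \<forall>hs\<in>Sep k K.
     \<bar>\<SS>\<^sub>F hs - \<SS> ^ k * U (cutoff K) hs\<bar> \<le> s K * (\<SS> ^ k * U (cutoff K) hs)"
    using singular_series_shifted_uniform by blast
  define r where "r = (\<lambda>K. (\<Sum>hs\<in>Sep k K. U (cutoff K) hs) / real K ^ k)"
  define R where "R = (\<lambda>K. (\<Sum>hs\<in>Sep k K. \<SS>\<^sub>F hs) / real K ^ k)"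
  have r: "r \<longlonglongrightarrow> 1" unfolding r_def by (rule sum_U_Sep_tendsto)
  have "\<forall>\<^sub>F K in sequentially. norm (R K - \<SS> ^ k * r K) \<le> s K * (\<SS> ^ k * r K)"
    using s(2)
  proof eventually_elim
    case (elim K)
    have "R K - \<SS> ^ k * r K = (\<Sum>hs\<in>Sep k K. \<SS>\<^sub>F hs - \<SS> ^ k * U (cutoff K) hs) / real K ^ k"
      by (simp add: R_def r_def sum_subtractf diff_divide_distrib sum_distrib_left)
    also have "norm \<dots> \<le> (\<Sum>hs\<in>Sep k K. s K * (\<SS> ^ k * U (cutoff K) hs)) / real K ^ k"
    proof -
      have "norm (\<Sum>hs\<in>Sep k K. \<SS>\<^sub>F hs - \<SS> ^ k * U (cutoff K) hs) \<le>
          (\<Sum>hs\<in>Sep k K. s K * (\<SS> ^ k * U (cutoff K) hs))"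
        using elim by (intro sum_norm_le) (simp only: real_norm_def)
      then show ?thesis by (simp add: norm_divide divide_right_mono)
    qed
    also have "\<dots> = s K * (\<SS> ^ k * r K)" by (simp add: r_def sum_distrib_left)
    finally show ?case .
  qed
  moreover have "(\<lambda>K. s K * (\<SS> ^ k * r K)) \<longlonglongrightarrow> 0"
    using tendsto_mult[OF s(1) tendsto_mult[OF tendsto_const r]] by simp
  ultimately have "(\<lambda>K. R K - \<SS> ^ k * r K) \<longlonglongrightarrow> 0" by (rule Lim_null_comparison)
  from tendsto_add[OF this tendsto_mult[OF tendsto_const[of "\<SS> ^ k"] r]] show ?thesis by (simp add: R_def)
qed

end

section \<open>Applications of the Bateman--Horn conjecture\<close>

lemma uniform_Bateman_HornE:
  assumes "uniform_Bateman_Horn" "\<epsilon> > 0"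
  obtains C where "\<And>gs N. primitive_family gs \<Longrightarrow> singular_series gs \<noteq> 0 \<Longrightarrow> (N::nat) \<ge> 2 \<Longrightarrow>
      \<exists>E::real. real (seed_count (real N) gs) =
        1 / real (peg gs) * singular_series gs * (real N / ln (real N) ^ length gs) * (1 + E) \<and>
        \<bar>E\<bar> \<le> C (map degree gs) * (real_of_int (height_sum gs) powr \<epsilon> / ln (real N))"
proof -
  from assms(1) obtain C :: "real \<Rightarrow> nat list \<Rightarrow> real" where C:
    "\<forall>\<epsilon>>0. \<forall>gs. primitive_family gs \<longrightarrow> singular_series gs \<noteq> 0 \<longrightarrow>
          (\<forall>N::nat. N \<ge> 2 \<longrightarrow>
             (\<exists>E::real.
                real (seed_count (real N) gs) =
                  1 / real (peg gs) * singular_series gs * (real N / ln (real N) ^ length gs) * (1 + E) \<and>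
                \<bar>E\<bar> \<le> C \<epsilon> (map degree gs) * (real_of_int (height_sum gs) powr \<epsilon> / ln (real N))))"
    unfolding uniform_Bateman_Horn_def by (elim exE)
  show thesis by (rule that[of "C \<epsilon>"]) (rule C[rule_format, OF assms(2)])
qed

text \<open>For a fixed family the height factor is a constant, so any \<open>\<epsilon>\<close>
  serves; here it is 1.\<close>

lemma Bateman_Horn_fixed:
  assumes "uniform_Bateman_Horn" "primitive_family gs" "singular_series gs \<noteq> 0"
  shows "(\<lambda>N. real (seed_count (real N) gs) * ln (real N) ^ length gs / real N) \<longlonglongrightarrow> singular_series gs / real (peg gs)"
proof -
  obtain C where C: "\<And>gs N. primitive_family gs \<Longrightarrow> singular_series gs \<noteq> 0 \<Longrightarrow> (N::nat) \<ge> 2 \<Longrightarrow>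
      \<exists>E::real. real (seed_count (real N) gs) =
        1 / real (peg gs) * singular_series gs * (real N / ln (real N) ^ length gs) * (1 + E) \<and>
        \<bar>E\<bar> \<le> C (map degree gs) * (real_of_int (height_sum gs) powr 1 / ln (real N))"
    using uniform_Bateman_HornE[OF assms(1) zero_less_one] by blast
  define c where "c = C (map degree gs) * (real_of_int (height_sum gs) powr 1)"
  define T where "T = singular_series gs / real (peg gs)"
  have "\<forall>\<^sub>F N in sequentially. norm (real (seed_count (real N) gs) * ln (real N) ^ length gs / real N - T) \<le> \<bar>T\<bar> * (c * (1 / ln (real N)))"
  proof (rule eventually_sequentiallyI[of 2])
    fix N :: nat assume N: "2 \<le> N"
    from C[OF assms(2,3) N] obtain E where E: "real (seed_count (real N) gs) = 1 / real (peg gs) * singular_series gs * (real N / ln (real N) ^ length gs) * (1 + E)"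
      "\<bar>E\<bar> \<le> C (map degree gs) * (real_of_int (height_sum gs) powr 1 / ln (real N))"
      by blast
    have "ln (real N) > 0" using N by simp
    then have "real (seed_count (real N) gs) * ln (real N) ^ length gs / real N = T * (1 + E)"
      unfolding E(1) T_def using N by simp
    then have "real (seed_count (real N) gs) * ln (real N) ^ length gs / real N - T = T * E"
      by (simp add: algebra_simps)
    also have "norm \<dots> \<le> \<bar>T\<bar> * (c * (1 / ln (real N)))"
      unfolding real_norm_def abs_mult using E(2) by (intro mult_left_mono) (auto simp: c_def)
    finally show "norm (real (seed_count (real N) gs) * ln (real N) ^ length gs / real N - T) \<le> \<bar>T\<bar> * (c * (1 / ln (real N)))" .
  qed
  moreover have "(\<lambda>N::nat. 1 / ln (real N)) \<longlonglongrightarrow> 0" by real_asymp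
  then have "(\<lambda>N. \<bar>T\<bar> * (c * (1 / ln (real N)))) \<longlonglongrightarrow> 0" by (intro tendsto_mult_right_zero)
  ultimately have "(\<lambda>N. real (seed_count (real N) gs) * ln (real N) ^ length gs / real N - T) \<longlonglongrightarrow> 0"
    by (rule Lim_null_comparison)
  then show ?thesis unfolding T_def[symmetric] by (simp add: LIM_zero_iff)
qed

section \<open>Families with a local obstruction\<close>

lemma card_value_eq_le:
  fixes g :: "int poly"
  assumes "degree g \<ge> 1"
  shows "finite {n::nat. poly g (int n) = c}" "card {n::nat. poly g (int n) = c} \<le> degree g"
proof -
  let ?g = "g - [:c:]"
  have nz: "?g \<noteq> 0" using assms by auto
  have deg: "degree ?g \<le> degree g" by (rule degree_diff_le) auto
  have sub: "int ` {n::nat. poly g (int n) = c} \<subseteq> {x. poly ?g x = 0}" by auto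
  have fin: "finite {x. poly ?g x = 0}" using nz by (rule poly_roots_finite)
  then show "finite {n::nat. poly g (int n) = c}"
    using sub by (metis (no_types, lifting) finite_imageD finite_subset inj_on_of_nat)
  have "card {n::nat. poly g (int n) = c} = card (int ` {n::nat. poly g (int n) = c})"
    by (simp add: card_image)
  also have "\<dots> \<le> card {x. poly ?g x = 0}" by (intro card_mono fin sub)
  also have "\<dots> \<le> degree ?g" using nz by (rule card_poly_roots_bound)
  finally show "card {n::nat. poly g (int n) = c} \<le> degree g" using deg by simp
qed

text \<open>At every \<open>n\<close> some member is divisible by \<open>p\<close>. At a seed that
  value is prime, so it equals \<open>p\<close>, and a member \<open>g\<close> takes the value
  \<open>p\<close> at most \<open>degree g\<close> times.\<close>

lemma seed_count_obstructed:
  assumes "primitive_family gs" "prime p" "root_count p gs = p"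
  shows "seed_count x gs \<le> (\<Sum>g\<leftarrow>gs. degree g)"
proof -
  have deg: "degree g \<ge> 1" if "g \<in> set gs" for g using that assms(1) by (auto simp: primitive_family_def)
  have "card {x\<in>{0..<p}. divides_value gs p x} = card {0..<p}"
    using assms(3) by (simp add: root_count_altdef)
  then have "{x\<in>{0..<p}. divides_value gs p x} = {0..<p}" by (intro card_subset_eq) auto
  then have dv: "divides_value gs p n" for n
  proof -
    have "n mod p \<in> {0..<p}" using prime_gt_0_nat[OF assms(2)] by simp
    then have "divides_value gs p (n mod p)" using \<open>{x\<in>{0..<p}. divides_value gs p x} = {0..<p}\<close> by blast
    then show ?thesis by (simp only: divides_value_mod)
  qed
  have "{n. prime_seed gs n \<and> real n \<le> x} \<subseteq> (\<Union>g\<in>set gs. {n. poly g (int n) = int p})"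
  proof
    fix n assume n: "n \<in> {n. prime_seed gs n \<and> real n \<le> x}"
    obtain g where g: "g \<in> set gs" "int p dvd poly g (int n)" using dv[of n] by (auto simp: divides_value_def)
    have "prime (poly g (int n))" using n g by (auto simp: prime_seed_def)
    then have "poly g (int n) = int p" using g(2) assms(2) by (metis assms(2) prime_nat_int_transfer primes_dvd_imp_eq)
    then show "n \<in> (\<Union>g\<in>set gs. {n. poly g (int n) = int p})" using g by auto
  qed
  then have "seed_count x gs \<le> card (\<Union>g\<in>set gs. {n::nat. poly g (int n) = int p})"
    unfolding seed_count_def by (intro card_mono) (auto intro: card_value_eq_le(1) deg)
  also have "\<dots> \<le> (\<Sum>g\<in>set gs. card {n::nat. poly g (int n) = int p})" by (intro card_UN_le) auto
  also have "\<dots> \<le> (\<Sum>g\<in>set gs. degree g)" by (intro sum_mono card_value_eq_le(2) deg)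
  also have "\<dots> = (\<Sum>g\<leftarrow>gs. degree g)"
    using assms(1) by (simp add: primitive_family_def sum_list_distinct_conv_sum_set)
  finally show ?thesis .
qed

context separated_family
begin

lemma height_error_tendsto:
  fixes K :: "nat \<Rightarrow> nat"
  assumes "C \<ge> 0" "\<forall>\<^sub>F N in sequentially. 1 + real (K N) \<le> c * ln (real N) ^ m"
  shows "\<exists>\<epsilon>>0. (\<lambda>N. (C * (1 + real (K N)) ^ e) powr \<epsilon> / ln (real N)) \<longlonglongrightarrow> 0"
proof (intro exI conjI)
  \<comment> \<open>Up to a constant the height is at most \<open>(ln N)^(m * e)\<close>. This
    choice makes \<open>m * e * \<epsilon> \<le> 1/2\<close>, so a factor
    \<open>(ln N)^(1/2)\<close> survives in the denominator; the \<open>+ 1\<close> covers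
    \<open>e = 0\<close>.\<close>
  define \<epsilon> :: real where "\<epsilon> = 1 / (2 * (real e * real m + 1))"
  have em: "real e * real m \<ge> 0" by simp
  then show \<epsilon>: "\<epsilon> > 0" unfolding \<epsilon>_def by (intro divide_pos_pos mult_pos_pos add_nonneg_pos) auto
  have "x * (1 / (2 * (x + 1))) \<le> 1 / 2" if "x \<ge> 0" for x :: real
    using that by (simp add: divide_simps)
  from this[OF em] have \<epsilon>2: "real (m * e) * \<epsilon> \<le> 1 / 2" unfolding \<epsilon>_def by (simp add: mult_ac)
  define D where "D = C * \<bar>c\<bar> ^ e"
  have D0: "D \<ge> 0" using assms(1) by (simp add: D_def)
  have "\<forall>\<^sub>F N::nat in sequentially. ln (real N) \<ge> 1" by real_asymp
  then have "\<forall>\<^sub>F N in sequentially. norm ((C * (1 + real (K N)) ^ e) powr \<epsilon> / ln (real N)) \<le> D powr \<epsilon> * ln (real N) powr (-1/2)"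
    using assms(2)
  proof eventually_elim
    case (elim N)
    let ?l = "ln (real N)"
    have "(1 + real (K N)) ^ e \<le> (\<bar>c\<bar> * ?l ^ m) ^ e"
    proof (intro power_mono)
      have "c * ?l ^ m \<le> \<bar>c\<bar> * ?l ^ m" using elim by (intro mult_right_mono) auto
      then show "1 + real (K N) \<le> \<bar>c\<bar> * ?l ^ m" using elim by linarith
    qed auto
    then have "C * (1 + real (K N)) ^ e \<le> D * ?l ^ (m * e)"
      using assms(1) by (simp add: D_def power_mult_distrib power_mult mult.assoc mult_left_mono)
    then have "(C * (1 + real (K N)) ^ e) powr \<epsilon> \<le> (D * ?l ^ (m * e)) powr \<epsilon>"
      using assms(1) \<epsilon> by (intro powr_mono2) auto
    also have "\<dots> = D powr \<epsilon> * ?l powr (real (m * e) * \<epsilon>)"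
      using D0 elim by (simp add: powr_mult powr_powr flip: powr_realpow)
    also have "\<dots> \<le> D powr \<epsilon> * ?l powr (1/2)"
      using elim \<epsilon>2 by (intro mult_left_mono powr_mono) auto
    finally have "(C * (1 + real (K N)) ^ e) powr \<epsilon> / ?l \<le> D powr \<epsilon> * ?l powr (1/2) / ?l"
      using elim by (intro divide_right_mono) auto
    also have "\<dots> = D powr \<epsilon> * ?l powr (-1/2)"
      using elim powr_diff[of ?l "1/2" 1] by simp
    finally show ?case using elim by simp
  qed
  moreover have "(\<lambda>N::nat. ln (real N) powr (-1/2)) \<longlonglongrightarrow> 0" by real_asymp
  then have "(\<lambda>N::nat. D powr \<epsilon> * ln (real N) powr (-1/2)) \<longlonglongrightarrow> 0" by (rule tendsto_mult_right_zero)
  ultimately show "(\<lambda>N. (C * (1 + real (K N)) ^ e) powr \<epsilon> / ln (real N)) \<longlonglongrightarrow> 0" by (rule Lim_null_comparison)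
qed

text \<open>The relative error comes from the conjecture: all families in question have the same
  list of degrees, so one implied constant serves every \<open>hs\<close>. The additive
  \<open>k * M\<close> covers the families with zero singular series.\<close>

lemma Bateman_Horn_shifted:
  fixes K :: "nat \<Rightarrow> nat"
  assumes BH: "uniform_Bateman_Horn" and k: "k > 0"
    and K: "filterlim K at_top at_top" "\<forall>\<^sub>F N in sequentially. 1 + real (K N) \<le> c * ln (real N) ^ m"
  defines "A \<equiv> \<lambda>N. real N / (real (peg fs) * ln (real N) ^ m) ^ k"
  shows "\<exists>\<eta>. \<eta> \<longlonglongrightarrow> 0 \<and> (\<forall>\<^sub>F N in sequentially. \<forall>hs\<in>Sep k (K N).
    \<bar>real (seed_count (real N) (\<F> hs)) - A N * \<SS>\<^sub>F hs\<bar> \<le>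
      \<eta> N * (A N * \<SS>\<^sub>F hs) + real (k * M))"
proof -
  obtain C e where C: "C \<ge> 0" "\<And>hs K. set hs \<subseteq> {..K} \<Longrightarrow>
      real_of_int (height_sum (\<F> hs)) \<le> real (length hs) * C * (1 + real K) ^ e"
    using height_sum_shifted_bound by blast
  obtain \<epsilon> where \<epsilon>: "\<epsilon> > 0" "(\<lambda>N. ((real k * C) * (1 + real (K N)) ^ e) powr \<epsilon> / ln (real N)) \<longlonglongrightarrow> 0"
    using height_error_tendsto[OF _ K(2), of "real k * C" e] C(1) by auto
  obtain CB where CB: "\<And>gs N. primitive_family gs \<Longrightarrow> singular_series gs \<noteq> 0 \<Longrightarrow> (N::nat) \<ge> 2 \<Longrightarrow>
      \<exists>E::real. real (seed_count (real N) gs) =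
        1 / real (peg gs) * singular_series gs * (real N / ln (real N) ^ length gs) * (1 + E) \<and>
        \<bar>E\<bar> \<le> CB (map degree gs) * (real_of_int (height_sum gs) powr \<epsilon> / ln (real N))"
    using uniform_Bateman_HornE[OF BH \<epsilon>(1)] by blast
  define c0 where "c0 = \<bar>CB (concat (replicate k (map degree fs)))\<bar>"
  define \<eta> where "\<eta> = (\<lambda>N. c0 * (((real k * C) * (1 + real (K N)) ^ e) powr \<epsilon> / ln (real N)))"
  have "\<eta> \<longlonglongrightarrow> 0" unfolding \<eta>_def by (intro tendsto_mult_right_zero \<epsilon>)
  moreover have "\<forall>\<^sub>F N in sequentially. \<forall>hs\<in>Sep k (K N). \<SS>\<^sub>F hs \<ge> 0 \<and>
    (\<SS>\<^sub>F hs = 0 \<longrightarrow> (\<exists>p. prime p \<and> root_count p (\<F> hs) = p))"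
    using eventually_compose_filterlim[OF singular_series_shifted_nonneg_or_obstructed K(1)] .
  then have "\<forall>\<^sub>F N in sequentially. \<forall>hs\<in>Sep k (K N).
    \<bar>real (seed_count (real N) (\<F> hs)) - A N * \<SS>\<^sub>F hs\<bar> \<le>
      \<eta> N * (A N * \<SS>\<^sub>F hs) + real (k * M)"
    using eventually_ge_at_top[of 2]
  proof eventually_elim
    case (elim N)
    show ?case
    proof
      fix hs assume hs: "hs \<in> Sep k (K N)"
      let ?g = "\<F> hs"
      have hs': "length hs = k" "set hs \<subseteq> {1..K N}" "sorted_wrt far hs" using hs by (auto simp: Sep_def)
      have prim: "primitive_family ?g" using hs' k by (intro primitive_shifted_family) auto
      have lnN: "ln (real N) > 0" using elim(2) by simp
      have A: "A N \<ge> 0" unfolding A_def using lnN by simp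
      have AS: "A N * singular_series ?g \<ge> 0" using A elim(1) hs by simp
      have \<eta>0: "\<eta> N \<ge> 0" unfolding \<eta>_def c0_def using lnN by simp
      show "\<bar>real (seed_count (real N) ?g) - A N * singular_series ?g\<bar> \<le> \<eta> N * (A N * singular_series ?g) + real (k * M)"
      proof (cases "singular_series ?g = 0")
        case True
        then obtain p where "prime p" "root_count p ?g = p" using elim(1) hs by blast
        then have "seed_count (real N) ?g \<le> (\<Sum>g\<leftarrow>?g. degree g)" by (rule seed_count_obstructed[OF prim])
        also have "(\<Sum>g\<leftarrow>?g. degree g) = k * M"
          unfolding map_degree_shifted_family hs'(1) by (induction k) auto
        finally show ?thesis using True by (simp flip: of_nat_mult)
      next
        case False
        obtain E where E: "real (seed_count (real N) ?g) =
            1 / real (peg ?g) * singular_series ?g * (real N / ln (real N) ^ length ?g) * (1 + E)"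
          "\<bar>E\<bar> \<le> CB (map degree ?g) * (real_of_int (height_sum ?g) powr \<epsilon> / ln (real N))"
          using CB[OF prim False elim(2)] by blast
        have "real (seed_count (real N) ?g) = A N * singular_series ?g * (1 + E)"
          unfolding E(1) A_def peg_shifted_family length_shifted_family hs'(1)
          by (simp add: power_mult_distrib mult.commute flip: power_mult)
        then have "real (seed_count (real N) ?g) - A N * singular_series ?g = A N * singular_series ?g * E"
          by (simp add: algebra_simps)
        then have eq: "\<bar>real (seed_count (real N) ?g) - A N * singular_series ?g\<bar> = A N * singular_series ?g * \<bar>E\<bar>"
          using abs_of_nonneg[OF AS] by (simp only: abs_mult[of "A N * singular_series ?g" E])
        have "real_of_int (height_sum ?g) powr \<epsilon> \<le> ((real k * C) * (1 + real (K N)) ^ e) powr \<epsilon>"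
          using C(2)[of hs "K N"] hs' \<epsilon>(1) height_sum_nonneg[of ?g] by (intro powr_mono2) fastforce+
        then have "real_of_int (height_sum ?g) powr \<epsilon> / ln (real N) \<le> ((real k * C) * (1 + real (K N)) ^ e) powr \<epsilon> / ln (real N)"
          using lnN by (intro divide_right_mono) auto
        then have "CB (map degree ?g) * (real_of_int (height_sum ?g) powr \<epsilon> / ln (real N)) \<le> \<eta> N"
          unfolding \<eta>_def c0_def map_degree_shifted_family hs'(1) using lnN by (intro mult_mono) auto
        then have "\<bar>E\<bar> \<le> \<eta> N" using E(2) by linarith
        then have "A N * singular_series ?g * \<bar>E\<bar> \<le> A N * singular_series ?g * \<eta> N" using AS by (intro mult_left_mono)
        then have "\<bar>real (seed_count (real N) ?g) - A N * singular_series ?g\<bar> \<le> \<eta> N * (A N * singular_series ?g)"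
          unfolding eq by (simp add: mult.commute)
        then show ?thesis by (simp add: add_increasing2)
      qed
    qed
  qed
  ultimately show ?thesis by blast
qed

lemma peg_pos: "peg fs > 0"
  using prim unfolding peg_def primitive_family_def by (intro Nat.gr0I) (force simp: prod_list_zero_iff)

text \<open>The main terms give \<open>(K N / D N)^k\<close> times an average of singular series,
  which tends to \<open>(lam / \<SS>)^k * \<SS>^k\<close>. The additive errors sum to at most
  \<open>k * M * K N ^ k\<close>, bounded by a power of \<open>ln N\<close>.\<close>

lemma seed_count_shifted_average:
  fixes K :: "nat \<Rightarrow> nat"
  assumes BH: "uniform_Bateman_Horn"
    and K: "filterlim K at_top at_top"
      "(\<lambda>N. real (K N) / (real (peg fs) * ln (real N) ^ m)) \<longlonglongrightarrow> lam / \<SS>"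
  shows "(\<lambda>N. (\<Sum>hs\<in>Sep k (K N). real (seed_count (real N) (\<F> hs))) / real N) \<longlonglongrightarrow> lam ^ k"
proof (cases "k = 0")
  case True
  \<comment> \<open>The empty family is not primitive, so the conjecture does not cover
    \<open>k = 0\<close>.\<close>
  have "seed_count (real N) [] = N" for N
  proof -
    have "{n. prime_seed [] n \<and> real n \<le> real N} = {1..N}" by (auto simp: prime_seed_def)
    then show ?thesis by (simp add: seed_count_def)
  qed
  moreover have "(\<lambda>N::nat. real N / real N) \<longlonglongrightarrow> 1" by real_asymp
  ultimately show ?thesis using True by simp
next
  case False
  define D where "D = (\<lambda>N::nat. real (peg fs) * ln (real N) ^ m)"
  define A where "A = (\<lambda>N. real N / D N ^ k)"
  define sc where "sc = (\<lambda>N hs. real (seed_count (real N) (\<F> hs)))"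
  define ss where "ss = (\<lambda>hs. \<SS>\<^sub>F hs)"
  define R where "R = (\<lambda>N. (\<Sum>hs\<in>Sep k (K N). ss hs) / real (K N) ^ k)"
  define \<rho> where "\<rho> = (\<lambda>N. real (K N) / D N)"
  have \<rho>: "\<rho> \<longlonglongrightarrow> lam / \<SS>" using K(2) by (simp add: \<rho>_def D_def)
  have R: "R \<longlonglongrightarrow> \<SS> ^ k"
    unfolding R_def ss_def by (rule filterlim_compose[OF singular_series_average K(1)])
  have lnge: "\<forall>\<^sub>F N::nat in sequentially. ln (real N) \<ge> 1" by real_asymp
  have Dpos: "\<forall>\<^sub>F N in sequentially. D N \<ge> 1"
    using lnge
  proof eventually_elim
    case (elim N)
    have "1 * 1 \<le> real (peg fs) * ln (real N) ^ m" using elim peg_pos by (intro mult_mono one_le_power) auto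
    then show ?case by (simp add: D_def)
  qed
  have Kle: "\<forall>\<^sub>F N in sequentially. 1 + real (K N) \<le> (1 + (\<bar>lam / \<SS>\<bar> + 1) * real (peg fs)) * ln (real N) ^ m"
  proof -
    have "\<forall>\<^sub>F N in sequentially. \<rho> N < \<bar>lam / \<SS>\<bar> + 1" 
      using order_tendstoD(2)[OF \<rho>, of "\<bar>lam / \<SS>\<bar> + 1"] abs_ge_self[of "lam / \<SS>"] by linarith
    then show ?thesis using Dpos lnge
    proof eventually_elim
      case (elim N)
      have "real (K N) \<le> (\<bar>lam / \<SS>\<bar> + 1) * D N" using elim by (simp add: \<rho>_def divide_less_eq)
      moreover have "1 \<le> ln (real N) ^ m" using elim by (intro one_le_power)
      ultimately show ?case by (simp add: D_def algebra_simps)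
    qed
  qed
  obtain \<eta> where \<eta>: "\<eta> \<longlonglongrightarrow> 0" "\<forall>\<^sub>F N in sequentially. \<forall>hs\<in>Sep k (K N). \<bar>sc N hs - A N * ss hs\<bar> \<le> \<eta> N * (A N * ss hs) + real (k * M)"
    using Bateman_Horn_shifted[OF BH _ K(1) Kle, of k] False unfolding A_def D_def sc_def ss_def by auto
  have AR: "A N * (\<Sum>hs\<in>Sep k (K N). ss hs) / real N = \<rho> N ^ k * R N" if "N > 0" "K N > 0" for N
    using that by (simp add: A_def R_def \<rho>_def power_divide)
  have Kpos: "\<forall>\<^sub>F N in sequentially. K N > 0" using K(1) by (rule eventually_compose_filterlim[OF eventually_gt_at_top])
  have cardSep: "card (Sep k (K N)) \<le> K N ^ k" for N
  proof -
    have "card (Sep k (K N)) \<le> card {hs. set hs \<subseteq> {1..K N} \<and> length hs = k}"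
      by (intro card_mono finite_lists_length_eq) (auto simp: Sep_def)
    also have "\<dots> = K N ^ k" by (subst card_lists_length_eq) auto
    finally show ?thesis .
  qed
  have "\<forall>\<^sub>F N in sequentially. norm ((\<Sum>hs\<in>Sep k (K N). sc N hs) / real N - \<rho> N ^ k * R N) \<le>
      \<eta> N * (\<rho> N ^ k * R N) + real (k * M) * (real (K N) ^ k / real N)"
    using \<eta>(2) eventually_gt_at_top[of 0] Kpos
  proof eventually_elim
    case (elim N)
    have "(\<Sum>hs\<in>Sep k (K N). sc N hs) / real N - \<rho> N ^ k * R N = (\<Sum>hs\<in>Sep k (K N). sc N hs - A N * ss hs) / real N"
      by (simp add: AR[OF elim(2,3), symmetric] sum_subtractf sum_distrib_left diff_divide_distrib)
    also have "norm \<dots> \<le> (\<Sum>hs\<in>Sep k (K N). \<eta> N * (A N * ss hs) + real (k * M)) / real N"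
    proof -
      have "norm (\<Sum>hs\<in>Sep k (K N). sc N hs - A N * ss hs) \<le> (\<Sum>hs\<in>Sep k (K N). \<eta> N * (A N * ss hs) + real (k * M))"
        using elim(1) by (intro sum_norm_le) (simp only: real_norm_def)
      then show ?thesis by (simp add: norm_divide divide_right_mono)
    qed
    also have "\<dots> = \<eta> N * (A N * (\<Sum>hs\<in>Sep k (K N). ss hs) / real N) + real (card (Sep k (K N))) * real (k * M) / real N"
      by (simp add: sum.distrib add_divide_distrib sum_distrib_left)
    also have "\<dots> \<le> \<eta> N * (\<rho> N ^ k * R N) + real (k * M) * (real (K N) ^ k / real N)"
    proof -
      have "real (card (Sep k (K N))) \<le> real (K N) ^ k" using cardSep[of N] by (metis of_nat_le_iff of_nat_power)
      then have "real (card (Sep k (K N))) * real (k * M) / real N \<le> real (K N) ^ k * real (k * M) / real N"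
        by (intro divide_right_mono mult_right_mono) auto
      then show ?thesis unfolding AR[OF elim(2,3)] by (simp add: mult.commute)
    qed
    finally show ?case .
  qed
  moreover have "(\<lambda>N. \<eta> N * (\<rho> N ^ k * R N) + real (k * M) * (real (K N) ^ k / real N)) \<longlonglongrightarrow> 0"
  proof -
    have "(\<lambda>N::nat. ln (real N) ^ (m * k) / real N) \<longlonglongrightarrow> 0" by real_asymp
    then have "(\<lambda>N. \<rho> N ^ k * real (peg fs) ^ k * (ln (real N) ^ (m * k) / real N)) \<longlonglongrightarrow> (lam / \<SS>) ^ k * real (peg fs) ^ k * 0"
      by (intro tendsto_intros \<rho>)
    moreover have "\<forall>\<^sub>F N in sequentially. \<rho> N ^ k * real (peg fs) ^ k * (ln (real N) ^ (m * k) / real N) = real (K N) ^ k / real N"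
      using Dpos
    proof eventually_elim
      case (elim N)
      have "\<rho> N * D N = real (K N)" using elim by (simp add: \<rho>_def)
      then have "\<rho> N ^ k * (real (peg fs) ^ k * ln (real N) ^ (m * k)) = real (K N) ^ k"
        unfolding D_def by (metis power_mult power_mult_distrib)
      then show ?case by (simp add: mult.assoc)
    qed
    ultimately have "(\<lambda>N. real (K N) ^ k / real N) \<longlonglongrightarrow> 0" using Lim_transform_eventually by fastforce
    then have "(\<lambda>N. real (k * M) * (real (K N) ^ k / real N)) \<longlonglongrightarrow> 0" by (rule tendsto_mult_right_zero)
    moreover have "(\<lambda>N. \<eta> N * (\<rho> N ^ k * R N)) \<longlonglongrightarrow> 0 * ((lam / \<SS>) ^ k * \<SS> ^ k)"
      by (intro tendsto_intros \<eta> \<rho> R)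
    ultimately show ?thesis using tendsto_add by fastforce
  qed
  ultimately have "(\<lambda>N. (\<Sum>hs\<in>Sep k (K N). sc N hs) / real N - \<rho> N ^ k * R N) \<longlonglongrightarrow> 0" by (rule Lim_null_comparison)
  moreover have "(\<lambda>N. \<rho> N ^ k * R N) \<longlonglongrightarrow> (lam / \<SS>) ^ k * \<SS> ^ k" by (intro tendsto_intros \<rho> R)
  ultimately have "(\<lambda>N. ((\<Sum>hs\<in>Sep k (K N). sc N hs) / real N - \<rho> N ^ k * R N) + \<rho> N ^ k * R N) \<longlonglongrightarrow> 0 + (lam / \<SS>) ^ k * \<SS> ^ k"
    by (rule tendsto_add)
  then show ?thesis using singular_nz by (simp add: sc_def power_divide)
qed

end

section \<open>Pairs of prime seeds at a fixed distance\<close>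

context separated_family
begin

lemma divides_value_not_all:
  assumes "prime p" shows "\<exists>x. \<not> divides_value fs p x"
proof (rule ccontr)
  assume "\<not> ?thesis"
  then have "{x\<in>{0..<p}. divides_value fs p x} = {0..<p}" by auto
  then have "\<nu> p = p" by (simp add: root_count_altdef)
  then show False using root_count_less[OF assms] by simp
qed

text \<open>If the shifted copy contributed no new root, the root set would be invariant under
  subtraction of \<open>d\<close>. For \<open>d\<close> invertible modulo \<open>p\<close> it would
  be empty or everything, and the nonzero singular series excludes the latter.\<close>

lemma root_count_pair:
  fixes d :: nat
  assumes "prime p"
  defines "g2 \<equiv> fs @ affine_family 1 d fs"
  shows "\<nu> p \<le> root_count p g2"
    and "\<not> p dvd d \<Longrightarrow> \<nu> p > 0 \<Longrightarrow> \<nu> p < root_count p g2"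
proof -
  let ?R = "{x\<in>{0..<p}. divides_value fs p x}" and ?R2 = "{x\<in>{0..<p}. divides_value g2 p x}"
  have g2: "divides_value g2 p x \<longleftrightarrow> divides_value fs p x \<or> divides_value fs p (d + x)" for x
    by (simp add: g2_def divides_value_append divides_value_affine_family)
  have sub: "?R \<subseteq> ?R2" using g2 by auto
  then show "\<nu> p \<le> root_count p g2" unfolding root_count_altdef by (intro card_mono) auto
  assume d: "\<not> p dvd d" and pos: "\<nu> p > 0"
  have "?R \<noteq> ?R2"
  proof
    assume eq: "?R = ?R2"
    have step: "divides_value fs p x" if "divides_value fs p (d + x)" for x
    proof -
      have "divides_value g2 p (x mod p)" using that g2 divides_value_mod by blast
      then have "x mod p \<in> ?R2" using prime_gt_0_nat[OF assms(1)] by simp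
      then have "x mod p \<in> ?R" unfolding eq .
      then show ?thesis by (simp only: mem_Collect_eq divides_value_mod)
    qed
    have steps: "divides_value fs p (j * d + x) \<Longrightarrow> divides_value fs p x" for j x
      by (induction j) (auto intro: step simp: add.assoc)
    have "?R \<noteq> {}" using pos unfolding root_count_altdef by (metis card.empty less_irrefl)
    then obtain y where y: "divides_value fs p y" by auto
    have "coprime d p" using assms(1) d by (metis coprime_commute prime_imp_coprime)
    then obtain c where c: "[d * c = 1] (mod p)" by (metis One_nat_def cong_solve_coprime_nat)
    have "divides_value fs p t" for t
    proof -
      have p1: "1 \<le> p" using prime_gt_0_nat[OF assms(1)] by simp
      \<comment> \<open>\<open>p - 1\<close> plays the role of \<open>-1\<close> in the naturals:
        modulo \<open>p\<close>, the root \<open>y\<close> is \<open>t\<close> plus a multiple of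
        \<open>d\<close>, and \<open>steps\<close> descends from it to \<open>t\<close>.\<close>
      have "[(d * c) * (y + (p - 1) * t) + t = 1 * (y + (p - 1) * t) + t] (mod p)"
        by (intro cong_add cong_mult c cong_refl)
      also have "1 * (y + (p - 1) * t) + t = y + p * t"
        using p1 by (cases p) auto
      also have "[y + p * t = y] (mod p)" by (simp add: cong_def)
      finally have "divides_value fs p ((d * c) * (y + (p - 1) * t) + t)" using y divides_value_cong by blast
      then show ?thesis using steps[of "c * (y + (p - 1) * t)" t] by (simp add: mult_ac)
    qed
    then show False using divides_value_not_all[OF assms(1)] by blast
  qed
  then have "?R \<subset> ?R2" using sub by blast
  then show "\<nu> p < root_count p g2" unfolding root_count_altdef by (intro psubset_card_mono) auto
qed

text \<open>Let \<open>p\<close> be large. If \<open>\<nu> p > 0\<close>, the pair has at least one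
  more root, so \<open>\<rho> p \<le> 1 - 1 / p\<close>; as \<open>\<nu> p \<le> M\<close>, in all
  cases \<open>\<rho> p \<le> exp (- \<nu> p / (M p))\<close>. Conversely
  \<open>1 - \<nu> p / p \<ge> exp (- 2 \<nu> p / p)\<close>. Hence the product is bounded by
  \<open>(V y / V w)^(1 / (2 M))\<close>, and the decay of \<open>V\<close> carries over.\<close>

lemma pair_density_tendsto_0:
  assumes "d > 0"
  shows "(\<lambda>y. (\<Prod>p\<in>\<P> y. \<delta> (fs @ affine_family 1 d fs) p) / V y) \<longlonglongrightarrow> 0"
proof -
  define g2 where "g2 = fs @ affine_family 1 d fs"
  define \<rho> where "\<rho> = (\<lambda>p. \<delta> g2 p / \<delta> fs p)"
  \<comment> \<open>Beyond \<open>w\<close> no prime divides \<open>d\<close>, and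
    \<open>\<nu> p / p \<le> 1/2\<close>.\<close>
  define w where "w = max d (2 * M)"
  define S where "S = (\<lambda>y. \<Sum>p\<in>\<R> w y. real (\<nu> p) / real p)"
  have \<rho>0: "0 \<le> \<rho> p" if "prime p" for p
    unfolding \<rho>_def using local_factor_nonneg[OF that, of g2] local_factor_pos[OF that] by auto
  have \<rho>1: "\<rho> p \<le> 1" if "prime p" for p
  proof -
    have "real (\<nu> p) / real p \<le> real (root_count p g2) / real p"
      using root_count_pair(1)[OF that, of d] by (intro divide_right_mono) (auto simp: g2_def)
    then show ?thesis unfolding \<rho>_def using local_factor_pos[OF that] by simp
  qed
  have \<rho>e: "\<rho> p \<le> exp (- (real (\<nu> p) / real p) / real M)" if p: "prime p" "p > w" for p
  proof (cases "\<nu> p = 0")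
    case True
    then show ?thesis using \<rho>1[OF p(1)] by simp
  next
    case False
    have p0: "real p > 0" using prime_gt_0_nat[OF p(1)] by simp
    have "\<not> p dvd d" using p(2) assms unfolding w_def by (auto dest: dvd_imp_le)
    then have "real (\<nu> p) + 1 \<le> real (root_count p g2)"
      using root_count_pair(2)[OF p(1), of d] False unfolding g2_def by simp
    then have "(real (\<nu> p) + 1) / real p \<le> real (root_count p g2) / real p" by (intro divide_right_mono) auto
    then have "\<rho> p \<le> (\<delta> fs p - 1 / real p) / \<delta> fs p"
      unfolding \<rho>_def using local_factor_pos[OF p(1)] by (intro divide_right_mono) (auto simp: add_divide_distrib)
    also have "\<dots> = 1 - (1 / real p) / \<delta> fs p"
    proof -
      have "(x - c) / x = 1 - c / x" if "x > 0" for x c :: real using that by (simp add: diff_divide_distrib)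
      from this[OF local_factor_pos[OF p(1)]] show ?thesis .
    qed
    also have "\<dots> \<le> 1 - (1 / real p) / 1"
      using local_factor_pos[OF p(1)] p0 by (intro diff_left_mono divide_left_mono) auto
    also have "\<dots> \<le> exp (- 1 / real p)" using exp_ge_add_one_self[of "- 1 / real p"] by simp
    also have "\<dots> \<le> exp (- (real (\<nu> p) / real p) / real M)"
    proof -
      have "real (\<nu> p) / real M \<le> 1" using root_count_le_M[OF p(1)] M_pos by simp
      then have "(real (\<nu> p) / real M) / real p \<le> 1 / real p" by (intro divide_right_mono) auto
      then show ?thesis by (simp add: mult.commute)
    qed
    finally show ?thesis .
  qed
  have fin: "finite (\<R> w y)" for y by (rule finite_subset[of _ "{..y}"]) auto
  have split: "\<P> y = \<P> w \<union> \<R> w y" if "y \<ge> w" for y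
    using that by auto
  have disj: "\<P> w \<inter> \<R> w y = {}" for y by auto
  have main: "(\<Prod>p\<in>\<P> y. \<rho> p) \<le> (V y / V w) powr (1 / (2 * real M))" if y: "y \<ge> w" for y
  proof -
    have "(\<Prod>p\<in>\<P> y. \<rho> p) = (\<Prod>p\<in>\<P> w. \<rho> p) * (\<Prod>p\<in>\<R> w y. \<rho> p)"
      unfolding split[OF y] by (rule prod.union_disjoint[OF _ fin disj]) simp
    also have "\<dots> \<le> 1 * (\<Prod>p\<in>\<R> w y. exp (- (real (\<nu> p) / real p) / real M))"
      using \<rho>0 \<rho>1 \<rho>e by (intro mult_mono prod_mono prod_le_1 prod_nonneg) auto
    also have "\<dots> = exp (\<Sum>p\<in>\<R> w y. - (real (\<nu> p) / real p) / real M)"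
      using fin by (simp add: exp_sum)
    also have "(\<Sum>p\<in>\<R> w y. - (real (\<nu> p) / real p) / real M) = - S y / real M"
      unfolding S_def sum_divide_distrib[symmetric] sum_negf ..
    also have "exp (- S y / real M) = exp (- 2 * S y) powr (1 / (2 * real M))"
      using M_pos by (simp add: exp_powr_real)
    also have "\<dots> \<le> (V y / V w) powr (1 / (2 * real M))"
    proof (rule powr_mono2)
      have "V y = V w * (\<Prod>p\<in>\<R> w y. \<delta> fs p)"
        unfolding V_def split[OF y] by (rule prod.union_disjoint[OF _ fin disj]) simp
      then have "V y / V w = (\<Prod>p\<in>\<R> w y. \<delta> fs p)"
        using V_pos[of w] by simp
      moreover have "exp (- 2 * S y) = (\<Prod>p\<in>\<R> w y. exp (- 2 * (real (\<nu> p) / real p)))"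
        using fin by (simp add: S_def sum_distrib_left exp_sum)
      moreover have "(\<Prod>p\<in>\<R> w y. exp (- 2 * (real (\<nu> p) / real p))) \<le>
          (\<Prod>p\<in>\<R> w y. \<delta> fs p)"
      proof (intro prod_mono conjI)
        fix p assume p: "p \<in> \<R> w y"
        define t where "t = real (\<nu> p) / real p"
        have "2 * \<nu> p \<le> p" using root_count_le_M[of p] p unfolding w_def by auto
        then have t: "0 \<le> t" "t \<le> 1/2" using p prime_gt_0_nat[of p] by (auto simp: t_def field_simps)
        have "1 \<le> (1 - t) * (1 + 2 * t)" using t mult_nonneg_nonneg[of t "1 - 2 * t"] by (simp add: algebra_simps)
        also have "\<dots> \<le> (1 - t) * exp (2 * t)" using t exp_ge_add_one_self[of "2 * t"] by (intro mult_left_mono) auto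
        finally show "exp (- 2 * (real (\<nu> p) / real p)) \<le> \<delta> fs p"
          unfolding t_def[symmetric] by (simp add: exp_minus field_simps)
      qed auto
      ultimately show "exp (- 2 * S y) \<le> V y / V w" by simp
    qed auto
    finally show ?thesis .
  qed
  have "(\<lambda>y. (V y / V w) powr (1 / (2 * real M))) \<longlonglongrightarrow> 0"
  proof -
    have "(\<lambda>y. (V y / V w) powr (1 / (2 * real M))) \<longlonglongrightarrow> (0 / V w) powr (1 / (2 * real M))"
      using V_pos M_pos by (intro tendsto_powr' tendsto_divide V_tendsto_0 tendsto_const) (auto intro!: always_eventually less_imp_le simp: less_imp_neq[symmetric])
    then show ?thesis by simp
  qed
  moreover have "(\<Prod>p\<in>\<P> y. \<delta> g2 p) / V y = (\<Prod>p\<in>\<P> y. \<rho> p)" for y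
    unfolding V_def \<rho>_def by (rule prod_dividef[symmetric])
  moreover have "(\<lambda>y. \<Prod>p\<in>\<P> y. \<rho> p) \<longlonglongrightarrow> 0"
  proof (rule tendsto_sandwich[OF _ _ tendsto_const calculation(1)])
    show "\<forall>\<^sub>F y in sequentially. 0 \<le> (\<Prod>p\<in>\<P> y. \<rho> p)"
      using \<rho>0 by (intro always_eventually allI prod_nonneg) simp
    show "\<forall>\<^sub>F y in sequentially. (\<Prod>p\<in>\<P> y. \<rho> p) \<le> (V y / V w) powr (1 / (2 * real M))"
      using main by (rule eventually_sequentiallyI)
  qed
  ultimately have "(\<lambda>y. (\<Prod>p\<in>\<P> y. \<delta> g2 p) / V y) \<longlonglongrightarrow> 0"
    by (simp only:)
  then show ?thesis unfolding g2_def .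
qed

text \<open>In the class of \<open>a\<close> modulo the primorial no value is divisible by a prime
  up to \<open>y\<close>, so those Euler factors lose their \<open>\<delta> fs p\<close>. At larger
  primes the substitution permutes the residues.\<close>

lemma singular_series_progression:
  assumes a: "\<And>p. prime p \<Longrightarrow> p \<le> y \<Longrightarrow> \<not> divides_value fs p a"
  shows "primitive_family (affine_family (Q y) a fs)" "singular_series (affine_family (Q y) a fs) = \<SS> / V y"
proof -
  let ?g = "affine_family (Q y) a fs"
  have pQ: "p dvd Q y \<longleftrightarrow> p \<le> y" if pp: "prime p" for p
  proof
    assume "p dvd Q y"
    then obtain q where "prime q" "q \<le> y" "p dvd q" unfolding Q_def
      using prime_dvd_prod_iff[of "\<P> y" p "\<lambda>x. x"] pp by auto
    then show "p \<le> y" using pp primes_dvd_imp_eq by blast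
  next
    assume "p \<le> y"
    then show "p dvd Q y" unfolding Q_def using pp by (intro dvd_prodI) auto
  qed
  show "primitive_family ?g"
  proof (rule primitive_affine_family[OF prim Q_pos])
    fix f assume f: "f \<in> set fs"
    show "coprime (poly f (int a)) (int (Q y))"
    proof -
      have "coprime (poly f (int a)) (int p)" if p: "p \<in> \<P> y" for p
      proof -
        have "\<not> int p dvd poly f (int a)" using a[of p] p f by (auto simp: divides_value_def)
        then show ?thesis using p by (metis coprime_commute mem_Collect_eq prime_imp_coprime prime_nat_int_transfer)
      qed
      then show ?thesis unfolding Q_def of_nat_prod by (intro prod_coprime_right)
    qed
  qed
  have rc: "root_count p ?g = (if p \<le> y then 0 else \<nu> p)" if p: "prime p" for p
  proof (cases "p \<le> y")
    case True
    then have "p dvd Q y" using pQ p by blast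
    then have "\<not> divides_value ?g p x" for x
      using a[OF p True] divides_value_cong[of "a + Q y * x" a p fs]
      unfolding divides_value_affine_family by (auto simp: cong_def mod_add_right_eq[symmetric] elim!: dvdE)
    then show ?thesis using True by (simp add: root_count_altdef)
  next
    case False
    then have "coprime (Q y) p" using pQ[OF p] p by (metis coprime_commute prime_imp_coprime)
    then show ?thesis using False by (simp add: root_count_affine_family)
  qed
  have "singular_partial_prod ?g Y = singular_partial_prod fs Y / V y" if Y: "Y \<ge> y" for Y
  proof -
    have "singular_partial_prod ?g Y = (\<Prod>p\<in>\<P> Y.
        \<delta> fs p * (1 - 1 / real p) powi (- int m) * (if p \<le> y then 1 / \<delta> fs p else 1))"
      unfolding singular_partial_prod_def length_affine_family
    proof (intro prod.cong refl)
      fix p assume "p \<in> \<P> Y"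
      then have "prime p" by simp
      then show "\<delta> ?g p * (1 - 1 / real p) powi (- int m) =
          \<delta> fs p * (1 - 1 / real p) powi (- int m) * (if p \<le> y then 1 / \<delta> fs p else 1)"
        using rc local_factor_pos[of p] by auto
    qed
    also have "\<dots> = singular_partial_prod fs Y * (\<Prod>p\<in>\<P> Y. if p \<le> y then 1 / \<delta> fs p else 1)"
      by (simp only: prod.distrib singular_partial_prod_def)
    also have "(\<Prod>p\<in>\<P> Y. if p \<le> y then 1 / \<delta> fs p else 1) =
        (\<Prod>p\<in>\<P> y. 1 / \<delta> fs p)"
      using Y by (intro prod.mono_neutral_cong_right) auto
    also have "\<dots> = 1 / V y" unfolding V_def by (subst prod_dividef) simp
    finally show ?thesis by simp
  qed
  then have "\<forall>\<^sub>F Y in sequentially. singular_partial_prod fs Y / V y = singular_partial_prod ?g Y"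
    by (intro eventually_sequentiallyI[of y]) simp
  moreover have "(\<lambda>Y. singular_partial_prod fs Y / V y) \<longlonglongrightarrow> \<SS> / V y"
    using V_pos[of y] by (intro tendsto_divide partial_prod_tendsto tendsto_const) auto
  ultimately have lim: "singular_partial_prod ?g \<longlonglongrightarrow> \<SS> / V y" by (rule Lim_transform_eventually[rotated])
  then show "singular_series ?g = \<SS> / V y"
    using limI[OF lim] convergentI[OF lim] singular_series_def[of ?g] by presburger
qed

text \<open>\<open>fs\<close> together with its shift by \<open>d\<close> may contain repetitions,
  so the conjecture is applied to \<open>fs\<close> alone in residue classes modulo a primorial
  \<open>q\<close>. The second seed only selects the classes: \<open>q * V2 y\<close> of them, each
  holding asymptotically a share \<open>1 / (q * V y)\<close> of the seeds. The total share
  \<open>V2 y / V y\<close> can be made small.\<close>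

lemma prime_seed_pairs_rare:
  assumes BH: "uniform_Bateman_Horn" and d: "d > 0"
  shows "(\<lambda>N. real (card {n. n \<le> N \<and> prime_seed fs n \<and> prime_seed fs (n + d)}) * ln (real N) ^ m / real N) \<longlonglongrightarrow> 0"
proof -
  define T where "T = (\<lambda>N. {n. n \<le> N \<and> prime_seed fs n \<and> prime_seed fs (n + d)})"
  define g2 where "g2 = fs @ affine_family 1 d fs"
  define V2 where "V2 = (\<lambda>y. \<Prod>p\<in>\<P> y. \<delta> g2 p)"
  define l where "l = (\<lambda>N::nat. ln (real N) ^ m / real N)"
  have l: "l \<longlonglongrightarrow> 0" unfolding l_def by real_asymp
  have "\<exists>u. u \<longlonglongrightarrow> \<SS> / real (peg fs) * (V2 y / V y) \<and> (\<forall>N. real (card (T N)) * l N \<le> u N)" for y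
  proof -
    define q where "q = Q y"
    have q: "q > 0" using Q_pos by (simp add: q_def)
    define Adm where "Adm = {a\<in>{0..<q}. \<forall>p. prime p \<and> p \<le> y \<longrightarrow> \<not> divides_value g2 p a}"
    have cardAdm: "real (card Adm) = real q * V2 y"
      unfolding Adm_def V2_def q_def Q_def by (rule card_values_coprime_primorial)
    define F where "F = (\<lambda>a. affine_family q a fs)"
    \<comment> \<open>The exceptions: \<open>n\<close> at which some value is itself a prime up to
      \<open>y\<close>. Every other \<open>n\<close> that starts a pair lies in an admissible
      class.\<close>
    define E where "E = (\<Union>f\<in>set g2. \<Union>p\<in>\<P> y. {n. poly f (int n) = int p})"
    have finE: "finite E"
    proof -
      have "degree f \<ge> 1" if "f \<in> set g2" for f
        using that prim primitive_affine_1[of d] by (auto simp: g2_def primitive_family_def)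
      then show ?thesis unfolding E_def by (intro finite_UN_I card_value_eq_le(1)) auto
    qed
    \<comment> \<open>The inserted \<open>a\<close> accounts for \<open>t = 0\<close>, because a
      prime seed is at least 1.\<close>
    let ?Z = "\<lambda>N a. insert a ((\<lambda>t. a + q * t) ` {t. prime_seed (F a) t \<and> real t \<le> real (N div q)})"
    have sub: "T N \<subseteq> E \<union> (\<Union>a\<in>Adm. ?Z N a)" for N
    proof
      fix n assume "n \<in> T N"
      then have n: "n \<le> N" "prime_seed fs n" "prime_seed fs (n + d)" by (auto simp: T_def)
      have seed2: "prime (poly f (int n))" if "f \<in> set g2" for f
        using that n ball_affine_family[of 1 d fs prime n] by (auto simp: g2_def prime_seed_def add.commute)
      show "n \<in> E \<union> (\<Union>a\<in>Adm. ?Z N a)"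
      proof (cases "\<exists>p. prime p \<and> p \<le> y \<and> divides_value g2 p n")
        case True
        then obtain p f where p: "prime p" "p \<le> y" "f \<in> set g2" "int p dvd poly f (int n)"
          by (auto simp: divides_value_def)
        then have "poly f (int n) = int p" using seed2[OF p(3)] by (metis prime_nat_int_transfer primes_dvd_imp_eq)
        then have "n \<in> E" using p unfolding E_def by blast
        then show ?thesis by blast
      next
        case False
        have pdvd: "p dvd q" if "prime p" "p \<le> y" for p
          unfolding q_def Q_def using that by (intro dvd_prodI) auto
        have "divides_value g2 p (n mod q) \<longleftrightarrow> divides_value g2 p n" if "prime p" "p \<le> y" for p
          using pdvd[OF that] by (intro divides_value_cong) (simp add: cong_def mod_mod_cancel)
        then have adm: "n mod q \<in> Adm" using False q unfolding Adm_def by auto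
        have eq: "n mod q + q * (n div q) = n" by simp
        show ?thesis
        proof (cases "n div q = 0")
          case True
          then have "n = n mod q" using eq by simp
          then show ?thesis using adm by blast
        next
          case False
          have "prime_seed (F (n mod q)) (n div q)"
            using n(2) False unfolding F_def prime_seed_affine_family eq by (auto simp: prime_seed_def)
          moreover have "n div q \<le> N div q" using n(1) by (rule div_le_mono)
          ultimately have "n \<in> (\<lambda>t. n mod q + q * t) ` {t. prime_seed (F (n mod q)) t \<and> real t \<le> real (N div q)}"
            using eq by (intro image_eqI[of _ _ "n div q"]) auto
          then show ?thesis using adm by blast
        qed
      qed
    qed
    define u where "u = (\<lambda>N. (real (card E) + (\<Sum>a\<in>Adm. 1 + real (seed_count (real (N div q)) (F a)))) * l N)"
    have "real (card (T N)) * l N \<le> u N" for N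
    proof -
      have finA: "finite Adm" by (simp add: Adm_def)
      have "card (T N) \<le> card (E \<union> (\<Union>a\<in>Adm. ?Z N a))"
        using finE finA by (intro card_mono sub) auto
      also have "\<dots> \<le> card E + card (\<Union>a\<in>Adm. ?Z N a)"
        by (rule card_Un_le)
      also have "\<dots> \<le> card E + (\<Sum>a\<in>Adm. card (?Z N a))"
        by (intro add_left_mono card_UN_le finA)
      also have "\<dots> \<le> card E + (\<Sum>a\<in>Adm. 1 + seed_count (real (N div q)) (F a))"
      proof (intro add_left_mono sum_mono)
        fix a
        have "card (?Z N a) \<le>
            Suc (card ((\<lambda>t. a + q * t) ` {t. prime_seed (F a) t \<and> real t \<le> real (N div q)}))"
          by (rule card_insert_le_m1) auto
        also have "\<dots> \<le> Suc (seed_count (real (N div q)) (F a))"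
          unfolding seed_count_def Suc_le_mono by (rule card_image_le) simp
        finally show "card (?Z N a) \<le> 1 + seed_count (real (N div q)) (F a)"
          by simp
      qed
      finally have "real (card (T N)) \<le> real (card E) + (\<Sum>a\<in>Adm. 1 + real (seed_count (real (N div q)) (F a)))"
        by (simp flip: of_nat_sum of_nat_add of_nat_Suc)
      moreover have "l N \<ge> 0" by (cases "N = 0") (auto simp: l_def)
      ultimately show ?thesis unfolding u_def by (rule mult_right_mono)
    qed
    moreover have "u \<longlonglongrightarrow> \<SS> / real (peg fs) * (V2 y / V y)"
    proof -
      have one: "(\<lambda>N. real (seed_count (real (N div q)) (F a)) * l N) \<longlonglongrightarrow> \<SS> / V y / real (peg fs) * (1 / real q)"
        if "a \<in> Adm" for a
      proof -
        let ?l = "\<lambda>N. ln (real (N div q))" and ?c = "\<lambda>N. real (seed_count (real (N div q)) (F a))"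
        have "\<not> divides_value fs p a" if "prime p" "p \<le> y" for p
          using \<open>a \<in> Adm\<close> that unfolding Adm_def g2_def by (auto simp: divides_value_append)
        then have prog: "primitive_family (F a)" "singular_series (F a) = \<SS> / V y"
          unfolding F_def q_def by (intro singular_series_progression; blast)+
        have "singular_series (F a) \<noteq> 0" unfolding prog(2) using singular_nz V_pos[of y] by simp
        from Bateman_Horn_fixed[OF BH prog(1) this]
        have bh: "(\<lambda>N. real (seed_count (real N) (F a)) * ln (real N) ^ m / real N) \<longlonglongrightarrow> \<SS> / V y / real (peg fs)"
          unfolding prog(2) using q by (simp add: F_def peg_affine_family)
        have divq: "filterlim (\<lambda>N. N div q) at_top at_top"
        proof (unfold filterlim_at_top, intro allI)
          fix Z
          show "\<forall>\<^sub>F N in sequentially. Z \<le> N div q"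
            using q by (intro eventually_sequentiallyI[of "Z * q"]) (simp add: less_eq_div_iff_mult_less_eq)
        qed
        have lim1: "(\<lambda>N. ?c N * ?l N ^ m / real (N div q)) \<longlonglongrightarrow> \<SS> / V y / real (peg fs)"
          by (rule filterlim_compose[OF bh divq])
        have lim2: "(\<lambda>N. real (N div q) / real N) \<longlonglongrightarrow> 1 / real q"
        proof (rule tendsto_sandwich[of "\<lambda>N. 1 / real q - 1 / real N" _ _ "\<lambda>N. 1 / real q"])
          show "\<forall>\<^sub>F N in sequentially. real (N div q) / real N \<le> 1 / real q"
          proof (rule eventually_sequentiallyI[of 1])
            fix N :: nat assume N: "1 \<le> N"
            have "real (N div q) \<le> real N / real q" by (rule of_nat_div_le_of_nat)
            then have "real (N div q) / real N \<le> real N / real q / real N" by (intro divide_right_mono) auto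
            then show "real (N div q) / real N \<le> 1 / real q" using N by simp
          qed
          show "\<forall>\<^sub>F N in sequentially. 1 / real q - 1 / real N \<le> real (N div q) / real N"
          proof (rule eventually_sequentiallyI[of 1])
            fix N :: nat assume N: "1 \<le> N"
            have "N < q * Suc (N div q)" using q by (simp add: dividend_less_times_div)
            then have "real N \<le> real q * (real (N div q) + 1)" by (metis less_imp_le of_nat_Suc of_nat_le_iff of_nat_mult add.commute)
            then have "real N / real q - 1 \<le> real (N div q)" using q by (simp add: field_simps)
            then have "(real N / real q - 1) / real N \<le> real (N div q) / real N" by (intro divide_right_mono) auto
            then show "1 / real q - 1 / real N \<le> real (N div q) / real N" using N by (simp add: diff_divide_distrib)
          qed
          have "(\<lambda>N. 1 / real q - 1 / real N) \<longlonglongrightarrow> 1 / real q - 0" by (intro tendsto_intros lim_1_over_n)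
          then show "(\<lambda>N. 1 / real q - 1 / real N) \<longlonglongrightarrow> 1 / real q" by simp
        qed auto
        \<comment> \<open>As \<open>q\<close> is fixed, \<open>ln N\<close> and
          \<open>ln (N div q)\<close> differ by a bounded amount.\<close>
        have lim3: "(\<lambda>N. (ln (real N) / ?l N) ^ m) \<longlonglongrightarrow> 1"
        proof -
          have "(\<lambda>N. ln (real (N div q) / real N)) \<longlonglongrightarrow> ln (1 / real q)"
            using q by (intro tendsto_ln lim2) auto
          moreover have "(\<lambda>N::nat. 1 / ln (real N)) \<longlonglongrightarrow> 0" by real_asymp
          then have lninv: "(\<lambda>N. 1 / ?l N) \<longlonglongrightarrow> 0" by (rule filterlim_compose[OF _ divq])
          ultimately have "(\<lambda>N. 1 - ln (real (N div q) / real N) * (1 / ?l N)) \<longlonglongrightarrow> 1 - ln (1 / real q) * 0"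
            using lninv by (intro tendsto_diff tendsto_mult tendsto_const)
          moreover have "\<forall>\<^sub>F N in sequentially. N div q \<ge> 2" using divq unfolding filterlim_at_top by blast
          then have "\<forall>\<^sub>F N in sequentially. 1 - ln (real (N div q) / real N) * (1 / ?l N) = ln (real N) / ?l N"
          proof eventually_elim
            case (elim N)
            then have "N > 0" by (auto intro!: Nat.gr0I)
            then have "ln (real (N div q) / real N) = ?l N - ln (real N)" using elim by (simp add: ln_div)
            moreover have "?l N > 0" using elim by simp
            ultimately show ?case by (simp add: field_simps)
          qed
          ultimately have "(\<lambda>N. ln (real N) / ?l N) \<longlonglongrightarrow> 1" using Lim_transform_eventually by fastforce
          from tendsto_power[OF this, of m] show ?thesis by simp
        qed
        have "(\<lambda>N. ?c N * ?l N ^ m / real (N div q) *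
            (real (N div q) / real N) * (ln (real N) / ?l N) ^ m) \<longlonglongrightarrow> \<SS> / V y / real (peg fs) * (1 / real q) * 1"
          by (intro tendsto_mult lim1 lim2 lim3)
        moreover have "\<forall>\<^sub>F N in sequentially. N div q \<ge> 2" using divq unfolding filterlim_at_top by blast
        then have "\<forall>\<^sub>F N in sequentially. ?c N * ?l N ^ m / real (N div q) *
            (real (N div q) / real N) * (ln (real N) / ?l N) ^ m = ?c N * l N"
        proof eventually_elim
          case (elim N)
          have "?l N ^ m > 0" "real (N div q) > 0" using elim by auto
          moreover have "c * x / D * (D / n) * (z / x) = c * (z / n)" if "x > 0" "D > 0" for c x D n z :: real
            using that by simp
          ultimately show ?case unfolding l_def power_divide by blast
        qed
        ultimately show ?thesis using Lim_transform_eventually by fastforce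
      qed
      have "(\<lambda>N. real (card E) * l N + (\<Sum>a\<in>Adm. l N + real (seed_count (real (N div q)) (F a)) * l N)) \<longlonglongrightarrow>
          real (card E) * 0 + (\<Sum>a\<in>Adm. 0 + \<SS> / V y / real (peg fs) * (1 / real q))"
        by (intro tendsto_intros l one)
      also have "(\<lambda>N. real (card E) * l N + (\<Sum>a\<in>Adm. l N + real (seed_count (real (N div q)) (F a)) * l N)) = u"
        by (simp add: u_def fun_eq_iff distrib_right sum_distrib_right)
      also have "real (card E) * 0 + (\<Sum>a\<in>Adm. 0 + \<SS> / V y / real (peg fs) * (1 / real q)) = \<SS> / real (peg fs) * (V2 y / V y)"
        using q by (simp add: cardAdm mult_ac)
      finally show ?thesis .
    qed
    ultimately show ?thesis by blast
  qed
  note upper = this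
  have "(\<lambda>N. real (card (T N)) * l N) \<longlonglongrightarrow> 0"
  proof (rule tendstoI)
    fix e :: real assume e: "e > 0"
    \<comment> \<open>First \<open>y\<close> is fixed, then \<open>N\<close> grows: the upper bound
      \<open>u\<close> depends on \<open>y\<close>.\<close>
    have "(\<lambda>y. \<SS> / real (peg fs) * (V2 y / V y)) \<longlonglongrightarrow> 0"
      unfolding V2_def g2_def by (intro tendsto_mult_right_zero pair_density_tendsto_0 d)
    then have "\<forall>\<^sub>F y in sequentially. \<SS> / real (peg fs) * (V2 y / V y) < e" using e by (rule order_tendstoD(2))
    then obtain y where y: "\<SS> / real (peg fs) * (V2 y / V y) < e" by (auto simp: eventually_sequentially)
    obtain u where u: "u \<longlonglongrightarrow> \<SS> / real (peg fs) * (V2 y / V y)" "\<And>N. real (card (T N)) * l N \<le> u N"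
      using upper[of y] by blast
    have "\<forall>\<^sub>F N in sequentially. u N < e" using u(1) y by (rule order_tendstoD(2))
    then show "\<forall>\<^sub>F N in sequentially. dist (real (card (T N)) * l N) 0 < e"
      using eventually_ge_at_top[of 1]
    proof eventually_elim
      case (elim N)
      have "real (card (T N)) * l N \<ge> 0" using elim(2) by (simp add: l_def)
      then show ?case using u(2)[of N] elim(1) by (simp add: dist_real_def)
    qed
  qed
  then show ?thesis by (simp add: T_def l_def)
qed

end

section \<open>Poisson distribution in short intervals\<close>

lemma card_distinct_lists:
  assumes "finite A"
  shows "card {xs. length xs = k \<and> distinct xs \<and> set xs \<subseteq> A} = fact k * (card A choose k)"
proof (cases "k \<le> card A")
  case True
  have "card {xs. length xs = k \<and> distinct xs \<and> set xs \<subseteq> A} = fact (card A) div fact (card A - k)"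
    using assms True by (simp add: card_lists_distinct_length_eq fact_div_fact)
  also have "\<dots> = fact k * (card A choose k)"
    using binomial_fact_lemma[OF True] by (metis fact_nonzero mult.commute mult.left_commute nonzero_mult_div_cancel_right)
  finally show ?thesis .
next
  case False
  have "{xs. length xs = k \<and> distinct xs \<and> set xs \<subseteq> A} = {}"
    using False card_mono[OF assms] by (auto simp flip: distinct_card)
  then show ?thesis using False by (simp only: card.empty binomial_eq_0 not_le mult_0_right)
qed

lemma seed_count_diff:
  assumes "x \<ge> 0"
  shows "int (seed_count (real n + x) fs) - int (seed_count (real n) fs) =
    int (card {k. prime_seed fs k \<and> n < k \<and> k \<le> n + nat \<lfloor>x\<rfloor>})"
proof -
  have le: "real k \<le> real n + x \<longleftrightarrow> k \<le> n + nat \<lfloor>x\<rfloor>" for k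
    using assms by linarith
  have "{k. prime_seed fs k \<and> real k \<le> real n + x} =
      {k. prime_seed fs k \<and> real k \<le> real n} \<union> {k. prime_seed fs k \<and> n < k \<and> k \<le> n + nat \<lfloor>x\<rfloor>}"
    unfolding le by auto
  moreover have "finite {k. prime_seed fs k \<and> n < k \<and> k \<le> n + nat \<lfloor>x\<rfloor>}"
    by (rule finite_subset[of _ "{..n + nat \<lfloor>x\<rfloor>}"]) auto
  ultimately have "seed_count (real n + x) fs = seed_count (real n) fs + card {k. prime_seed fs k \<and> n < k \<and> k \<le> n + nat \<lfloor>x\<rfloor>}"
    unfolding seed_count_def by (simp only:) (rule card_Un_disjoint, auto)
  then show ?thesis by simp
qed

context separated_family
begin

text \<open>\<open>P h\<close> will say that \<open>n + h\<close> is a prime seed; the cardinality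
  is then the factorial moment at \<open>n\<close> restricted to separated tuples.\<close>

definition Sep_in :: "nat \<Rightarrow> nat \<Rightarrow> (nat \<Rightarrow> bool) \<Rightarrow> nat list set" where
  "Sep_in k K P = {hs \<in> Sep k K. \<forall>h\<in>set hs. P h}"

lemma finite_Sep_in [simp]: "finite (Sep_in k K P)" by (simp add: Sep_in_def)

text \<open>A pair \<open>(A, B)\<close> is sent to the separated tuple \<open>l\<close> consisting
  of \<open>A\<close> and those entries of \<open>B\<close> that are far from all of
  \<open>A\<close>. It has at most \<open>2 * k\<close> entries, and every entry of \<open>B\<close>
  is within \<open>L\<close> of one of them. So, given \<open>l\<close>, each of the
  \<open>k\<close> entries of \<open>B\<close> has at most \<open>2 * k * (2 * L + 1)\<close>
  possibilities.\<close>

lemma card_Sep_in_square_le: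
  "real (card (Sep_in k K P)) ^ 2 \<le> real ((2 * k * (2 * L + 1)) ^ k) * (\<Sum>j\<le>2*k. real (card (Sep_in j K P)))"
proof -
  define near where "near = (\<lambda>l::nat list. \<Union>x\<in>set l. {x - L..x + L})"
  define \<Phi> where "\<Phi> = (\<lambda>(A, B). (A @ filter (\<lambda>b. \<forall>a\<in>set A. far a b) B, B))"
  define T where "T = (\<Union>j\<le>2*k. Sep_in j K P)"
  define N where "N = (\<lambda>l. {B. set B \<subseteq> near l \<and> length B = k})"
  have finT: "finite T" by (simp add: T_def)
  have fin_near: "finite (near l)" for l by (simp add: near_def)
  have finN: "finite (N l)" for l unfolding N_def by (rule finite_lists_length_eq[OF fin_near])
  have cardN: "card (N l) \<le> (2 * k * (2 * L + 1)) ^ k" if "l \<in> T" for l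
  proof -
    have len: "length l \<le> 2 * k" using that by (auto simp: T_def Sep_in_def Sep_def)
    have "card (near l) \<le> (\<Sum>x\<in>set l. card {x - L..x + L})" unfolding near_def by (rule card_UN_le) simp
    also have "\<dots> \<le> (\<Sum>x\<in>set l. 2 * L + 1)" by (intro sum_mono) auto
    also have "\<dots> = card (set l) * (2 * L + 1)" by (simp only: sum_constant of_nat_id)
    also have "\<dots> \<le> 2 * k * (2 * L + 1)" using len card_length[of l] by (intro mult_le_mono1) linarith
    finally have "card (near l) \<le> 2 * k * (2 * L + 1)" .
    then show ?thesis unfolding N_def by (subst card_lists_length_eq[OF fin_near]) (rule power_mono, auto)
  qed
  have inj: "inj_on \<Phi> (Sep_in k K P \<times> Sep_in k K P)"
    by (rule inj_on_inverseI[where g = "\<lambda>(l, B). (take k l, B)"]) (auto simp: \<Phi>_def Sep_in_def Sep_def)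
  have img: "\<Phi> ` (Sep_in k K P \<times> Sep_in k K P) \<subseteq> (SIGMA l:T. N l)"
  proof
    fix z assume "z \<in> \<Phi> ` (Sep_in k K P \<times> Sep_in k K P)"
    then obtain A B where AB: "A \<in> Sep_in k K P" "B \<in> Sep_in k K P" "z = \<Phi> (A, B)" by auto
    let ?F = "filter (\<lambda>b. \<forall>a\<in>set A. far a b) B"
    have A: "length A = k" "set A \<subseteq> {1..K}" "sorted_wrt far A" "\<forall>h\<in>set A. P h"
      and B: "length B = k" "set B \<subseteq> {1..K}" "sorted_wrt far B" "\<forall>h\<in>set B. P h"
      using AB by (auto simp: Sep_in_def Sep_def)
    have "length (A @ ?F) \<le> 2 * k" using A(1) B(1) length_filter_le[of "\<lambda>b. \<forall>a\<in>set A. far a b" B] by simp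
    moreover have "sorted_wrt far (A @ ?F)"
      using A(3) sorted_wrt_filter[OF B(3)] by (auto simp: sorted_wrt_append)
    ultimately have "A @ ?F \<in> T"
      using A B by (auto simp: T_def Sep_in_def Sep_def)
    moreover have "set B \<subseteq> near (A @ ?F)"
    proof
      fix b assume b: "b \<in> set B"
      show "b \<in> near (A @ ?F)"
      proof (cases "\<forall>a\<in>set A. far a b")
        case True
        then have "b \<in> set ?F" using b by simp
        moreover have "b \<in> {b - L..b + L}" by simp
        ultimately show ?thesis unfolding near_def set_append by blast
      next
        case False
        then obtain a where "a \<in> set A" "\<not> far a b" by blast
        then have "a \<in> set A" "b \<in> {a - L..a + L}" by auto
        then show ?thesis unfolding near_def set_append by blast
      qed
    qed
    ultimately show "z \<in> (SIGMA l:T. N l)" using AB(3) B(1) by (simp add: \<Phi>_def N_def)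
  qed
  have "card (Sep_in k K P) ^ 2 = card (\<Phi> ` (Sep_in k K P \<times> Sep_in k K P))"
    by (simp add: card_image[OF inj] power2_eq_square card_cartesian_product)
  also have "\<dots> \<le> card (SIGMA l:T. N l)" using finT finN by (intro card_mono img) auto
  also have "\<dots> = (\<Sum>l\<in>T. card (N l))" using finT finN by simp
  also have "\<dots> \<le> (\<Sum>l\<in>T. (2 * k * (2 * L + 1)) ^ k)" by (intro sum_mono cardN)
  also have "\<dots> = (2 * k * (2 * L + 1)) ^ k * card T" by simp
  also have "\<dots> \<le> (2 * k * (2 * L + 1)) ^ k * (\<Sum>j\<le>2*k. card (Sep_in j K P))"
    unfolding T_def by (intro mult_left_mono card_UN_le) auto
  finally have "real (card (Sep_in k K P) ^ 2) \<le> real ((2 * k * (2 * L + 1)) ^ k * (\<Sum>j\<le>2*k. card (Sep_in j K P)))"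
    by (simp only: of_nat_le_iff)
  then show ?thesis by (simp only: of_nat_power of_nat_mult of_nat_sum)
qed

text \<open>Where the points satisfying \<open>P\<close> are never close, being separated is the
  same as being distinct.\<close>

lemma card_Sep_in_separated:
  assumes "\<And>h h'. h \<in> {1..K} \<Longrightarrow> h' \<in> {1..K} \<Longrightarrow> P h \<Longrightarrow> P h' \<Longrightarrow> h < h' \<Longrightarrow> h + L < h'"
  shows "card (Sep_in k K P) = fact k * (card {h\<in>{1..K}. P h} choose k)"
proof -
  have "Sep_in k K P = {hs. length hs = k \<and> distinct hs \<and> set hs \<subseteq> {h\<in>{1..K}. P h}}"
  proof (intro equalityI subsetI)
    fix hs assume "hs \<in> Sep_in k K P"
    then have hs: "length hs = k" "set hs \<subseteq> {1..K}" "sorted_wrt far hs" "\<forall>h\<in>set hs. P h"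
      by (auto simp: Sep_in_def Sep_def)
    have "distinct hs" using hs(3) by (induction hs) auto
    then show "hs \<in> {hs. length hs = k \<and> distinct hs \<and> set hs \<subseteq> {h\<in>{1..K}. P h}}" using hs by auto
  next
    fix hs assume "hs \<in> {hs. length hs = k \<and> distinct hs \<and> set hs \<subseteq> {h\<in>{1..K}. P h}}"
    then have hs: "length hs = k" "distinct hs" "set hs \<subseteq> {h\<in>{1..K}. P h}" by auto
    have "sorted_wrt far hs" using hs(2,3)
    proof (induction hs)
      case (Cons h hs)
      have "far h h'" if "h' \<in> set hs" for h'
      proof -
        have "h \<noteq> h'" using Cons.prems that by auto
        moreover have "h \<in> {1..K}" "h' \<in> {1..K}" "P h" "P h'" using Cons.prems that by auto
        ultimately show ?thesis using assms[of h h'] assms[of h' h] by (meson linorder_neqE_nat)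
      qed
      then show ?case using Cons by auto
    qed simp
    then show "hs \<in> Sep_in k K P" using hs by (auto simp: Sep_in_def Sep_def)
  qed
  then show ?thesis by (simp only:) (rule card_distinct_lists, simp)
qed

theorem prime_seeds_in_short_intervals:
  assumes BH: "uniform_Bateman_Horn" and lam: "lam > 0"
  shows "(\<lambda>N. real (card {n\<in>{1..N}. card {k. prime_seed fs k \<and> n < k \<and> k \<le> n + nat \<lfloor>lam * mean_spacing N fs\<rfloor>} = r}) / real N)
    \<longlonglongrightarrow> exp (- lam) * (lam ^ r / fact r)"
proof -
  define K where "K = (\<lambda>N. nat \<lfloor>lam * mean_spacing N fs\<rfloor>)"
  define X where "X = (\<lambda>N n. card {k. prime_seed fs k \<and> n < k \<and> k \<le> n + K N})"
  define Y where "Y = (\<lambda>k N n. card (Sep_in k (K N) (\<lambda>h. prime_seed fs (n + h))))"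
  define Bad where "Bad = (\<lambda>N. {n\<in>{1..N}. \<exists>s d. 1 \<le> d \<and> d \<le> L \<and> prime_seed fs s \<and> prime_seed fs (s + d) \<and> n < s \<and> s + d \<le> n + K N})"
  define D where "D = (\<lambda>N::nat. real (peg fs) * ln (real N) ^ m)"
  have spacing: "lam * mean_spacing N fs = lam / \<SS> * D N" for N
    by (simp add: mean_spacing_def D_def)
  have Dtop: "filterlim D at_top at_top"
  proof -
    have "filterlim (\<lambda>N::nat. ln (real N) ^ m) at_top at_top"
      using m_pos by (intro filterlim_pow_at_top) (auto, real_asymp)
    then show ?thesis unfolding D_def using peg_pos by (intro filterlim_tendsto_pos_mult_at_top[OF tendsto_const]) auto
  qed
  have c: "lam / \<SS> > 0" using lam singular_pos by simp
  have Dnonneg: "D N \<ge> 0" for N by (cases "N = 0") (auto simp: D_def)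
  have Kbounds: "real (K N) \<le> lam / \<SS> * D N" "lam / \<SS> * D N - 1 \<le> real (K N)" for N
    using c Dnonneg[of N] mult_nonneg_nonneg[of "lam / \<SS>" "D N"] unfolding K_def spacing by linarith+
  have Ktop: "filterlim K at_top at_top"
  proof -
    have "filterlim (\<lambda>N. lam / \<SS> * D N) at_top at_top"
      by (rule filterlim_tendsto_pos_mult_at_top[OF tendsto_const c Dtop])
    then show ?thesis unfolding K_def spacing
      by (intro filterlim_compose[OF filterlim_nat_sequentially] filterlim_compose[OF filterlim_floor_sequentially])
  qed
  have Dpos: "\<forall>\<^sub>F N in sequentially. D N > 0"
    using Dtop unfolding filterlim_at_top_dense by blast
  have Klim: "(\<lambda>N. real (K N) / D N) \<longlonglongrightarrow> lam / \<SS>"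
  proof (rule tendsto_sandwich[OF _ _ _ tendsto_const])
    show "\<forall>\<^sub>F N in sequentially. real (K N) / D N \<le> lam / \<SS>"
      using Dpos by eventually_elim (use Kbounds in \<open>simp add: divide_le_eq\<close>)
    show "\<forall>\<^sub>F N in sequentially. lam / \<SS> - 1 / D N \<le> real (K N) / D N"
      using Dpos
    proof eventually_elim
      case (elim N)
      have "(lam / \<SS> * D N - 1) / D N \<le> real (K N) / D N" using elim Kbounds by (intro divide_right_mono) auto
      then show ?case using elim by (simp add: diff_divide_distrib)
    qed
    have "(\<lambda>N. 1 / D N) \<longlonglongrightarrow> 0" using tendsto_inverse_0_at_top[OF Dtop] by (simp add: inverse_eq_divide)
    from tendsto_diff[OF tendsto_const this] show "(\<lambda>N. lam / \<SS> - 1 / D N) \<longlonglongrightarrow> lam / \<SS>" by simp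
  qed
  have "(\<lambda>N. real (card {n\<in>{1..N}. X N n = r}) / real N) \<longlonglongrightarrow> exp (- lam) * (lam ^ r / fact r)"
  proof (rule poisson_limit_of_moments[where Y = Y and Bad = Bad])
    fix k
    \<comment> \<open>With the sums exchanged, a fixed \<open>hs\<close> asks for the
      \<open>n\<close> at which all \<open>n + h\<close> are seeds, which is a seed count of the
      shifted family.\<close>
    have "(\<Sum>n=1..N. real (Y k N n)) = (\<Sum>hs\<in>Sep k (K N). real (seed_count (real N) (\<F> hs)))" for N
    proof -
      have "(\<Sum>n=1..N. real (Y k N n)) = (\<Sum>n=1..N. \<Sum>hs\<in>Sep k (K N). of_bool (\<forall>h\<in>set hs. prime_seed fs (n + h)))"
        by (intro sum.cong refl) (simp add: Y_def Sep_in_def of_bool_def sum.If_cases Int_def)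
      also have "\<dots> = (\<Sum>hs\<in>Sep k (K N). \<Sum>n=1..N. of_bool (\<forall>h\<in>set hs. prime_seed fs (n + h)))"
        by (rule sum.swap)
      also have "\<dots> = (\<Sum>hs\<in>Sep k (K N). real (seed_count (real N) (\<F> hs)))"
      proof (intro sum.cong refl)
        fix hs
        have "{n. prime_seed (\<F> hs) n \<and> real n \<le> real N} = {n\<in>{1..N}. \<forall>h\<in>set hs. prime_seed fs (n + h)}"
          by (auto simp: prime_seed_shifted_family)
        then show "(\<Sum>n=1..N. of_bool (\<forall>h\<in>set hs. prime_seed fs (n + h))) = real (seed_count (real N) (\<F> hs))"
          unfolding seed_count_def by (simp add: of_bool_def sum.If_cases Int_def)
      qed
      finally show ?thesis .
    qed
    then show "(\<lambda>N. (\<Sum>n=1..N. real (Y k N n)) / real N) \<longlonglongrightarrow> lam ^ k"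
      using seed_count_shifted_average[OF BH Ktop Klim[unfolded D_def], of k] by simp
    show "\<exists>C. \<forall>N n. real (Y k N n) ^ 2 \<le> C * (\<Sum>j\<le>2*k. real (Y j N n))"
      unfolding Y_def using card_Sep_in_square_le by blast
  next
    fix k N n assume n: "n \<in> {1..N} - Bad N"
    have "card (Sep_in k (K N) (\<lambda>h. prime_seed fs (n + h))) = fact k * (card {h\<in>{1..K N}. prime_seed fs (n + h)} choose k)"
    proof (rule card_Sep_in_separated)
      fix h h' assume h: "h \<in> {1..K N}" "h' \<in> {1..K N}" "prime_seed fs (n + h)" "prime_seed fs (n + h')" "h < h'"
      show "h + L < h'"
      proof (rule ccontr)
        assume "\<not> h + L < h'"
        then have "1 \<le> h' - h \<and> h' - h \<le> L \<and> prime_seed fs (n + h) \<and> prime_seed fs (n + h + (h' - h)) \<and>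
            n < n + h \<and> n + h + (h' - h) \<le> n + K N"
          using h by auto
        then have "n \<in> Bad N" using n unfolding Bad_def by blast
        then show False using n by simp
      qed
    qed
    moreover have "bij_betw (\<lambda>h. n + h) {h\<in>{1..K N}. prime_seed fs (n + h)} {k. prime_seed fs k \<and> n < k \<and> k \<le> n + K N}"
      by (rule bij_betwI[where g = "\<lambda>k. k - n"]) auto
    then have "card {h\<in>{1..K N}. prime_seed fs (n + h)} = X N n" unfolding X_def by (rule bij_betw_same_card)
    ultimately show "Y k N n = fact k * (X N n choose k)" by (simp add: Y_def)
  next
    fix N show "Bad N \<subseteq> {1..N}" by (auto simp: Bad_def)
  next
    define T where "T = (\<lambda>d N. {n. n \<le> N \<and> prime_seed fs n \<and> prime_seed fs (n + d)})"
    define t where "t = (\<lambda>d N. real (card (T d N)) * ln (real N) ^ m / real N)"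
    \<comment> \<open>Taken at \<open>2 * N\<close> because a pair that makes some
      \<open>n \<le> N\<close> bad may start beyond \<open>N\<close>, though not beyond
      \<open>N + K N\<close>.\<close>
    have tlim: "(\<lambda>N. t d (2 * N)) \<longlonglongrightarrow> 0" if "d \<in> {1..L}" for d
    proof -
      have "t d \<longlonglongrightarrow> 0" unfolding t_def T_def using that by (intro prime_seed_pairs_rare[OF BH]) auto
      moreover have "filterlim (\<lambda>N::nat. 2 * N) at_top at_top" by (intro mult_nat_left_at_top) simp
      ultimately show ?thesis by (rule filterlim_compose)
    qed
    have KN: "\<forall>\<^sub>F N in sequentially. K N \<le> N"
    proof -
      have "(\<lambda>N::nat. ln (real N) ^ m / real N) \<longlonglongrightarrow> 0" by real_asymp
      then have "(\<lambda>N::nat. lam / \<SS> * real (peg fs) * (ln (real N) ^ m / real N)) \<longlonglongrightarrow> 0" by (rule tendsto_mult_right_zero)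
      then have "\<forall>\<^sub>F N::nat in sequentially. lam / \<SS> * real (peg fs) * (ln (real N) ^ m / real N) < 1"
        by (rule order_tendstoD) simp
      then show ?thesis using eventually_gt_at_top[of 0]
      proof eventually_elim
        case (elim N)
        then have "(lam / \<SS> * D N) / real N < 1" by (simp add: D_def)
        then have "lam / \<SS> * D N < real N" using elim(2) by (subst (asm) pos_divide_less_eq) auto
        then show ?case using Kbounds(1)[of N] by linarith
      qed
    qed
    \<comment> \<open>A close pair starting at \<open>s\<close> spoils only the \<open>n\<close>
      with \<open>s - K N \<le> n < s\<close>. There are \<open>o(N / (ln N)^m)\<close> such pairs
      and \<open>K N\<close> has the order of \<open>(ln N)^m\<close>, so few \<open>n\<close> are
      bad.\<close>
    have Badle: "card (Bad N) \<le> (\<Sum>d\<in>{1..L}. card (T d (2 * N)) * K N)" if "K N \<le> N" for N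
    proof -
      have finT: "finite (T d N')" for d N' by (rule finite_subset[of _ "{..N'}"]) (auto simp: T_def)
      have "Bad N \<subseteq> (\<Union>d\<in>{1..L}. \<Union>s\<in>T d (2 * N). {s - K N..<s})"
      proof
        fix n assume "n \<in> Bad N"
        then obtain s d where sd: "n \<le> N" "1 \<le> d" "d \<le> L" "prime_seed fs s" "prime_seed fs (s + d)" "n < s" "s + d \<le> n + K N"
          by (auto simp: Bad_def)
        then have "s \<in> T d (2 * N)" "n \<in> {s - K N..<s}" using that by (auto simp: T_def)
        then show "n \<in> (\<Union>d\<in>{1..L}. \<Union>s\<in>T d (2 * N). {s - K N..<s})" using sd by auto
      qed
      then have "card (Bad N) \<le> card (\<Union>d\<in>{1..L}. \<Union>s\<in>T d (2 * N). {s - K N..<s})"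
        using finT by (intro card_mono) auto
      also have "\<dots> \<le> (\<Sum>d\<in>{1..L}. card (\<Union>s\<in>T d (2 * N). {s - K N..<s}))" by (rule card_UN_le) simp
      also have "\<dots> \<le> (\<Sum>d\<in>{1..L}. card (T d (2 * N)) * K N)"
      proof (rule sum_mono)
        fix d
        have "card (\<Union>s\<in>T d (2 * N). {s - K N..<s}) \<le> (\<Sum>s\<in>T d (2 * N). card {s - K N..<s})"
          by (rule card_UN_le[OF finT])
        also have "\<dots> \<le> (\<Sum>s\<in>T d (2 * N). K N)" by (intro sum_mono) simp
        also have "\<dots> = card (T d (2 * N)) * K N" by simp
        finally show "card (\<Union>s\<in>T d (2 * N). {s - K N..<s}) \<le> card (T d (2 * N)) * K N" .
      qed
      finally show ?thesis .
    qed
    have lnge: "\<forall>\<^sub>F N::nat in sequentially. ln (real N) \<ge> 1" by real_asymp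
    have le: "\<forall>\<^sub>F N in sequentially. real (card (Bad N)) / real N \<le> (\<Sum>d\<in>{1..L}. t d (2 * N)) * (2 * real (peg fs) * (real (K N) / D N))"
      using KN lnge eventually_gt_at_top[of 0]
    proof eventually_elim
      case (elim N)
      have l: "ln (real N) ^ m > 0" using elim(2) by (intro zero_less_power) linarith
      have "real (card (Bad N)) / real N \<le> (\<Sum>d\<in>{1..L}. real (card (T d (2 * N))) * real (K N)) / real N"
        using Badle[OF elim(1)] by (intro divide_right_mono) (auto simp flip: of_nat_mult of_nat_sum)
      also have "\<dots> = (\<Sum>d\<in>{1..L}. real (card (T d (2 * N))) * real (K N) / real N)" by (simp add: sum_divide_distrib)
      also have "\<dots> \<le> (\<Sum>d\<in>{1..L}. t d (2 * N) * (2 * real (peg fs) * (real (K N) / D N)))"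
      proof (rule sum_mono)
        fix d
        let ?T = "real (card (T d (2 * N)))"
        have "ln (real N) ^ m \<le> ln (real (2 * N)) ^ m" using elim by (intro power_mono) auto
        then have "?T * ln (real N) ^ m \<le> ?T * ln (real (2 * N)) ^ m" by (intro mult_left_mono) auto
        then have "?T * ln (real N) ^ m / (2 * real N) \<le> t d (2 * N)"
          unfolding t_def using divide_right_mono[of _ _ "2 * real N"] by fastforce
        then have "?T * ln (real N) ^ m / (2 * real N) * (2 * real (peg fs) * (real (K N) / D N)) \<le>
            t d (2 * N) * (2 * real (peg fs) * (real (K N) / D N))"
          using Dnonneg[of N] by (intro mult_right_mono) auto
        moreover have "?T * ln (real N) ^ m / (2 * real N) * (2 * real (peg fs) * (real (K N) / D N)) = ?T * real (K N) / real N"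
        proof -
          have "a * x / (2 * n) * (2 * b * (z / (b * x))) = a * z / n" if "x > 0" "b > 0" for a b x z n :: real
            using that by simp
          moreover have "real (peg fs) > 0" using peg_pos by simp
          ultimately show ?thesis using l unfolding D_def by blast
        qed
        ultimately show "?T * real (K N) / real N \<le> t d (2 * N) * (2 * real (peg fs) * (real (K N) / D N))" by simp
      qed
      finally show ?case by (simp only: sum_distrib_right)
    qed
    have "(\<lambda>N. (\<Sum>d\<in>{1..L}. t d (2 * N)) * (2 * real (peg fs) * (real (K N) / D N))) \<longlonglongrightarrow>
        (\<Sum>d\<in>{1..L}. 0) * (2 * real (peg fs) * (lam / \<SS>))"
      by (intro tendsto_mult tendsto_sum tlim tendsto_const Klim)
    then have lim: "(\<lambda>N. (\<Sum>d\<in>{1..L}. t d (2 * N)) * (2 * real (peg fs) * (real (K N) / D N))) \<longlonglongrightarrow> 0" by simp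
    have "\<forall>\<^sub>F N in sequentially. 0 \<le> real (card (Bad N)) / real N" by simp
    then show "(\<lambda>N. real (card (Bad N)) / real N) \<longlonglongrightarrow> 0"
      by (rule tendsto_sandwich[OF _ le tendsto_const lim])
  qed
  then show ?thesis unfolding X_def K_def .
qed

end

text \<open>The difference polynomial of the product of the family is nonzero, so it has finitely
  many zeros, and \<open>L\<close> bounds their absolute values.\<close>

lemma ex_separated_family:
  assumes "primitive_family fs" "singular_series fs \<noteq> 0"
  shows "\<exists>G L. separated_family fs G L"
proof -
  have "0 \<notin> set fs" using assms(1) by (auto simp: primitive_family_def)
  then have "prod_list fs \<noteq> 0" by (simp add: prod_list_zero_iff)
  then obtain G :: "int poly" where G: "G \<noteq> 0"
    "\<And>n x y. n dvd poly (prod_list fs) x \<Longrightarrow> n dvd poly (prod_list fs) y \<Longrightarrow> n dvd poly G (x - y)"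
    using ex_difference_poly by blast
  have "finite {d. poly G d = 0}" using G(1) by (rule poly_roots_finite)
  then have "finite ((\<lambda>d. nat \<bar>d\<bar>) ` {d. poly G d = 0})" by simp
  then obtain L where L: "\<And>d. poly G d = 0 \<Longrightarrow> nat \<bar>d\<bar> \<le> L" by (auto simp: finite_nat_set_iff_bounded_le)
  have "separated_family fs G L"
  proof
    fix d :: int assume "\<bar>d\<bar> > int L"
    then show "poly G d \<noteq> 0" using L[of d] by auto
  qed (use assms G in auto)
  then show ?thesis by blast
qed

theorem theorem1p3:
  fixes fs :: "int poly list" and lam :: real and r :: nat
  assumes "uniform_Bateman_Horn"
    and "primitive_family fs"
    and "singular_series fs \<noteq> 0"
    and "lam > 0"
  shows "(\<lambda>N. 1 / real N * real (card {n::nat. 1 \<le> n \<and> n \<le> N \<and>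
              int (seed_count (real n + lam * mean_spacing N fs) fs) - int (seed_count (real n) fs) = int r}))
            \<longlonglongrightarrow> exp (- lam) * (lam ^ r / fact r) \<and>
         (\<lambda>N. pmf (map_pmf
              (\<lambda>n. card {k. prime_seed fs k \<and> real k \<in> {real n<..real n + lam * ln (real N) ^ length fs}})
              (pmf_of_set {1..N})) r)
            \<longlonglongrightarrow> pmf (poisson_pmf (singular_series fs / real (peg fs) * lam)) r"
proof -
  obtain G L where "separated_family fs G L" using ex_separated_family assms(2,3) by blast
  then interpret separated_family fs G L .
  let ?f = "\<lambda>N. \<lambda>n. card {k. prime_seed fs k \<and> real k \<in> {real n<..real n + lam * ln (real N) ^ length fs}}"
  define c where "c = (\<lambda>x N n. card {k. prime_seed fs k \<and> n < k \<and> k \<le> n + nat \<lfloor>x * mean_spacing N fs\<rfloor>})"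
  have lim: "(\<lambda>N. real (card {n\<in>{1..N}. c x N n = r}) / real N) \<longlonglongrightarrow> exp (- x) * (x ^ r / fact r)" if "x > 0" for x
    unfolding c_def by (rule prime_seeds_in_short_intervals[OF assms(1) that])
  have spacing: "mean_spacing N fs \<ge> 0" for N
    using singular_pos by (cases "N = 0") (auto simp: mean_spacing_def)
  have "{n. 1 \<le> n \<and> n \<le> N \<and>
      int (seed_count (real n + lam * mean_spacing N fs) fs) - int (seed_count (real n) fs) = int r} = {n\<in>{1..N}. c lam N n = r}" for N
    using assms(4) spacing[of N] by (auto simp: seed_count_diff c_def)
  then have 1: "(\<lambda>N. 1 / real N * real (card {n::nat. 1 \<le> n \<and> n \<le> N \<and>
              int (seed_count (real n + lam * mean_spacing N fs) fs) - int (seed_count (real n) fs) = int r}))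
            \<longlonglongrightarrow> exp (- lam) * (lam ^ r / fact r)"
    using lim[OF assms(4)] by simp
  \<comment> \<open>Chosen so that \<open>lam * (ln N)^m = mu * mean_spacing N fs\<close>; the
    second limit is thus the first with \<open>mu\<close> in place of \<open>lam\<close>.\<close>
  define mu where "mu = singular_series fs / real (peg fs) * lam"
  have mu: "mu > 0" unfolding mu_def using assms(4) singular_pos peg_pos by simp
  have mus: "mu * mean_spacing N fs = lam * ln (real N) ^ length fs" for N
    using singular_pos peg_pos by (simp add: mu_def mean_spacing_def)
  have "\<forall>\<^sub>F N in sequentially. real (card {n\<in>{1..N}. c mu N n = r}) / real N =
      pmf (map_pmf (?f N) (pmf_of_set {1..N})) r"
  \<comment> \<open>\<open>pmf_of_set\<close> is the uniform distribution only on a nonempty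
    set.\<close>
  proof (rule eventually_sequentiallyI[of 1])
    fix N :: nat assume N: "1 \<le> N"
    have "real k \<in> {real n<..real n + lam * ln (real N) ^ length fs} \<longleftrightarrow> n < k \<and> k \<le> n + nat \<lfloor>mu * mean_spacing N fs\<rfloor>" for n k
      unfolding mus[of N, symmetric] using mult_nonneg_nonneg[OF less_imp_le[OF mu] spacing[of N]]
      by (auto; linarith)
    then have "?f N = c mu N"
      by (simp only: c_def)
    then show "real (card {n\<in>{1..N}. c mu N n = r}) / real N =
      pmf (map_pmf (?f N) (pmf_of_set {1..N})) r"
      using N by (simp add: pmf_map measure_pmf_of_set vimage_def Int_def)
  qed
  from Lim_transform_eventually[OF lim[OF mu] this] have 2: "(\<lambda>N. pmf (map_pmf (?f N) (pmf_of_set {1..N})) r)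
            \<longlonglongrightarrow> pmf (poisson_pmf (singular_series fs / real (peg fs) * lam)) r"
    using mu unfolding mu_def by (simp add: mult.commute)
  show ?thesis using 1 2 by blast
qed

end
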